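(* Let $n\ge2$, let $W(\tilde C_n)$ be the Coxeter group of type $\tilde C_n$, let $c$ be a Coxeter element of $W(\tilde C_n)$ and let $w\in W(\tilde C_n)$ be a divisor of $c$ (for the reflection length). Then the Hurwitz action is transitive on the set of reduced decompositions of $w$.
   Context: $W(\tilde C_n)$ is the Coxeter group with simple reflections $\sigma_0,\dots,\sigma_n$, where $\sigma_0\sigma_1$ and $\sigma_{n-1}\sigma_n$ have order $4$, $\sigma_i\sigma_{i+1}$ has order $3$ for $1\le i\le n-2$, and $\sigma_i,\sigma_j$ commute for $|i-j|\ge2$. A Coxeter element is a product of all simple reflections, each taken once, in some order. Reflections are the conjugates of simple reflections. $l_C(w)$ denotes the minimal number of reflections in an expression of $w$ as a product of reflections; $w$ is a divisor of $c$ if $l_C(w)+l_C(w^{-1}c)=l_C(c)$. A reduced decomposition of $w$ is a tuple $(r_1,\dots,r_k)$ of reflections of $W(\tilde C_n)$ with $k=l_C(w)$ and $w=r_1\cdots r_k$. Hurwitz action: for $g$ in a group $G$, the braid group on $k$ strands acts on the set of $k$-tuples $(g_1,\dots,g_k)$ of elements of $G$ with $g=g_1\cdots g_k$; the $i$-th elementary braid maps $(g_1,\dots,g_k)$ to $(g_1,\dots,g_{i-1},g_ig_{i+1}g_i^{-1},g_i,g_{i+2},\dots,g_k)$. Since conjugates of reflections are reflections, this restricts to an action of the braid group on $l_C(w)$ strands on the reduced decompositions of $w$. *)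

theory Defs
  imports "HOL-Algebra.Group_Action"
begin

section \<open>Groups given by generators and relations\<close>

text \<open>
  The letter \<open>(s, True)\<close> stands for the generator \<open>s\<close> and \<open>(s, False)\<close> for its formal inverse.
  A defining relation \<open>l = r\<close> is a pair \<open>(l, r)\<close> of words; pairs that involve letters
  outside \<open>S\<close> are ignored.
\<close>

type_synonym 's word = "('s \<times> bool) list"

abbreviation words :: "'s set \<Rightarrow> 's word set"
  where "words S \<equiv> lists (S \<times> UNIV)"

inductive_set pres_cong :: "'s set \<Rightarrow> ('s word \<times> 's word) set \<Rightarrow> ('s word \<times> 's word) set"
  for S :: "'s set" and R :: "('s word \<times> 's word) set" where
  pc_refl: "u \<in> words S \<Longrightarrow> (u, u) \<in> pres_cong S R"
| pc_sym: "(u, v) \<in> pres_cong S R \<Longrightarrow> (v, u) \<in> pres_cong S R"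
| pc_trans: "(u, v) \<in> pres_cong S R \<Longrightarrow> (v, w) \<in> pres_cong S R \<Longrightarrow> (u, w) \<in> pres_cong S R"
| pc_cancel: "u \<in> words S \<Longrightarrow> v \<in> words S \<Longrightarrow> s \<in> S
    \<Longrightarrow> (u @ [(s, b), (s, \<not> b)] @ v, u @ v) \<in> pres_cong S R"
| pc_relation: "u \<in> words S \<Longrightarrow> v \<in> words S \<Longrightarrow> l \<in> words S \<Longrightarrow> r \<in> words S \<Longrightarrow> (l, r) \<in> R
    \<Longrightarrow> (u @ l @ v, u @ r @ v) \<in> pres_cong S R"

definition presented_group :: "'s set \<Rightarrow> ('s word \<times> 's word) set \<Rightarrow> 's word set monoid"
  where "presented_group S R =
    \<lparr>carrier = words S // pres_cong S R,
     mult = (\<lambda>A B. \<Union>u\<in>A. \<Union>v\<in>B. pres_cong S R `` {u @ v}),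
     one = pres_cong S R `` {[]}\<rparr>"

definition pres_gen :: "'s set \<Rightarrow> ('s word \<times> 's word) set \<Rightarrow> 's \<Rightarrow> 's word set"
  where "pres_gen S R s = pres_cong S R `` {[(s, True)]}"

lemma pres_cong_words: "(u, v) \<in> pres_cong S R \<Longrightarrow> u \<in> words S \<and> v \<in> words S"
  by (induction rule: pres_cong.induct) auto

lemma equiv_pres_cong: "equiv (words S) (pres_cong S R)"
proof (rule equivI)
  show "pres_cong S R \<subseteq> words S \<times> words S" by (auto dest: pres_cong_words)
  show "refl_on (words S) (pres_cong S R)" by (intro refl_onI pc_refl)
  show "sym (pres_cong S R)" by (rule symI) (rule pc_sym)
  show "trans (pres_cong S R)" by (rule transI) (rule pc_trans)
qed

lemma pres_cong_append_context:
  "(u, v) \<in> pres_cong S R \<Longrightarrow> x \<in> words S \<Longrightarrow> y \<in> words S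
    \<Longrightarrow> (x @ u @ y, x @ v @ y) \<in> pres_cong S R"
proof (induction rule: pres_cong.induct)
  case (pc_refl u)
  then show ?case by (intro pres_cong.pc_refl) auto
next
  case (pc_sym u v)
  show ?case by (rule pres_cong.pc_sym) (rule pc_sym.IH[OF pc_sym.prems])
next
  case (pc_trans u v w)
  show ?case
    by (rule pres_cong.pc_trans[OF pc_trans.IH(1)[OF pc_trans.prems] pc_trans.IH(2)[OF pc_trans.prems]])
next
  case (pc_cancel u v s b)
  then show ?case using pres_cong.pc_cancel[of "x @ u" S "v @ y" s b R] by simp
next
  case (pc_relation u v l r)
  then show ?case using pres_cong.pc_relation[of "x @ u" S "v @ y" l r R] by simp
qed

lemma pres_cong_append:
  assumes "(u, u') \<in> pres_cong S R" "(v, v') \<in> pres_cong S R"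
  shows "(u @ v, u' @ v') \<in> pres_cong S R"
proof -
  have "(u @ v, u' @ v) \<in> pres_cong S R"
    using pres_cong_append_context[OF assms(1), of "[]" v] pres_cong_words[OF assms(2)] by simp
  moreover have "(u' @ v, u' @ v') \<in> pres_cong S R"
    using pres_cong_append_context[OF assms(2), of u' "[]"] pres_cong_words[OF assms(1)] by simp
  ultimately show ?thesis by (rule pc_trans)
qed

lemma presented_group_mult_class:
  assumes "u \<in> words S" "v \<in> words S"
  shows "(pres_cong S R `` {u}) \<otimes>\<^bsub>presented_group S R\<^esub> (pres_cong S R `` {v})
    = pres_cong S R `` {u @ v}"
proof -
  have "congruent2 (pres_cong S R) (pres_cong S R) (\<lambda>u v. pres_cong S R `` {u @ v})"
    by (rule congruent2I') (rule equiv_class_eq[OF equiv_pres_cong pres_cong_append])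
  from UN_equiv_class2[OF equiv_pres_cong equiv_pres_cong this assms] show ?thesis
    by (simp add: presented_group_def)
qed

lemma words_inverse: "u \<in> words S \<Longrightarrow> rev (map (apsnd Not) u) \<in> words S"
  by (fastforce simp: in_lists_conv_set)

lemma inverse_word_inverse: "rev (map (apsnd Not) (rev (map (apsnd Not) u))) = u"
  by (simp add: rev_map comp_def apsnd_def map_prod_def case_prod_unfold)

lemma pres_cong_inverse:
  "u \<in> words S \<Longrightarrow> (rev (map (apsnd Not) u) @ u, []) \<in> pres_cong S R"
proof (induction u)
  case Nil
  then show ?case by (simp add: pc_refl)
next
  case (Cons a u)
  obtain s b where a: "a = (s, b)" by (cases a)
  have w: "rev (map (apsnd Not) u) \<in> words S" "u \<in> words S" "s \<in> S"
    using Cons.prems a words_inverse[of u S] by auto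
  have "(rev (map (apsnd Not) u) @ [(s, \<not> b), (s, \<not> \<not> b)] @ u,
      rev (map (apsnd Not) u) @ u) \<in> pres_cong S R"
    by (rule pc_cancel) (use w in auto)
  then show ?case using pc_trans[OF _ Cons.IH[OF w(2)]] a by simp
qed

lemma group_presented_group: "group (presented_group S R)"
proof (rule groupI)
  let ?G = "presented_group S R"
  let ?q = "\<lambda>u. pres_cong S R `` {u}"
  have car: "carrier ?G = words S // pres_cong S R"
    by (simp add: presented_group_def)
  have one: "\<one>\<^bsub>?G\<^esub> = ?q []"
    by (simp add: presented_group_def)
  note mul = presented_group_mult_class[of _ S _ R]
  have obt: "\<And>x. x \<in> carrier ?G \<Longrightarrow> \<exists>u\<in>words S. x = ?q u"
    unfolding car by (auto elim: quotientE)
  have app: "\<And>u v. u \<in> words S \<Longrightarrow> v \<in> words S \<Longrightarrow> u @ v \<in> words S" by auto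
  have cl: "\<And>u. u \<in> words S \<Longrightarrow> ?q u \<in> carrier ?G"
    unfolding car by (rule quotientI)
  show "x \<otimes>\<^bsub>?G\<^esub> y \<in> carrier ?G" if "x \<in> carrier ?G" "y \<in> carrier ?G" for x y
    using obt[OF that(1)] obt[OF that(2)] by (elim bexE) (simp only: mul app cl)
  show "\<one>\<^bsub>?G\<^esub> \<in> carrier ?G" by (simp add: one cl)
  show "x \<otimes>\<^bsub>?G\<^esub> y \<otimes>\<^bsub>?G\<^esub> z = x \<otimes>\<^bsub>?G\<^esub> (y \<otimes>\<^bsub>?G\<^esub> z)"
    if "x \<in> carrier ?G" "y \<in> carrier ?G" "z \<in> carrier ?G" for x y z
    using obt[OF that(1)] obt[OF that(2)] obt[OF that(3)]
    by (elim bexE) (simp only: mul app append_assoc)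
  show "\<one>\<^bsub>?G\<^esub> \<otimes>\<^bsub>?G\<^esub> x = x" if "x \<in> carrier ?G" for x
    using obt[OF that] by (elim bexE) (simp only: mul one lists.Nil append_Nil)
  show "\<exists>y\<in>carrier ?G. y \<otimes>\<^bsub>?G\<^esub> x = \<one>\<^bsub>?G\<^esub>" if "x \<in> carrier ?G" for x
  proof -
    obtain u where u: "u \<in> words S" "x = ?q u"
      using obt[OF \<open>x \<in> carrier ?G\<close>] by blast
    note r = words_inverse[OF u(1)]
    show ?thesis
      using mul[OF r u(1)] equiv_class_eq[OF equiv_pres_cong pres_cong_inverse[OF u(1)]] u(2) one
      by (intro bexI[OF _ cl[OF r]]) simp
  qed
qed


section \<open>Coxeter groups\<close>

text \<open>
  The entry \<open>0\<close> of a Coxeter matrix encodes \<open>\<infinity>\<close>: the relation is then the trivial one.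
  The diagonal entries \<open>1\<close> make the generators involutions.
\<close>

definition coxeter_relations :: "'s set \<Rightarrow> ('s \<Rightarrow> 's \<Rightarrow> nat) \<Rightarrow> ('s word \<times> 's word) set"
  where "coxeter_relations S m =
    {(concat (replicate (m s t) [(s, True), (t, True)]), []) | s t. s \<in> S \<and> t \<in> S}"

definition coxeter_group :: "'s set \<Rightarrow> ('s \<Rightarrow> 's \<Rightarrow> nat) \<Rightarrow> 's word set monoid"
  where "coxeter_group S m = presented_group S (coxeter_relations S m)"

definition simple_reflection :: "'s set \<Rightarrow> ('s \<Rightarrow> 's \<Rightarrow> nat) \<Rightarrow> 's \<Rightarrow> 's word set"
  where "simple_reflection S m s = pres_gen S (coxeter_relations S m) s"

definition list_prod :: "('a, 'b) monoid_scheme \<Rightarrow> 'a list \<Rightarrow> 'a"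
  where "list_prod G xs = foldr (\<otimes>\<^bsub>G\<^esub>) xs \<one>\<^bsub>G\<^esub>"

definition reflections :: "'s set \<Rightarrow> ('s \<Rightarrow> 's \<Rightarrow> nat) \<Rightarrow> 's word set set"
  where "reflections S m =
    {g \<otimes>\<^bsub>coxeter_group S m\<^esub> simple_reflection S m s \<otimes>\<^bsub>coxeter_group S m\<^esub> inv\<^bsub>coxeter_group S m\<^esub> g
      | g s. g \<in> carrier (coxeter_group S m) \<and> s \<in> S}"

definition is_coxeter_element :: "'s set \<Rightarrow> ('s \<Rightarrow> 's \<Rightarrow> nat) \<Rightarrow> 's word set \<Rightarrow> bool"
  where "is_coxeter_element S m c \<longleftrightarrow>
    (\<exists>xs. distinct xs \<and> set xs = S \<and>
      c = list_prod (coxeter_group S m) (map (simple_reflection S m) xs))"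

definition reflection_length :: "'s set \<Rightarrow> ('s \<Rightarrow> 's \<Rightarrow> nat) \<Rightarrow> 's word set \<Rightarrow> nat"
  where "reflection_length S m w =
    (LEAST k. \<exists>rs. length rs = k \<and> set rs \<subseteq> reflections S m \<and> list_prod (coxeter_group S m) rs = w)"

definition is_divisor :: "'s set \<Rightarrow> ('s \<Rightarrow> 's \<Rightarrow> nat) \<Rightarrow> 's word set \<Rightarrow> 's word set \<Rightarrow> bool"
  where "is_divisor S m w c \<longleftrightarrow>
    reflection_length S m w
      + reflection_length S m (inv\<^bsub>coxeter_group S m\<^esub> w \<otimes>\<^bsub>coxeter_group S m\<^esub> c)
    = reflection_length S m c"

definition reduced_decompositions ::
    "'s set \<Rightarrow> ('s \<Rightarrow> 's \<Rightarrow> nat) \<Rightarrow> 's word set \<Rightarrow> 's word set list set"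
  where "reduced_decompositions S m w =
    {rs. length rs = reflection_length S m w \<and> set rs \<subseteq> reflections S m \<and>
      list_prod (coxeter_group S m) rs = w}"

definition affine_C_matrix :: "nat \<Rightarrow> nat \<Rightarrow> nat \<Rightarrow> nat"
  where "affine_C_matrix n i j =
    (if i = j then 1
     else if {i, j} = {0, 1} \<or> {i, j} = {n - 1, n} then 4
     else if i = Suc j \<or> j = Suc i then 3
     else 2)"


section \<open>The braid group and the Hurwitz action\<close>

text \<open>
  The elementary braids of the braid group on \<open>k\<close> strands are indexed from \<open>0\<close>, like positions
  in lists: the braid with index \<open>i\<close> involves the strands \<open>i\<close> and \<open>Suc i\<close>, where \<open>Suc i < k\<close>.
\<close>

definition braid_relations :: "(nat word \<times> nat word) set"
  where "braid_relations =
    {([(i, True), (j, True)], [(j, True), (i, True)]) | i j. Suc i < j}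
    \<union> {([(i, True), (Suc i, True), (i, True)], [(Suc i, True), (i, True), (Suc i, True)]) | i. True}"

definition braid_group :: "nat \<Rightarrow> nat word set monoid"
  where "braid_group k = presented_group {i. Suc i < k} braid_relations"

definition hurwitz_letter :: "('a, 'b) monoid_scheme \<Rightarrow> nat \<times> bool \<Rightarrow> 'a list \<Rightarrow> 'a list"
  where "hurwitz_letter G = (\<lambda>(i, b) t.
    if b then t[i := t ! i \<otimes>\<^bsub>G\<^esub> t ! Suc i \<otimes>\<^bsub>G\<^esub> inv\<^bsub>G\<^esub> (t ! i), Suc i := t ! i]
    else t[i := t ! Suc i, Suc i := inv\<^bsub>G\<^esub> (t ! Suc i) \<otimes>\<^bsub>G\<^esub> t ! i \<otimes>\<^bsub>G\<^esub> t ! Suc i])"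

definition hurwitz_word :: "('a, 'b) monoid_scheme \<Rightarrow> nat word \<Rightarrow> 'a list \<Rightarrow> 'a list"
  where "hurwitz_word G u = foldr (hurwitz_letter G) u"

text \<open>
  The set \<open>E\<close> is the invariant set of tuples to which the action is restricted.  All words
  representing a braid have the same effect, by \<open>hurwitz_word_cong\<close> below.
\<close>

definition hurwitz_action ::
    "('a, 'b) monoid_scheme \<Rightarrow> 'a list set \<Rightarrow> nat word set \<Rightarrow> 'a list \<Rightarrow> 'a list"
  where "hurwitz_action G E \<beta> = (\<lambda>t\<in>E. the_elem ((\<lambda>u. hurwitz_word G u t) ` \<beta>))"

abbreviation tuples :: "('a, 'b) monoid_scheme \<Rightarrow> nat \<Rightarrow> 'a list set"
  where "tuples G k \<equiv> {t. length t = k \<and> set t \<subseteq> carrier G}"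

context group
begin

lemma inv_cancel_left:
  "a \<in> carrier G \<Longrightarrow> b \<in> carrier G \<Longrightarrow> a \<otimes> (inv a \<otimes> b) = b"
  "a \<in> carrier G \<Longrightarrow> b \<in> carrier G \<Longrightarrow> inv a \<otimes> (a \<otimes> b) = b"
  by (simp_all flip: m_assoc)

lemma hurwitz_letter_closed:
  assumes "t \<in> tuples G k" "Suc (fst x) < k"
  shows "hurwitz_letter G x t \<in> tuples G k"
proof -
  have "t ! fst x \<in> carrier G" "t ! Suc (fst x) \<in> carrier G"
    using assms nth_mem[of "fst x" t] nth_mem[of "Suc (fst x)" t] by auto
  with assms show ?thesis
    by (auto simp: hurwitz_letter_def split: prod.splits
        dest!: subsetD[OF set_update_subset_insert])
qed

lemma hurwitz_letter_cancel:
  assumes "t \<in> tuples G k" "Suc i < k"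
  shows "hurwitz_letter G (i, b) (hurwitz_letter G (i, \<not> b) t) = t"
proof -
  have "t ! i \<in> carrier G" "t ! Suc i \<in> carrier G"
    using assms nth_mem[of i t] nth_mem[of "Suc i" t] by auto
  with assms show ?thesis
    by (intro nth_equalityI)
      (auto simp: hurwitz_letter_def nth_list_update inv_cancel_left m_assoc)
qed

lemma hurwitz_letter_commute:
  assumes "t \<in> tuples G k" "Suc i < j" "Suc j < k"
  shows "hurwitz_letter G (i, True) (hurwitz_letter G (j, True) t)
    = hurwitz_letter G (j, True) (hurwitz_letter G (i, True) t)"
  using assms by (intro nth_equalityI) (auto simp: hurwitz_letter_def nth_list_update)

lemma hurwitz_letter_braid:
  assumes "t \<in> tuples G k" "Suc (Suc i) < k"
  shows "hurwitz_letter G (i, True) (hurwitz_letter G (Suc i, True) (hurwitz_letter G (i, True) t))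
    = hurwitz_letter G (Suc i, True) (hurwitz_letter G (i, True) (hurwitz_letter G (Suc i, True) t))"
proof -
  have "t ! i \<in> carrier G" "t ! Suc i \<in> carrier G" "t ! Suc (Suc i) \<in> carrier G"
    using assms nth_mem[of i t] nth_mem[of "Suc i" t] nth_mem[of "Suc (Suc i)" t] by auto
  with assms show ?thesis
    by (intro nth_equalityI)
      (auto simp: hurwitz_letter_def nth_list_update inv_cancel_left m_assoc inv_mult_group)
qed

lemma hurwitz_word_closed:
  assumes "\<And>x t. Suc (fst x) < k \<Longrightarrow> t \<in> E \<Longrightarrow> hurwitz_letter G x t \<in> E"
  shows "u \<in> words {i. Suc i < k} \<Longrightarrow> t \<in> E \<Longrightarrow> hurwitz_word G u t \<in> E"
  by (induction u) (auto simp: hurwitz_word_def intro!: assms)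

lemma hurwitz_word_append: "hurwitz_word G (u @ v) t = hurwitz_word G u (hurwitz_word G v t)"
  by (simp add: hurwitz_word_def)

lemma hurwitz_word_cong:
  assumes "(u, v) \<in> pres_cong {i. Suc i < k} braid_relations" "t \<in> tuples G k"
  shows "hurwitz_word G u t = hurwitz_word G v t"
  using assms
proof (induction arbitrary: t rule: pres_cong.induct)
  case (pc_refl u)
  show ?case ..
next
  case (pc_sym u v)
  then show ?case by metis
next
  case (pc_trans u v w)
  then show ?case by metis
next
  case (pc_cancel u v s b)
  let ?t = "hurwitz_word G v t"
  have "?t \<in> tuples G k"
    using hurwitz_word_closed[OF hurwitz_letter_closed] pc_cancel by blast
  then have "hurwitz_word G [(s, b), (s, \<not> b)] ?t = ?t"
    using hurwitz_letter_cancel[of ?t k s b] pc_cancel by (simp add: hurwitz_word_def)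
  then show ?case by (simp only: hurwitz_word_append)
next
  case (pc_relation u v l r)
  let ?t = "hurwitz_word G v t"
  have "?t \<in> tuples G k"
    using hurwitz_word_closed[OF hurwitz_letter_closed] pc_relation by blast
  then have "hurwitz_word G l ?t = hurwitz_word G r ?t"
    using pc_relation hurwitz_letter_commute[of ?t k] hurwitz_letter_braid[of ?t k]
    by (auto simp: hurwitz_word_def braid_relations_def)
  then show ?case by (simp only: hurwitz_word_append)
qed

lemma hurwitz_action_class:
  assumes "E \<subseteq> tuples G k" "u \<in> words {i. Suc i < k}" "t \<in> E"
  shows "hurwitz_action G E (pres_cong {i. Suc i < k} braid_relations `` {u}) t = hurwitz_word G u t"
proof -
  let ?C = "pres_cong {i. Suc i < k} braid_relations `` {u}"
  have "u \<in> ?C" using assms(2) by (auto intro: pc_refl)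
  moreover have "\<And>v. v \<in> ?C \<Longrightarrow> hurwitz_word G v t = hurwitz_word G u t"
    using hurwitz_word_cong[OF _ subsetD[OF assms(1,3)]] by simp
  ultimately have "(\<lambda>v. hurwitz_word G v t) ` ?C = {hurwitz_word G u t}" by blast
  then show ?thesis using assms(3) by (simp add: hurwitz_action_def)
qed

lemma group_action_hurwitz:
  assumes E: "E \<subseteq> tuples G k"
    and closed: "\<And>x t. Suc (fst x) < k \<Longrightarrow> t \<in> E \<Longrightarrow> hurwitz_letter G x t \<in> E"
  shows "group_action (braid_group k) E (hurwitz_action G E)"
proof -
  let ?S = "{i. Suc i < k}"
  let ?q = "\<lambda>u. pres_cong ?S braid_relations `` {u}"
  have obt: "\<exists>u\<in>words ?S. \<beta> = ?q u" if "\<beta> \<in> carrier (braid_group k)" for \<beta>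
    using that by (auto simp: braid_group_def presented_group_def elim: quotientE)
  have inE: "\<And>u t. u \<in> words ?S \<Longrightarrow> t \<in> E \<Longrightarrow> hurwitz_word G u t \<in> E"
    using hurwitz_word_closed[of k E] closed by blast
  have bij: "hurwitz_action G E (?q u) \<in> Bij E" if u: "u \<in> words ?S" for u
  proof -
    let ?v = "rev (map (apsnd Not) u)"
    note v = words_inverse[OF u]
    have l: "hurwitz_word G ?v (hurwitz_word G u t) = t" if "t \<in> E" for t
      using hurwitz_word_cong[OF pres_cong_inverse[OF u] subsetD[OF E that]]
      by (simp add: hurwitz_word_append) (simp add: hurwitz_word_def)
    have r: "hurwitz_word G u (hurwitz_word G ?v t) = t" if "t \<in> E" for t
      using hurwitz_word_cong[OF pres_cong_inverse[OF v] subsetD[OF E that]]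
      unfolding inverse_word_inverse by (simp add: hurwitz_word_append) (simp add: hurwitz_word_def)
    have "bij_betw (hurwitz_word G u) E E"
      by (rule bij_betw_byWitness[where f' = "hurwitz_word G ?v"])
        (use l r inE[OF u] inE[OF v] in auto)
    then have "bij_betw (hurwitz_action G E (?q u)) E E"
      using hurwitz_action_class[OF E u] by (simp cong: bij_betw_cong)
    then show ?thesis by (simp add: Bij_def hurwitz_action_def)
  qed
  have "hurwitz_action G E \<in> hom (braid_group k) (BijGroup E)"
  proof (rule homI)
    fix \<beta> assume "\<beta> \<in> carrier (braid_group k)"
    then show "hurwitz_action G E \<beta> \<in> carrier (BijGroup E)"
      using obt bij by (auto simp: BijGroup_def)
  next
    fix \<beta> \<gamma> assume "\<beta> \<in> carrier (braid_group k)" "\<gamma> \<in> carrier (braid_group k)"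
    then obtain u v where u: "u \<in> words ?S" "\<beta> = ?q u" and v: "v \<in> words ?S" "\<gamma> = ?q v"
      using obt by blast
    have uv: "u @ v \<in> words ?S" using u v by auto
    have "hurwitz_action G E (?q (u @ v))
      = compose E (hurwitz_action G E (?q u)) (hurwitz_action G E (?q v))"
    proof
      fix t
      show "hurwitz_action G E (?q (u @ v)) t
        = compose E (hurwitz_action G E (?q u)) (hurwitz_action G E (?q v)) t"
      proof (cases "t \<in> E")
        case True
        then show ?thesis
          using hurwitz_action_class[OF E uv True] hurwitz_action_class[OF E v(1) True]
            hurwitz_action_class[OF E u(1) inE[OF v(1) True]]
          by (simp add: compose_def hurwitz_word_append)
      next
        case False
        then show ?thesis by (simp add: compose_def hurwitz_action_def)
      qed
    qed
    then show "hurwitz_action G E (\<beta> \<otimes>\<^bsub>braid_group k\<^esub> \<gamma>)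
      = hurwitz_action G E \<beta> \<otimes>\<^bsub>BijGroup E\<^esub> hurwitz_action G E \<gamma>"
      using bij u v presented_group_mult_class[OF u(1) v(1), of braid_relations]
      by (simp add: BijGroup_def braid_group_def)
  qed
  then show ?thesis
    by (auto simp: group_action_def group_hom_def group_hom_axioms_def group_BijGroup
        braid_group_def intro: group_presented_group)
qed

lemma list_prod_closed: "set xs \<subseteq> carrier G \<Longrightarrow> list_prod G xs \<in> carrier G"
  by (induction xs) (auto simp: list_prod_def)

lemma list_prod_append:
  "set xs \<subseteq> carrier G \<Longrightarrow> set ys \<subseteq> carrier G
    \<Longrightarrow> list_prod G (xs @ ys) = list_prod G xs \<otimes> list_prod G ys"
proof (induction xs)
  case Nil
  then show ?case using list_prod_closed[of ys] by (simp add: list_prod_def)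
next
  case (Cons x xs)
  then show ?case using list_prod_closed[of xs] list_prod_closed[of ys]
    by (simp add: list_prod_def m_assoc)
qed

lemma hurwitz_letter_prod:
  assumes "T \<subseteq> carrier G"
    and conj: "\<And>a b. a \<in> T \<Longrightarrow> b \<in> T \<Longrightarrow> a \<otimes> b \<otimes> inv a \<in> T \<and> inv a \<otimes> b \<otimes> a \<in> T"
    and "set t \<subseteq> T" "Suc (fst x) < length t"
  shows "set (hurwitz_letter G x t) \<subseteq> T \<and> list_prod G (hurwitz_letter G x t) = list_prod G t"
proof -
  obtain i e where x: "x = (i, e)" by (cases x)
  define xs ys a b where "xs = take i t" "ys = drop (Suc (Suc i)) t" "a = t ! i" "b = t ! Suc i"
  then have t: "t = xs @ a # b # ys" "length xs = i"
    using assms(4) x by (simp_all add: Cons_nth_drop_Suc flip: id_take_nth_drop)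
  have T: "a \<in> T" "b \<in> T" "set xs \<subseteq> T" "set ys \<subseteq> T" using assms(3) t by auto
  then have c: "a \<in> carrier G" "b \<in> carrier G" "set xs \<subseteq> carrier G" "set ys \<subseteq> carrier G"
    using assms(1) by auto
  have y: "list_prod G ys \<in> carrier G" using c list_prod_closed by blast
  have lc: "list_prod G (u # us) = u \<otimes> list_prod G us" for u us by (simp add: list_prod_def)
  have l0: "list_prod G [] = \<one>" by (simp add: list_prod_def)
  have h: "hurwitz_letter G x t =
      xs @ (if e then [a \<otimes> b \<otimes> inv a, a] else [b, inv b \<otimes> a \<otimes> b]) @ ys"
    using t(2) by (simp add: t(1) x hurwitz_letter_def nth_append list_update_append)
  show ?thesis
  proof
    show "set (hurwitz_letter G x t) \<subseteq> T"
      unfolding h using T conj[of a b] conj[of b a] by auto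
    show "list_prod G (hurwitz_letter G x t) = list_prod G t"
      unfolding h unfolding t(1) using c y
      by (simp add: list_prod_append lc l0 m_assoc inv_cancel_left)
  qed
qed

end

lemma group_coxeter_group: "group (coxeter_group S m)"
  by (simp add: coxeter_group_def group_presented_group)

lemma simple_reflection_carrier:
  "s \<in> S \<Longrightarrow> simple_reflection S m s \<in> carrier (coxeter_group S m)"
  by (simp add: simple_reflection_def pres_gen_def coxeter_group_def presented_group_def quotientI)

lemma reflections_carrier: "reflections S m \<subseteq> carrier (coxeter_group S m)"
proof -
  interpret group "coxeter_group S m" by (rule group_coxeter_group)
  show ?thesis using simple_reflection_carrier by (fastforce simp: reflections_def)
qed

lemma reflections_conj:
  assumes "g \<in> carrier (coxeter_group S m)" "r \<in> reflections S m"
  shows "g \<otimes>\<^bsub>coxeter_group S m\<^esub> r \<otimes>\<^bsub>coxeter_group S m\<^esub> inv\<^bsub>coxeter_group S m\<^esub> g \<in> reflections S m"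
proof -
  interpret group "coxeter_group S m" by (rule group_coxeter_group)
  obtain h s where h: "h \<in> carrier (coxeter_group S m)" "s \<in> S"
      "r = h \<otimes>\<^bsub>coxeter_group S m\<^esub> simple_reflection S m s \<otimes>\<^bsub>coxeter_group S m\<^esub> inv\<^bsub>coxeter_group S m\<^esub> h"
    using assms(2) by (auto simp: reflections_def)
  then have "g \<otimes>\<^bsub>coxeter_group S m\<^esub> r \<otimes>\<^bsub>coxeter_group S m\<^esub> inv\<^bsub>coxeter_group S m\<^esub> g
    = (g \<otimes>\<^bsub>coxeter_group S m\<^esub> h) \<otimes>\<^bsub>coxeter_group S m\<^esub> simple_reflection S m s
      \<otimes>\<^bsub>coxeter_group S m\<^esub> inv\<^bsub>coxeter_group S m\<^esub> (g \<otimes>\<^bsub>coxeter_group S m\<^esub> h)"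
    using assms(1) simple_reflection_carrier[OF h(2)] by (simp add: m_assoc inv_mult_group)
  then show ?thesis using assms(1) h(1,2) by (auto simp: reflections_def)
qed

lemma group_action_reduced_decompositions:
  "group_action (braid_group (reflection_length S m w)) (reduced_decompositions S m w)
    (hurwitz_action (coxeter_group S m) (reduced_decompositions S m w))"
proof -
  interpret group "coxeter_group S m" by (rule group_coxeter_group)
  have conj: "a \<otimes>\<^bsub>coxeter_group S m\<^esub> b \<otimes>\<^bsub>coxeter_group S m\<^esub> inv\<^bsub>coxeter_group S m\<^esub> a \<in> reflections S m
      \<and> inv\<^bsub>coxeter_group S m\<^esub> a \<otimes>\<^bsub>coxeter_group S m\<^esub> b \<otimes>\<^bsub>coxeter_group S m\<^esub> a \<in> reflections S m"
    if "a \<in> reflections S m" "b \<in> reflections S m" for a b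
  proof -
    have a: "a \<in> carrier (coxeter_group S m)" using that(1) reflections_carrier by blast
    show ?thesis
      using reflections_conj[OF a that(2)] reflections_conj[OF inv_closed[OF a] that(2)] a by simp
  qed
  show ?thesis
  proof (rule group_action_hurwitz)
    show "reduced_decompositions S m w \<subseteq> tuples (coxeter_group S m) (reflection_length S m w)"
      using reflections_carrier by (force simp: reduced_decompositions_def)
  next
    fix x :: "nat \<times> bool" and t
    assume *: "Suc (fst x) < reflection_length S m w" "t \<in> reduced_decompositions S m w"
    have "length (hurwitz_letter (coxeter_group S m) x t) = length t"
      by (simp add: hurwitz_letter_def split: prod.splits)
    then show "hurwitz_letter (coxeter_group S m) x t \<in> reduced_decompositions S m w"
      using * hurwitz_letter_prod[OF reflections_carrier conj, of t x]
      by (simp add: reduced_decompositions_def)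
  qed
qed

end

theory Submission
  imports Defs
begin

text \<open>
  \<open>W\<close> acts faithfully on the integers by maps that commute with \<open>x \<mapsto> - x\<close> and \<open>x \<mapsto> x + N\<close>, where
  \<open>N = 2 n + 1\<close>.  These two maps generate an infinite dihedral group whose free orbits are \<open>n\<close> vertices;
  a reflection exchanges two points, together with their images.  It is an edge if the two points belong to
  different vertices and a loop otherwise, and the conjugacy class of a loop is that of \<open>\<sigma>\<^sub>0\<close> or of \<open>\<sigma>\<^sub>n\<close>.
  Parity and connectedness force every decomposition of \<open>c\<close> into \<open>n + 1\<close> reflections to consist of a spanning
  tree and one loop of each class, so a decomposition of a divisor is a forest with at most one loop of each class.

  If \<open>w\<close> moves a point \<open>x\<close> to another vertex, then following \<open>x\<close> through the factors and using that no edge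
  closes a cycle, Hurwitz moves produce a last factor that exchanges \<open>x\<close> and \<open>w x\<close>.  This factor
  depends only on \<open>w\<close>, which allows induction on the length.  Otherwise only loops are left.  The one nontrivial case
  is that of two loops at the same vertex, whose product translates by \<open>q N\<close> with \<open>q\<close> odd; as \<open>c\<close> has just two
  orbits on these points, \<open>q = \<plusminus> 1\<close>, and then conjugation by the product reaches all pairs.
\<close>

section \<open>Hurwitz equivalence\<close>

text \<open>The graph is never formed. Its components are replaced by labels, that is, functions on
  the integers preserved by all factors, and every bound on the number of edges comes from counting
  values: an identification of two labels costs at most one value. The same count on residues modulo
  a multiple of \<open>N\<close> also sees translations, and this is how \<open>q\<close> is
  bounded. Labels describe \<open>c\<close> as well, so that the many Coxeter elements need no
  normal form.

  The obstacle is a pair of loops at one vertex. Its product has infinitely many decompositions, and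
  Hurwitz moves change the centre of a loop of the pair only by multiples of \<open>q * N\<close>.
  For |q| > 1 transitivity would fail, so the position of \<open>w\<close> below \<open>c\<close>
  has to enter here beyond the absence of cycles.

  The group is known only by its presentation. Faithfulness of the action is what turns agreement of
  two reflections at one moved point into equality, and so makes the last factor depend on
  \<open>w\<close> alone.\<close>

lemma (in group) list_prod_simps:
  "list_prod G [] = \<one>" "list_prod G (x # xs) = x \<otimes> list_prod G xs"
  by (simp_all add: list_prod_def)

context group
begin

text \<open>Only positive elementary braids are steps; the equivalence closure supplies inverses and
  products. Braid words come back in \<open>hurwitz_equiv_invariant\<close>.\<close>

definition hurwitz_step :: "'a list \<Rightarrow> 'a list \<Rightarrow> bool" where
  "hurwitz_step t t' \<longleftrightarrow> set t \<subseteq> carrier G \<and>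
    (\<exists>xs a b ys. t = xs @ a # b # ys \<and> t' = xs @ (a \<otimes> b \<otimes> inv a) # a # ys)"

abbreviation hurwitz_equiv :: "'a list \<Rightarrow> 'a list \<Rightarrow> bool" where
  "hurwitz_equiv \<equiv> equivclp hurwitz_step"

lemma hurwitz_step_carrier: "hurwitz_step t t' \<Longrightarrow> set t \<subseteq> carrier G \<and> set t' \<subseteq> carrier G"
  by (auto simp: hurwitz_step_def)

lemma hurwitz_stepI:
  assumes "set (xs @ a # b # ys) \<subseteq> carrier G"
  shows "hurwitz_equiv (xs @ a # b # ys) (xs @ (a \<otimes> b \<otimes> inv a) # a # ys)"
  by (rule r_into_equivclp) (use assms in \<open>auto simp: hurwitz_step_def\<close>)

lemma hurwitz_stepI':
  assumes "set (xs @ a # b # ys) \<subseteq> carrier G"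
  shows "hurwitz_equiv (xs @ a # b # ys) (xs @ b # (inv b \<otimes> a \<otimes> b) # ys)"
proof -
  have "hurwitz_equiv (xs @ b # (inv b \<otimes> a \<otimes> b) # ys) (xs @ a # b # ys)"
    using hurwitz_stepI[of xs b "inv b \<otimes> a \<otimes> b" ys] assms by (simp add: m_assoc inv_cancel_left)
  then show ?thesis by (rule equivclp_sym)
qed

lemma hurwitz_equiv_context:
  assumes "hurwitz_equiv t t'" "set xs \<subseteq> carrier G" "set ys \<subseteq> carrier G"
  shows "hurwitz_equiv (xs @ t @ ys) (xs @ t' @ ys)"
  using assms(1)
proof (induction rule: equivclp_induct)
  case base
  show ?case by simp
next
  case (step y z)
  have *: "hurwitz_step (xs @ u @ ys) (xs @ v @ ys)" if "hurwitz_step u v" for u v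
  proof -
    obtain us a b vs where u: "u = us @ a # b # vs" "v = us @ (a \<otimes> b \<otimes> inv a) # a # vs"
      "set u \<subseteq> carrier G"
      using \<open>hurwitz_step u v\<close> by (auto simp: hurwitz_step_def)
    then have "xs @ u @ ys = (xs @ us) @ a # b # (vs @ ys)"
      "xs @ v @ ys = (xs @ us) @ (a \<otimes> b \<otimes> inv a) # a # (vs @ ys)"
      by simp_all
    moreover have "set (xs @ u @ ys) \<subseteq> carrier G" using u assms by auto
    ultimately show ?thesis unfolding hurwitz_step_def by blast
  qed
  show ?case
  proof -
    have "hurwitz_equiv (xs @ y @ ys) (xs @ z @ ys)"
      using step.hyps(2) *[of y z] *[of z y] by (auto intro: r_into_equivclp equivclp_sym)
    then show ?thesis by (rule equivclp_trans[OF step.IH])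
  qed
qed

lemma hurwitz_equiv_move_right:
  assumes "t \<in> carrier G" "set us \<subseteq> carrier G"
  shows "hurwitz_equiv (t # us) (map (\<lambda>u. t \<otimes> u \<otimes> inv t) us @ [t])"
  using assms(2)
proof (induction us)
  case Nil
  show ?case by simp
next
  case (Cons u us)
  have "hurwitz_equiv (t # u # us) ((t \<otimes> u \<otimes> inv t) # t # us)"
    using hurwitz_stepI[of "[]" t u us] assms(1) Cons.prems by simp
  moreover have "hurwitz_equiv ((t \<otimes> u \<otimes> inv t) # t # us)
     ((t \<otimes> u \<otimes> inv t) # map (\<lambda>u. t \<otimes> u \<otimes> inv t) us @ [t])"
    using hurwitz_equiv_context[OF Cons.IH, of "[t \<otimes> u \<otimes> inv t]" "[]"] assms(1) Cons.prems by simp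
  ultimately show ?case by (simp add: equivclp_trans)
qed

text \<open>The bridge back to the braid group: a step is the positive letter at position
  \<open>length xs\<close>, a reversed step the negative one, and a chain of steps spells a word. In
  the applications \<open>T\<close> is the set of reflections.\<close>

lemma hurwitz_equiv_invariant:
  assumes "hurwitz_equiv t t'" "T \<subseteq> carrier G"
    and conj: "\<And>a b. a \<in> T \<Longrightarrow> b \<in> T \<Longrightarrow> a \<otimes> b \<otimes> inv a \<in> T \<and> inv a \<otimes> b \<otimes> a \<in> T"
    and "set t \<subseteq> T"
  shows "set t' \<subseteq> T \<and> length t' = length t \<and> list_prod G t' = list_prod G t
    \<and> (\<exists>u\<in>words {i. Suc i < length t}. hurwitz_word G u t = t')"
  using assms(1)
proof (induction rule: equivclp_induct)
  case base
  show ?case using assms(4) by (auto simp: hurwitz_word_def intro!: bexI[of _ "[]"])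
next
  case (step y z)
  note y = step.IH
  have *: "hurwitz_letter G (length xs, True) (xs @ a # b # ys) = xs @ (a \<otimes> b \<otimes> inv a) # a # ys" for xs a b ys
    by (simp add: hurwitz_letter_def nth_append list_update_append)
  have "\<exists>x. Suc (fst x) < length y \<and> hurwitz_letter G x y = z"
  proof (cases "hurwitz_step y z")
    case True
    then obtain xs a b ys where "y = xs @ a # b # ys" "z = xs @ (a \<otimes> b \<otimes> inv a) # a # ys"
      by (auto simp: hurwitz_step_def)
    then show ?thesis using * by (intro exI[of _ "(length xs, True)"]) auto
  next
    case False
    then have zy: "hurwitz_step z y" using step.hyps(2) by blast
    then obtain xs a b ys where z: "z = xs @ a # b # ys" "y = xs @ (a \<otimes> b \<otimes> inv a) # a # ys"
      by (auto simp: hurwitz_step_def)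
    have "hurwitz_letter G (length xs, False) y = z"
      unfolding z(2) *[symmetric] z(1)[symmetric]
      using hurwitz_letter_cancel[of z "length z" "length xs" False] hurwitz_step_carrier[OF zy] z(1) by simp
    then show ?thesis using z by (intro exI[of _ "(length xs, False)"]) auto
  qed
  then obtain x where x: "Suc (fst x) < length y" "hurwitz_letter G x y = z" by blast
  from y obtain u where u: "u \<in> words {i. Suc i < length t}" "hurwitz_word G u t = y" by blast
  have "x # u \<in> words {i. Suc i < length t}" "hurwitz_word G (x # u) t = z"
    using u x y by (cases x; auto simp: hurwitz_word_def)+
  moreover have "length z = length y"
    using x by (auto simp: hurwitz_letter_def split: prod.splits)
  moreover have "set z \<subseteq> T \<and> list_prod G z = list_prod G y"
    using hurwitz_letter_prod[OF assms(2) conj _ x(1)] x(2) y by blast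
  ultimately show ?case using y by metis
qed

text \<open>The full twist on two strands, which is the square of the elementary braid, conjugates
  both entries by their product.\<close>

lemma hurwitz_equiv_conj_pair:
  assumes "a \<in> carrier G" "b \<in> carrier G"
  shows "hurwitz_equiv [a, b]
    [(a \<otimes> b) \<otimes> a \<otimes> inv (a \<otimes> b), (a \<otimes> b) \<otimes> b \<otimes> inv (a \<otimes> b)]"
proof -
  have "hurwitz_equiv [a, b] [a \<otimes> b \<otimes> inv a, a]"
    using hurwitz_stepI[of "[]" a b "[]"] assms by simp
  also have "hurwitz_equiv \<dots> [(a \<otimes> b \<otimes> inv a) \<otimes> a \<otimes> inv (a \<otimes> b \<otimes> inv a), a \<otimes> b \<otimes> inv a]"
    using hurwitz_stepI[of "[]" "a \<otimes> b \<otimes> inv a" a "[]"] assms by simp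
  finally show ?thesis using assms by (simp add: m_assoc inv_mult_group inv_cancel_left)
qed

end

section \<open>Mirrors on the integers\<close>

locale affine_C =
  fixes n :: nat
  assumes n_ge_2: "n \<ge> 2"
begin

text \<open>The nonzero residues are those of \<plusminus>1, ..., \<plusminus>n. As \<open>N\<close>
  is odd, an integral fixed point of x \<mapsto> k N - x is a multiple of \<open>N\<close>, so all
  other dihedral orbits are free.\<close>

definition N :: int where "N = 2 * int n + 1"

lemma N_ge_5: "N \<ge> 5" and odd_N: "odd N"
  using n_ge_2 by (simp_all add: N_def)

text \<open>Being in the same orbit of the dihedral group, that is, at the same vertex.\<close>

definition sim :: "int \<Rightarrow> int \<Rightarrow> bool" where
  "sim x y \<longleftrightarrow> N dvd x - y \<or> N dvd x + y"

definition equivariant :: "(int \<Rightarrow> int) \<Rightarrow> bool" where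
  "equivariant f \<longleftrightarrow> (\<forall>x. f (- x) = - f x) \<and> (\<forall>x. f (x + N) = f x + N)"

text \<open>The cases overlap, and \<open>mirror x y\<close> exchanges \<open>x\<close> and \<open>y\<close> only under the condition \<open>mirror_pair x y\<close> below.\<close>

definition mirror :: "int \<Rightarrow> int \<Rightarrow> int \<Rightarrow> int" where
  "mirror x y z =
    (if N dvd z - x then z + (y - x) else if N dvd z + x then z - (y - x)
     else if N dvd z - y then z + (x - y) else if N dvd z + y then z - (x - y) else z)"

text \<open>An equivariant map that sends x to x + k N sends x + k N to x + 2 k N, so two different
  points of one orbit can be exchanged only if their sum is a multiple of \<open>N\<close>.\<close>

definition mirror_pair :: "int \<Rightarrow> int \<Rightarrow> bool" where
  "mirror_pair x y \<longleftrightarrow> \<not> N dvd x \<and> \<not> N dvd y \<and> (sim x y \<longrightarrow> N dvd x + y)"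

lemma N_dvd_2: "N dvd 2 * x \<longleftrightarrow> N dvd x"
proof -
  have "coprime N 2" using odd_N by simp
  then show ?thesis using coprime_dvd_mult_right_iff by blast
qed

lemma simI1: "sim (x + k * N) x" and simI2: "sim (k * N - x) x"
  by (auto simp: sim_def)

lemma simE:
  assumes "sim z x" obtains k where "z = x + k * N" | k where "z = k * N - x"
proof -
  have "N dvd z - x \<or> N dvd z + x" using assms by (simp add: sim_def)
  then show ?thesis
  proof
    assume "N dvd z - x"
    then obtain k where "z - x = N * k" by (rule dvdE)
    then have "z = x + k * N" by (simp add: algebra_simps)
    then show ?thesis by (rule that)
  next
    assume "N dvd z + x"
    then obtain k where "z + x = N * k" by (rule dvdE)
    then have "z = k * N - x" by (simp add: algebra_simps)
    then show ?thesis by (rule that)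
  qed
qed

lemma sim_refl [simp]: "sim x x" by (simp add: sim_def)

lemma sim_sym: "sim x y \<longleftrightarrow> sim y x"
  using dvd_diff_commute[of N x y] by (simp only: sim_def add.commute[of x y])

lemma sim_trans: "sim x y \<Longrightarrow> sim y z \<Longrightarrow> sim x z"
proof (elim simE)
  fix k l assume "x = y + k * N" "y = z + l * N"
  then have "x = z + (k + l) * N" by (simp add: algebra_simps)
  then show ?thesis by (simp only: simI1)
next
  fix k l assume "x = y + k * N" "y = l * N - z"
  then have "x = (k + l) * N - z" by (simp add: algebra_simps)
  then show ?thesis by (simp only: simI2)
next
  fix k l assume "x = k * N - y" "y = z + l * N"
  then have "x = (k - l) * N - z" by (simp add: algebra_simps)
  then show ?thesis by (simp only: simI2)
next
  fix k l assume "x = k * N - y" "y = l * N - z"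
  then have "x = z + (k - l) * N" by (simp add: algebra_simps)
  then show ?thesis by (simp only: simI1)
qed

lemma sim_dvd: "sim x y \<Longrightarrow> N dvd x \<longleftrightarrow> N dvd y"
  by (elim simE) (auto simp: dvd_add_left_iff dvd_diff_right_iff)

lemma equivariant_add:
  assumes "equivariant f" shows "f (x + k * N) = f x + k * N"
proof -
  have nat: "f (x + int j * N) = f x + int j * N" for j x
  proof (induction j arbitrary: x)
    case (Suc j)
    have "f (x + int (Suc j) * N) = f ((x + int j * N) + N)" by (simp add: algebra_simps)
    also have "\<dots> = f (x + int j * N) + N" using assms unfolding equivariant_def by blast
    also have "\<dots> = f x + int (Suc j) * N" by (simp add: Suc.IH algebra_simps)
    finally show ?case .
  qed simp
  show ?thesis
  proof (cases "k \<ge> 0")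
    case True then show ?thesis using nat[of x "nat k"] by simp
  next
    case False then show ?thesis using nat[of "x + k * N" "nat (- k)"] by (simp add: algebra_simps)
  qed
qed

lemma equivariant_neg: "equivariant f \<Longrightarrow> f (- x) = - f x"
  by (simp add: equivariant_def)

lemma equivariant_diff: "equivariant f \<Longrightarrow> f (k * N - x) = k * N - f x"
  using equivariant_add[of f "- x" k] by (simp add: equivariant_neg)

lemma equivariant_sim: "equivariant f \<Longrightarrow> sim x y \<Longrightarrow> sim (f x) (f y)"
  by (elim simE) (auto simp: equivariant_add equivariant_diff simI1 simI2)

lemma equivariant_0: "equivariant f \<Longrightarrow> f 0 = 0"
  using equivariant_neg[of f 0] by simp

lemma equivariant_comp: "equivariant f \<Longrightarrow> equivariant g \<Longrightarrow> equivariant (f \<circ> g)"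
  by (simp add: equivariant_def)

lemma mirror_add1: "mirror x y (x + k * N) = y + k * N"
  by (simp add: mirror_def)

lemma mirror_neg1: "mirror_pair x y \<Longrightarrow> mirror x y (k * N - x) = k * N - y"
proof -
  assume "mirror_pair x y"
  then have "\<not> N dvd x" by (simp add: mirror_pair_def)
  then have "\<not> N dvd 2 * x" using N_dvd_2 by blast
  then have "\<not> N dvd k * N - 2 * x" by (simp add: dvd_diff_right_iff)
  moreover have "(k * N - x) - x = k * N - 2 * x" by simp
  ultimately have "\<not> N dvd (k * N - x) - x" by metis
  then show ?thesis by (simp add: mirror_def)
qed

lemma mirror_pair_commute: "mirror_pair x y \<Longrightarrow> mirror_pair y x"
  by (auto simp: mirror_pair_def sim_sym add.commute)

lemma mirror_pair_not_dvd_diff: "mirror_pair x y \<Longrightarrow> \<not> N dvd x - y"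
proof
  assume *: "mirror_pair x y" "N dvd x - y"
  then have "N dvd x + y" by (simp add: mirror_pair_def sim_def)
  then have "N dvd (x + y) + (x - y)" using *(2) by (rule dvd_add)
  moreover have "(x + y) + (x - y) = 2 * x" by simp
  ultimately have "N dvd 2 * x" by simp
  then show False using * N_dvd_2 by (auto simp: mirror_pair_def)
qed

lemma mirror_commute: "mirror_pair x y \<Longrightarrow> mirror x y = mirror y x"
proof
  fix z assume *: "mirror_pair x y"
  have a: "\<not> N dvd x - y" "\<not> N dvd y - x"
    using mirror_pair_not_dvd_diff[OF *] mirror_pair_not_dvd_diff[OF mirror_pair_commute[OF *]] .
  have b: "\<not> (N dvd z - x \<and> N dvd z - y)" using a dvd_diff[of N "z - x" "z - y"] by auto
  have c: "\<not> (N dvd z + x \<and> N dvd z + y)" using a dvd_diff[of N "z + x" "z + y"] by auto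
  have d: "\<not> (N dvd z - x \<and> N dvd z + x)"
    using * N_dvd_2[of x] dvd_diff[of N "z + x" "z - x"] by (auto simp: mirror_pair_def)
  have e: "\<not> (N dvd z - y \<and> N dvd z + y)"
    using * N_dvd_2[of y] dvd_diff[of N "z + y" "z - y"] by (auto simp: mirror_pair_def)
  show "mirror x y z = mirror y x z" unfolding mirror_def
    using b c d e by (simp only: if_split) auto
qed

lemma mirror_add2: "mirror_pair x y \<Longrightarrow> mirror x y (y + k * N) = x + k * N"
  using mirror_add1[of y x k] mirror_commute[of x y] by simp

lemma mirror_neg2: "mirror_pair x y \<Longrightarrow> mirror x y (k * N - y) = k * N - x"
  using mirror_neg1[of y x k] mirror_commute[of x y] by (simp add: mirror_pair_commute)

lemma mirror_fix: "\<not> sim z x \<Longrightarrow> \<not> sim z y \<Longrightarrow> mirror x y z = z"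
  by (simp add: mirror_def sim_def)

lemma mirror_cases [consumes 1, case_names pos neg pos' neg' fixed]:
  assumes "mirror_pair x y"
  obtains k where "z = x + k * N" "mirror x y z = y + k * N"
    | k where "z = k * N - x" "mirror x y z = k * N - y"
    | k where "z = y + k * N" "mirror x y z = x + k * N"
    | k where "z = k * N - y" "mirror x y z = k * N - x"
    | "\<not> sim z x" "\<not> sim z y" "mirror x y z = z"
proof (cases "sim z x")
  case True
  then show ?thesis
  proof (cases rule: simE)
    case (1 k) then show ?thesis using that(1) mirror_add1 by blast
  next
    case (2 k) then show ?thesis using that(2) mirror_neg1 assms by blast
  qed
next
  case F: False
  show ?thesis
  proof (cases "sim z y")
    case True
    then show ?thesis
    proof (cases rule: simE)
      case (1 k) then show ?thesis using that(3) mirror_add2 assms by blast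
    next
      case (2 k) then show ?thesis using that(4) mirror_neg2 assms by blast
    qed
  next
    case False
    then show ?thesis using that(5) F mirror_fix by blast
  qed
qed

lemma mirror_involution:
  assumes "mirror_pair x y" shows "mirror x y (mirror x y z) = z"
  using assms
  by (cases rule: mirror_cases[where z = z])
    (simp_all add: mirror_add1 mirror_add2 mirror_neg1 mirror_neg2 assms)

text \<open>An equivariant \<open>g\<close> respects dihedral orbits, and its equivariant left
  inverse \<open>h\<close> shows that it keeps different orbits apart. Hence each case of
  \<open>mirror_cases\<close> is carried to the same case for \<open>g x\<close> and
  \<open>g y\<close>.\<close>

lemma conj_mirror:
  assumes p: "mirror_pair x y" and g: "equivariant g" and h: "equivariant h" "\<And>z. h (g z) = z"
  shows "mirror_pair (g x) (g y)" "g (mirror x y z) = mirror (g x) (g y) (g z)"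
proof -
  have s: "sim (g a) (g b) \<longleftrightarrow> sim a b" for a b
    using equivariant_sim[OF g, of a b] equivariant_sim[OF h(1), of "g a" "g b"] h(2) by auto
  have d: "N dvd g a \<longleftrightarrow> N dvd a" for a
    using s[of a 0] equivariant_0[OF g] by (simp add: sim_def)
  have l: "N dvd g x + g y" if "N dvd x + y"
  proof -
    obtain k where "x + y = N * k" using \<open>N dvd x + y\<close> by (rule dvdE)
    then have "y = k * N - x" by (simp add: algebra_simps)
    then have "g y = - g x + k * N" using equivariant_add[OF g, of "- x" k] equivariant_neg[OF g] by simp
    then show ?thesis by simp
  qed
  show q: "mirror_pair (g x) (g y)" using p s d l by (auto simp: mirror_pair_def)
  show "g (mirror x y z) = mirror (g x) (g y) (g z)"
    using p
  proof (cases rule: mirror_cases[where z = z])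
    case fixed
    then show ?thesis using s mirror_fix by auto
  qed (use q in \<open>simp_all add: equivariant_add[OF g] equivariant_diff[OF g] mirror_add1 mirror_add2
      mirror_neg1 mirror_neg2 mirror_pair_def[of "g x"]\<close>)
qed

lemma equivariant_mirror: assumes "mirror_pair x y" shows "equivariant (mirror x y)"
  unfolding equivariant_def
proof (intro conjI allI)
  fix z
  have h: "mirror x y u = v" if "u = a" "mirror x y a = b" "v = b" for u v a b
    using that by simp
  have "sim (- z) z" "sim (z + N) z" using simI2[of 0 z] simI1[of z 1] by simp_all
  then have f: "sim (- z) a = sim z a" "sim (z + N) a = sim z a" for a
    using sim_trans sim_sym by blast+
  show "mirror x y (- z) = - mirror x y z"
    using assms
  proof (cases rule: mirror_cases[where z = z])
    case (pos k) then show ?thesis by (intro h[OF _ mirror_neg1[OF assms, of "- k"]]) (simp_all)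
  next
    case (neg k) then show ?thesis by (intro h[OF _ mirror_add1[of x y "- k"]]) (simp_all)
  next
    case (pos' k) then show ?thesis by (intro h[OF _ mirror_neg2[OF assms, of "- k"]]) (simp_all)
  next
    case (neg' k) then show ?thesis by (intro h[OF _ mirror_add2[OF assms, of "- k"]]) (simp_all)
  next
    case fixed then show ?thesis using f mirror_fix by auto
  qed
  show "mirror x y (z + N) = mirror x y z + N"
    using assms
  proof (cases rule: mirror_cases[where z = z])
    case (pos k) then show ?thesis by (intro h[OF _ mirror_add1[of x y "k + 1"]]) (simp_all add: distrib_right)
  next
    case (neg k) then show ?thesis by (intro h[OF _ mirror_neg1[OF assms, of "k + 1"]]) (simp_all add: distrib_right)
  next
    case (pos' k) then show ?thesis by (intro h[OF _ mirror_add2[OF assms, of "k + 1"]]) (simp_all add: distrib_right)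
  next
    case (neg' k) then show ?thesis by (intro h[OF _ mirror_neg2[OF assms, of "k + 1"]]) (simp_all add: distrib_right)
  next
    case fixed then show ?thesis using f mirror_fix by auto
  qed
qed

lemma mirror_pair_shift:
  assumes "mirror_pair x y"
  shows "mirror_pair (x + k * N) (y + k * N)" "mirror (x + k * N) (y + k * N) = mirror x y"
    "mirror_pair (k * N - x) (k * N - y)" "mirror (k * N - x) (k * N - y) = mirror x y"
proof -
  have e: "x + k * N - (y + k * N) = x - y" "k * N - x - (k * N - y) = y - x"
    "x + k * N + (y + k * N) = (x + y) + (2 * k) * N"
    "k * N - x + (k * N - y) = - (x + y) + (2 * k) * N"
    by (simp_all add: algebra_simps)
  have e': "a + k * N - (b + k * N) = a - b" "- a + k * N - (- b + k * N) = b - a" for a b by simp_all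
  have m: "N dvd a + j * N \<longleftrightarrow> N dvd a" for a j
    by (metis dvd_add_left_iff dvd_triv_right)
  have z: "z - (x + k * N) = (z - x) + (- k) * N" "z + (x + k * N) = (z + x) + k * N"
    "z - (k * N - x) = (z + x) + (- k) * N" "z + (k * N - x) = (z - x) + k * N" for x z
    by (simp_all add: algebra_simps)
  have dd: "N dvd - x - y \<longleftrightarrow> N dvd x + y" "N dvd y - x \<longleftrightarrow> N dvd x - y"
    by (metis dvd_minus_iff minus_add_distrib diff_conv_add_uminus) (metis dvd_minus_iff minus_diff_eq)
  show p: "mirror_pair (x + k * N) (y + k * N)" "mirror_pair (k * N - x) (k * N - y)"
    using assms unfolding mirror_pair_def sim_def e m by (auto simp: dd dvd_diff_right_iff)
  show "mirror (x + k * N) (y + k * N) = mirror x y"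
    unfolding mirror_def e' unfolding z m by (rule refl)
  show "mirror (k * N - x) (k * N - y) = mirror x y"
  proof -
    have d: "\<not> (N dvd z - x \<and> N dvd z + x)" for z
      using assms N_dvd_2[of x] dvd_diff[of N "z + x" "z - x"] by (auto simp: mirror_pair_def)
    have d': "\<not> (N dvd z - y \<and> N dvd z + y)" for z
      using assms N_dvd_2[of y] dvd_diff[of N "z + y" "z - y"] by (auto simp: mirror_pair_def)
    show ?thesis unfolding mirror_def e' unfolding z m using d d' by (simp add: fun_eq_iff)
  qed
qed

text \<open>Moving both points by the same element of the dihedral group does not change the mirror,
  so any moved point can serve as base point. One moved point and its image therefore determine the
  mirror.\<close>

lemma mirror_rebase:
  assumes "mirror_pair x y" "mirror x y z \<noteq> z"
  shows "mirror_pair z (mirror x y z) \<and> mirror x y = mirror z (mirror x y z)"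
  using assms(1)
proof (cases rule: mirror_cases[where z = z])
  case (pos k)
  then show ?thesis using mirror_pair_shift[OF assms(1)] by simp
next
  case (neg k)
  then show ?thesis using mirror_pair_shift[OF assms(1)] by simp
next
  case (pos' k)
  then show ?thesis using mirror_pair_shift[OF mirror_pair_commute[OF assms(1)]] mirror_commute[OF assms(1)] by simp
next
  case (neg' k)
  then show ?thesis using mirror_pair_shift[OF mirror_pair_commute[OF assms(1)]] mirror_commute[OF assms(1)] by simp
qed (use assms in simp)

text \<open>The label may distinguish points of one dihedral orbit, as residues modulo
  \<open>K * N\<close> do in \<open>periodic_label\<close>. All translates and negatives of the pair
  have to be compared for this reason.\<close>

lemma mirror_label:
  assumes "mirror_pair x y"
    and "\<And>k. f (x + k * N) = f (y + k * N)" "\<And>k. f (k * N - x) = f (k * N - y)"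
  shows "f (mirror x y z) = f z"
  using assms(1)
proof (cases rule: mirror_cases[where z = z])
qed (use assms(2,3) in simp_all)

end

section \<open>The action on the integers\<close>

lemma (in group) mult_eq_one_imp_eq_inv:
  "x \<in> carrier G \<Longrightarrow> y \<in> carrier G \<Longrightarrow> x \<otimes> y = \<one> \<Longrightarrow> x = inv y"
  by (metis inv_equality)

context affine_C
begin

section \<open>Generators as mirrors\<close>

lemma not_sim_nodes:
  assumes "x \<le> n" "y \<le> n" "x \<noteq> y" shows "\<not> sim (int x) (int y)"
proof
  assume "sim (int x) (int y)"
  then have "N dvd int x - int y \<or> N dvd int x + int y" by (simp add: sim_def)
  then show False
    using zdvd_imp_le[of N "int x - int y"] zdvd_imp_le[of N "int y - int x"]
      zdvd_imp_le[of N "int x + int y"] assms dvd_diff_commute[of N "int x" "int y"]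
    by (cases "x < y") (auto simp: N_def)
qed

lemma nodeE:
  obtains x k where "x \<le> n" "z = int x + k * N" | x k where "x \<le> n" "z = k * N - int x"
proof -
  have r: "0 \<le> z mod N" "z mod N < N" using N_ge_5 by simp_all
  have e: "z = z mod N + (z div N) * N" by simp
  show ?thesis
  proof (cases "z mod N \<le> int n")
    case True
    then show ?thesis using that(1)[of "nat (z mod N)" "z div N"] r e by auto
  next
    case False
    have "z = (z div N + 1) * N - (N - z mod N)" using e by (simp add: algebra_simps)
    then show ?thesis using that(2)[of "nat (N - z mod N)" "z div N + 1"] r False by (auto simp: N_def)
  qed
qed

lemma equivariant_eqI:
  assumes "equivariant f" "equivariant g" "\<And>x. 1 \<le> x \<Longrightarrow> x \<le> n \<Longrightarrow> f (int x) = g (int x)"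
  shows "f = g"
proof
  fix z show "f z = g z"
  proof (rule nodeE[of z])
    fix x k assume "x \<le> n" "z = int x + k * N"
    then show ?thesis using assms equivariant_add[of f 0 k] equivariant_add[of g 0 k]
      by (cases "x = 0") (auto simp: equivariant_add equivariant_0)
  next
    fix x k assume "x \<le> n" "z = k * N - int x"
    then show ?thesis using assms equivariant_add[of f 0 k] equivariant_add[of g 0 k]
      by (cases "x = 0") (auto simp: equivariant_diff equivariant_0)
  qed
qed

text \<open>The generator 0 exchanges 1 and -1, since 0 and 1 are not a mirror pair. For
  \<open>i = n\<close> the partner n + 1 equals N - n, so the second clause yields a loop there and
  edges for the generators in between.\<close>

definition gen_map :: "nat \<Rightarrow> int \<Rightarrow> int" where
  "gen_map i = (if i = 0 then mirror 1 (- 1) else mirror (int i) (int i + 1))"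

lemma node_not_dvd: "1 \<le> x \<Longrightarrow> x \<le> n \<Longrightarrow> \<not> N dvd int x"
  using zdvd_imp_le[of N "int x"] by (auto simp: N_def)

lemma mirror_pair_gen:
  "mirror_pair 1 (- 1)"
  "1 \<le> i \<Longrightarrow> i \<le> n \<Longrightarrow> mirror_pair (int i) (int i + 1)"
proof -
  show "mirror_pair 1 (- 1)" using node_not_dvd[of 1] n_ge_2 by (simp add: mirror_pair_def)
  assume i: "1 \<le> i" "i \<le> n"
  show "mirror_pair (int i) (int i + 1)"
  proof (cases "i = n")
    case True
    have "sim (int n + 1) (int n)" using simI2[of 1 "int n"] by (simp add: N_def)
    then show ?thesis using True node_not_dvd[of n] i sim_dvd by (auto simp: mirror_pair_def N_def)
  next
    case False
    then show ?thesis using i node_not_dvd[of i] node_not_dvd[of "Suc i"] not_sim_nodes[of i "Suc i"]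
      by (simp add: mirror_pair_def add.commute)
  qed
qed

lemma equivariant_gen_map: "i \<le> n \<Longrightarrow> equivariant (gen_map i)"
  using mirror_pair_gen(1) mirror_pair_gen(2)[of i] equivariant_mirror by (auto simp: gen_map_def)

lemma gen_map_involution: "i \<le> n \<Longrightarrow> gen_map i (gen_map i z) = z"
  using mirror_pair_gen(1) mirror_pair_gen(2)[of i] mirror_involution by (auto simp: gen_map_def)

lemma gen_map_0: "x \<le> n \<Longrightarrow> gen_map 0 (int x) = (if x = 1 then - int x else int x)"
  using mirror_add1[of 1 "- 1" 0] mirror_fix[of "int x" 1 "- 1"] not_sim_nodes[of x 1] n_ge_2
    sim_trans[of "int x" "- 1" 1] simI2[of 0 1]
  by (auto simp: gen_map_def)

lemma gen_map_n: "x \<le> n \<Longrightarrow> gen_map n (int x) = (if x = n then N - int x else int x)"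
proof -
  assume x: "x \<le> n"
  have "sim (int n + 1) (int n)" using simI2[of 1 "int n"] by (simp add: N_def)
  then have "x \<noteq> n \<Longrightarrow> \<not> sim (int x) (int n + 1)"
    using sim_trans[of "int x" "int n + 1" "int n"] not_sim_nodes[of x n] x by auto
  then show ?thesis
    using mirror_add1[of "int n" "int n + 1" 0] mirror_fix[of "int x" "int n" "int n + 1"]
      not_sim_nodes[of x n] x n_ge_2
    by (auto simp: gen_map_def N_def)
qed

lemma gen_map_mid: "1 \<le> i \<Longrightarrow> i < n \<Longrightarrow> x \<le> n \<Longrightarrow>
   gen_map i (int x) = (if x = i then int (Suc i) else if x = Suc i then int i else int x)"
  using mirror_add1[of "int i" "int i + 1" 0] mirror_add2[OF mirror_pair_gen(2)[of i], of 0]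
    mirror_fix[of "int x" "int i" "int (Suc i)"] not_sim_nodes[of x i] not_sim_nodes[of x "Suc i"]
  by (auto simp: gen_map_def add.commute)

lemma gen_map_neg: "i \<le> n \<Longrightarrow> gen_map i (- z) = - gen_map i z"
  using equivariant_gen_map equivariant_neg by blast

lemma gen_map_diff: "i \<le> n \<Longrightarrow> gen_map i (N - z) = N - gen_map i z"
  using equivariant_diff[OF equivariant_gen_map[of i], of 1 z] by simp

lemmas gen_map_simps = gen_map_0 gen_map_n gen_map_mid gen_map_neg gen_map_diff

lemma gen_map_commute:
  assumes "i \<le> n" "j \<le> n" "Suc i < j"
  shows "gen_map i \<circ> gen_map j = gen_map j \<circ> gen_map i"
proof (rule equivariant_eqI)
  fix x assume "1 \<le> x" "x \<le> n"
  then show "(gen_map i \<circ> gen_map j) (int x) = (gen_map j \<circ> gen_map i) (int x)"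
    using assms by (cases "i = 0"; cases "j = n"; cases "x = i"; cases "x = Suc i"; cases "x = j"; cases "x = Suc j")
     (simp_all add: gen_map_simps del: of_nat_Suc)
qed (use assms in \<open>simp_all add: equivariant_comp equivariant_gen_map\<close>)

lemma gen_map_braid:
  assumes "1 \<le> i" "Suc i < n"
  shows "gen_map i \<circ> gen_map (Suc i) \<circ> gen_map i = gen_map (Suc i) \<circ> gen_map i \<circ> gen_map (Suc i)"
proof (rule equivariant_eqI)
  fix x assume "1 \<le> x" "x \<le> n"
  then show "(gen_map i \<circ> gen_map (Suc i) \<circ> gen_map i) (int x) = (gen_map (Suc i) \<circ> gen_map i \<circ> gen_map (Suc i)) (int x)"
    using assms by (cases "x = i"; cases "x = Suc i"; cases "x = Suc (Suc i)")
     (simp_all add: gen_map_simps del: of_nat_Suc)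
qed (use assms in \<open>simp_all add: equivariant_comp equivariant_gen_map\<close>)

lemma gen_map_braid_0:
  "gen_map 0 \<circ> gen_map 1 \<circ> gen_map 0 \<circ> gen_map 1 = gen_map 1 \<circ> gen_map 0 \<circ> gen_map 1 \<circ> gen_map 0"
proof (rule equivariant_eqI)
  fix x assume "1 \<le> x" "x \<le> n"
  then show "(gen_map 0 \<circ> gen_map 1 \<circ> gen_map 0 \<circ> gen_map 1) (int x)
     = (gen_map 1 \<circ> gen_map 0 \<circ> gen_map 1 \<circ> gen_map 0) (int x)"
    using n_ge_2 by (cases "x = 1"; cases "x = 2")
     (simp_all add: gen_map_0 gen_map_mid[of "Suc 0"] gen_map_neg numeral_2_eq_2 
       gen_map_0[where x = "Suc (Suc 0)"] del: of_nat_Suc)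
qed (use n_ge_2 in \<open>simp_all add: equivariant_comp equivariant_gen_map\<close>)

lemma gen_map_braid_n:
  assumes "n = Suc m"
  shows "gen_map m \<circ> gen_map n \<circ> gen_map m \<circ> gen_map n = gen_map n \<circ> gen_map m \<circ> gen_map n \<circ> gen_map m"
proof (rule equivariant_eqI)
  fix x assume "1 \<le> x" "x \<le> n"
  then show "(gen_map m \<circ> gen_map n \<circ> gen_map m \<circ> gen_map n) (int x)
     = (gen_map n \<circ> gen_map m \<circ> gen_map n \<circ> gen_map m) (int x)"
    using n_ge_2 assms gen_map_n[of m] gen_map_n[of "Suc m"] gen_map_n[of x]
      gen_map_mid[of m m] gen_map_mid[of m "Suc m"] gen_map_mid[of m x] gen_map_diff[of m] gen_map_diff[of n]
    by (cases "x = m"; cases "x = n") (simp_all del: of_nat_Suc)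
qed (use equivariant_comp equivariant_gen_map[of m] equivariant_gen_map[of n] assms in simp_all)

section \<open>The homomorphism to maps of the integers and the parity characters\<close>

abbreviation "M \<equiv> affine_C_matrix n"
abbreviation "S \<equiv> {0..n}"
abbreviation "W \<equiv> coxeter_group S M"
abbreviation "cls u \<equiv> pres_cong S (coxeter_relations S M) `` {u}"
abbreviation "sr \<equiv> simple_reflection S M"

sublocale W: group W by (rule group_coxeter_group)

text \<open>Exponents are ignored because every generator acts as an involution.\<close>

definition word_map :: "nat word \<Rightarrow> int \<Rightarrow> int" where
  "word_map u = foldr (\<lambda>l. (\<circ>) (gen_map (fst l))) u id"

definition act :: "nat word set \<Rightarrow> int \<Rightarrow> int" where
  "act A = word_map (SOME u. u \<in> A)"

definition parity :: "nat set \<Rightarrow> nat word set \<Rightarrow> bool" where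
  "parity J A = odd (length (filter (\<lambda>l. fst l \<in> J) (SOME u. u \<in> A)))"

lemma word_map_append: "word_map (u @ v) = word_map u \<circ> word_map v"
  by (induction u) (simp_all add: word_map_def o_assoc)

lemma word_map_simps [simp]: "word_map [] = id" "word_map (l # u) = gen_map (fst l) \<circ> word_map u"
  by (simp_all add: word_map_def)

lemma gen_map_square: "i \<le> n \<Longrightarrow> gen_map i \<circ> gen_map i = id"
  by (auto simp: gen_map_involution)

lemma M_cases:
  assumes "s \<le> n" "t \<le> n"
  obtains "s = t" "M s t = 1" | "Suc s < t \<or> Suc t < s" "M s t = 2"
    | "t = Suc s" "1 \<le> s" "t < n" "M s t = 3" | "s = Suc t" "1 \<le> t" "s < n" "M s t = 3"
    | "s = 0" "t = 1" "M s t = 4" | "s = 1" "t = 0" "M s t = 4"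
    | "n = Suc s" "t = n" "M s t = 4" | "n = Suc t" "s = n" "M s t = 4"
proof -
  consider "s = t" | "Suc s < t \<or> Suc t < s" | "t = Suc s" | "s = Suc t" by linarith
  then show ?thesis
  proof cases
    case 1 then show ?thesis by (intro that(1)) (simp_all add: affine_C_matrix_def)
  next
    case 2 then show ?thesis using n_ge_2 by (intro that(2)) (auto simp: affine_C_matrix_def doubleton_eq_iff)
  next
    case 3
    consider "s = 0" | "t = n" | "1 \<le> s" "t < n" using assms 3 by linarith
    then show ?thesis
    proof cases
      case 1 then show ?thesis using 3 by (intro that(5)) (auto simp: affine_C_matrix_def)
    next
      case 2 then show ?thesis using 3 by (intro that(7)) (auto simp: affine_C_matrix_def)
    next
      case b: 3 then show ?thesis using 3 by (intro that(3)) (auto simp: affine_C_matrix_def doubleton_eq_iff)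
    qed
  next
    case 4
    consider "t = 0" | "s = n" | "1 \<le> t" "s < n" using assms 4 by linarith
    then show ?thesis
    proof cases
      case 1 then show ?thesis using 4 by (intro that(6)) (auto simp: affine_C_matrix_def)
    next
      case 2 then show ?thesis using 4 by (intro that(8)) (auto simp: affine_C_matrix_def)
    next
      case b: 3 then show ?thesis using 4 by (intro that(4)) (auto simp: affine_C_matrix_def doubleton_eq_iff)
    qed
  qed
qed

lemma braid_imp_relation:
  fixes f g :: "'a \<Rightarrow> 'a"
  assumes "f \<circ> f = id" "g \<circ> g = id"
  shows "f \<circ> g = g \<circ> f \<Longrightarrow> f \<circ> g \<circ> f \<circ> g = id"
    "f \<circ> g \<circ> f = g \<circ> f \<circ> g \<Longrightarrow> f \<circ> g \<circ> f \<circ> g \<circ> f \<circ> g = id"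
    "f \<circ> g \<circ> f \<circ> g = g \<circ> f \<circ> g \<circ> f \<Longrightarrow> f \<circ> g \<circ> f \<circ> g \<circ> f \<circ> g \<circ> f \<circ> g = id"
proof -
  have a: "f (f x) = x" "g (g x) = x" for x using assms by (metis comp_apply id_apply)+
  show "f \<circ> g = g \<circ> f \<Longrightarrow> f \<circ> g \<circ> f \<circ> g = id"
  proof -
    assume "f \<circ> g = g \<circ> f"
    then have "f (g x) = g (f x)" for x by (metis comp_apply)
    then show ?thesis using a by (auto simp: fun_eq_iff)
  qed
  show "f \<circ> g \<circ> f = g \<circ> f \<circ> g \<Longrightarrow> f \<circ> g \<circ> f \<circ> g \<circ> f \<circ> g = id"
  proof -
    assume "f \<circ> g \<circ> f = g \<circ> f \<circ> g"
    then have "f (g (f x)) = g (f (g x))" for x by (metis comp_apply)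
    then show ?thesis using a by (auto simp: fun_eq_iff)
  qed
  show "f \<circ> g \<circ> f \<circ> g = g \<circ> f \<circ> g \<circ> f \<Longrightarrow> f \<circ> g \<circ> f \<circ> g \<circ> f \<circ> g \<circ> f \<circ> g = id"
  proof -
    assume "f \<circ> g \<circ> f \<circ> g = g \<circ> f \<circ> g \<circ> f"
    then have "f (g (f (g x))) = g (f (g (f x)))" for x by (metis comp_apply)
    then have "f (g (f (g (f (g (f (g x))))))) = x" for x using a by metis
    then show ?thesis by (auto simp: fun_eq_iff)
  qed
qed

lemma word_map_relation:
  assumes "s \<le> n" "t \<le> n"
  shows "word_map (concat (replicate (M s t) [(s, True), (t, True)])) = id"
proof -
  note sq = gen_map_square[OF assms(1)] gen_map_square[OF assms(2)]
  note rel = braid_imp_relation[OF sq] braid_imp_relation[OF sq(2,1)]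
  note simps = numeral_eq_Suc o_assoc
  from assms show ?thesis
  proof (cases rule: M_cases)
    case 1 then show ?thesis using sq by simp
  next
    case 2
    then have "gen_map s \<circ> gen_map t = gen_map t \<circ> gen_map s"
      using gen_map_commute[of s t] gen_map_commute[of t s] assms by auto
    from rel(1)[OF this] 2 show ?thesis by (simp add: simps)
  next
    case 3
    then have "gen_map s \<circ> gen_map t \<circ> gen_map s = gen_map t \<circ> gen_map s \<circ> gen_map t"
      using gen_map_braid[of s] by simp
    from rel(2)[OF this] 3 show ?thesis by (simp add: simps)
  next
    case 4
    then have "gen_map s \<circ> gen_map t \<circ> gen_map s = gen_map t \<circ> gen_map s \<circ> gen_map t"
      using gen_map_braid[of t] by simp
    from rel(2)[OF this] 4 show ?thesis by (simp add: simps)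
  next
    case 5
    then have "gen_map s \<circ> gen_map t \<circ> gen_map s \<circ> gen_map t = gen_map t \<circ> gen_map s \<circ> gen_map t \<circ> gen_map s"
      using gen_map_braid_0 by simp
    from rel(3)[OF this] 5 show ?thesis by (simp add: simps)
  next
    case 6
    then have "gen_map s \<circ> gen_map t \<circ> gen_map s \<circ> gen_map t = gen_map t \<circ> gen_map s \<circ> gen_map t \<circ> gen_map s"
      using gen_map_braid_0 by simp
    from rel(3)[OF this] 6 show ?thesis by (simp add: simps)
  next
    case 7
    then have "gen_map s \<circ> gen_map t \<circ> gen_map s \<circ> gen_map t = gen_map t \<circ> gen_map s \<circ> gen_map t \<circ> gen_map s"
      using gen_map_braid_n[of s] by simp
    from rel(3)[OF this] 7(3) show ?thesis by (simp add: simps)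
  next
    case 8
    then have "gen_map s \<circ> gen_map t \<circ> gen_map s \<circ> gen_map t = gen_map t \<circ> gen_map s \<circ> gen_map t \<circ> gen_map s"
      using gen_map_braid_n[of t] by simp
    from rel(3)[OF this] 8(3) show ?thesis by (simp add: simps)
  qed
qed

lemma word_map_cong: "(u, v) \<in> pres_cong S (coxeter_relations S M) \<Longrightarrow> word_map u = word_map v"
proof (induction rule: pres_cong.induct)
  case (pc_cancel u v s b)
  then show ?case by (auto simp: word_map_append gen_map_involution fun_eq_iff)
next
  case (pc_relation u v l r)
  then show ?case by (auto simp: word_map_append coxeter_relations_def word_map_relation)
qed auto

text \<open>A relation word contains each of its two letters \<open>M s t\<close> times. Counting
  letters from \<open>J\<close> modulo 2 respects the relations if \<open>J\<close> never separates
  two generators with odd \<open>M s t\<close>, that is, if it is a union of classes of generators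
  linked by odd orders.\<close>

definition even_cut :: "nat set \<Rightarrow> bool" where
  "even_cut J \<longleftrightarrow> (\<forall>s\<le>n. \<forall>t\<le>n. odd (M s t) \<longrightarrow> (s \<in> J \<longleftrightarrow> t \<in> J))"

lemma length_filter_replicate:
  "length (filter P (concat (replicate k [a, b]))) = k * (of_bool (P a) + of_bool (P b))"
  by (induction k) auto

lemma parity_cong:
  assumes "even_cut J" "(u, v) \<in> pres_cong S (coxeter_relations S M)"
  shows "even (length (filter (\<lambda>l. fst l \<in> J) u)) = even (length (filter (\<lambda>l. fst l \<in> J) v))"
  using assms(2)
proof (induction rule: pres_cong.induct)
  case (pc_relation u v l r)
  then obtain s t where st: "s \<le> n" "t \<le> n" "l = concat (replicate (M s t) [(s, True), (t, True)])" "r = []"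
    by (auto simp: coxeter_relations_def)
  have "even (length (filter (\<lambda>l. fst l \<in> J) l))"
    using assms(1) st unfolding even_cut_def st(3) length_filter_replicate by auto
  then show ?case using st(4) by simp
qed auto

text \<open>The products of generator 0, or of generator n, with the other generators have order 2
  or 4, so each of the two is a class of its own. These characters tell the two kinds of loops
  apart; \<open>UNIV\<close> gives the sign character.\<close>

lemma even_cuts: "even_cut {0}" "even_cut {n}" "even_cut UNIV"
proof -
  have "even_cut J" if "\<And>s t. s \<noteq> t \<Longrightarrow> 1 \<le> s \<Longrightarrow> 1 \<le> t \<Longrightarrow> s < n \<Longrightarrow> t < n \<Longrightarrow> s \<in> J \<longleftrightarrow> t \<in> J" for J
    unfolding even_cut_def
  proof (intro allI impI)
    fix s t assume "s \<le> n" "t \<le> n" and o: "odd (M s t)"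
    then show "s \<in> J \<longleftrightarrow> t \<in> J" by (cases rule: M_cases) (use that o in auto)
  qed
  then show "even_cut {0}" "even_cut {n}" "even_cut UNIV" by auto
qed

lemma carrierE:
  assumes "A \<in> carrier W" obtains u where "u \<in> words S" "A = cls u"
  using assms by (auto simp: coxeter_group_def presented_group_def quotient_def)

lemma cls_some: "u \<in> words S \<Longrightarrow> (u, SOME v. v \<in> cls u) \<in> pres_cong S (coxeter_relations S M)"
  using someI[of "\<lambda>v. v \<in> cls u" u] by (simp add: pc_refl)

lemma act_class: "u \<in> words S \<Longrightarrow> act (cls u) = word_map u"
  unfolding act_def using word_map_cong[OF cls_some] by simp

lemma parity_class: "even_cut J \<Longrightarrow> u \<in> words S \<Longrightarrow>
    parity J (cls u) = odd (length (filter (\<lambda>l. fst l \<in> J) u))"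
  unfolding parity_def using parity_cong[OF _ cls_some] by blast

lemma mult_class: "u \<in> words S \<Longrightarrow> v \<in> words S \<Longrightarrow> cls u \<otimes>\<^bsub>W\<^esub> cls v = cls (u @ v)"
  by (simp add: coxeter_group_def presented_group_mult_class)

lemma one_class: "\<one>\<^bsub>W\<^esub> = cls []"
  by (simp add: coxeter_group_def presented_group_def)

lemma act_mult: "A \<in> carrier W \<Longrightarrow> B \<in> carrier W \<Longrightarrow> act (A \<otimes>\<^bsub>W\<^esub> B) = act A \<circ> act B"
  by (elim carrierE) (simp add: mult_class act_class word_map_append)

lemma act_one: "act \<one>\<^bsub>W\<^esub> = id"
  by (simp add: one_class act_class)

lemma parity_mult: "even_cut J \<Longrightarrow> A \<in> carrier W \<Longrightarrow> B \<in> carrier W \<Longrightarrow>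
    parity J (A \<otimes>\<^bsub>W\<^esub> B) \<longleftrightarrow> parity J A \<noteq> parity J B"
  by (elim carrierE) (simp add: mult_class parity_class)

lemma parity_one: "even_cut J \<Longrightarrow> \<not> parity J \<one>\<^bsub>W\<^esub>"
  by (simp add: one_class parity_class)

lemma sr_class: "sr i = cls [(i, True)]"
  by (simp add: simple_reflection_def pres_gen_def)

lemma sr_carrier [simp, intro]: "i \<le> n \<Longrightarrow> sr i \<in> carrier W"
  by (rule simple_reflection_carrier) simp

lemma act_sr: "i \<le> n \<Longrightarrow> act (sr i) = gen_map i"
  by (simp add: sr_class act_class)

lemma parity_sr: "even_cut J \<Longrightarrow> i \<le> n \<Longrightarrow> parity J (sr i) \<longleftrightarrow> i \<in> J"
  by (simp add: sr_class parity_class)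

lemma equivariant_act: "A \<in> carrier W \<Longrightarrow> equivariant (act A)"
proof (elim carrierE)
  fix u assume u: "u \<in> words S" "A = cls u"
  have "equivariant (word_map u)"
    using u(1)
  proof (induction u)
    case Nil then show ?case by (simp add: equivariant_def)
  next
    case (Cons l u)
    then show ?case unfolding word_map_simps
      by (intro equivariant_comp equivariant_gen_map) auto
  qed
  then show ?thesis using u by (simp add: act_class)
qed

lemma act_inv: "A \<in> carrier W \<Longrightarrow> act (inv\<^bsub>W\<^esub> A) (act A z) = z" "A \<in> carrier W \<Longrightarrow> act A (act (inv\<^bsub>W\<^esub> A) z) = z"
  using act_mult[of "inv\<^bsub>W\<^esub> A" A] act_mult[of A "inv\<^bsub>W\<^esub> A"] by (auto simp: act_one fun_eq_iff)

lemma cls_relation: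
  assumes "s \<le> n" "t \<le> n"
  shows "cls (concat (replicate (M s t) [(s, True), (t, True)])) = \<one>\<^bsub>W\<^esub>"
  unfolding one_class
proof (rule equiv_class_eq[OF equiv_pres_cong])
  let ?l = "concat (replicate (M s t) [(s, True), (t, True)])"
  have *: "concat (replicate k [(s, True), (t, True)]) \<in> words S" for k
    using assms by (induction k) auto
  have "([] @ ?l @ [], [] @ [] @ []) \<in> pres_cong S (coxeter_relations S M)"
    by (rule pc_relation) (use assms * in \<open>auto simp: coxeter_relations_def\<close>)
  then show "(?l, []) \<in> pres_cong S (coxeter_relations S M)" by simp
qed

lemma sr_square: assumes "i \<le> n" shows "sr i \<otimes>\<^bsub>W\<^esub> sr i = \<one>\<^bsub>W\<^esub>"
  using cls_relation[OF assms assms] assms by (simp add: sr_class mult_class affine_C_matrix_def)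

lemma sr_inv: "i \<le> n \<Longrightarrow> inv\<^bsub>W\<^esub> (sr i) = sr i"
  using W.inv_equality[OF sr_square] by simp

lemma sr_commute:
  assumes "s \<le> n" "t \<le> n" "M s t = 2"
  shows "sr s \<otimes>\<^bsub>W\<^esub> sr t = sr t \<otimes>\<^bsub>W\<^esub> sr s"
proof -
  have "(sr s \<otimes>\<^bsub>W\<^esub> sr t) \<otimes>\<^bsub>W\<^esub> (sr s \<otimes>\<^bsub>W\<^esub> sr t) = \<one>\<^bsub>W\<^esub>"
    using cls_relation[OF assms(1,2)] assms by (simp add: sr_class mult_class numeral_eq_Suc)
  then have "sr s \<otimes>\<^bsub>W\<^esub> sr t = inv\<^bsub>W\<^esub> (sr s \<otimes>\<^bsub>W\<^esub> sr t)"
    using assms by (intro W.mult_eq_one_imp_eq_inv) auto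
  then show ?thesis using assms by (simp add: W.inv_mult_group sr_inv)
qed

lemma sr_braid:
  assumes "s \<le> n" "t \<le> n" "M s t = 3"
  shows "sr s \<otimes>\<^bsub>W\<^esub> sr t \<otimes>\<^bsub>W\<^esub> sr s = sr t \<otimes>\<^bsub>W\<^esub> sr s \<otimes>\<^bsub>W\<^esub> sr t"
proof -
  have "(sr s \<otimes>\<^bsub>W\<^esub> sr t \<otimes>\<^bsub>W\<^esub> sr s) \<otimes>\<^bsub>W\<^esub> (sr t \<otimes>\<^bsub>W\<^esub> sr s \<otimes>\<^bsub>W\<^esub> sr t) = \<one>\<^bsub>W\<^esub>"
    using cls_relation[OF assms(1,2)] assms by (simp add: sr_class mult_class numeral_eq_Suc)
  then have "sr s \<otimes>\<^bsub>W\<^esub> sr t \<otimes>\<^bsub>W\<^esub> sr s = inv\<^bsub>W\<^esub> (sr t \<otimes>\<^bsub>W\<^esub> sr s \<otimes>\<^bsub>W\<^esub> sr t)"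
    using assms by (intro W.mult_eq_one_imp_eq_inv) auto
  then show ?thesis using assms by (simp add: W.inv_mult_group sr_inv W.m_assoc)
qed

lemma sr_braid4:
  assumes "s \<le> n" "t \<le> n" "M s t = 4"
  shows "sr s \<otimes>\<^bsub>W\<^esub> sr t \<otimes>\<^bsub>W\<^esub> sr s \<otimes>\<^bsub>W\<^esub> sr t = sr t \<otimes>\<^bsub>W\<^esub> sr s \<otimes>\<^bsub>W\<^esub> sr t \<otimes>\<^bsub>W\<^esub> sr s"
proof -
  have "(sr s \<otimes>\<^bsub>W\<^esub> sr t \<otimes>\<^bsub>W\<^esub> sr s \<otimes>\<^bsub>W\<^esub> sr t) \<otimes>\<^bsub>W\<^esub> (sr s \<otimes>\<^bsub>W\<^esub> sr t \<otimes>\<^bsub>W\<^esub> sr s \<otimes>\<^bsub>W\<^esub> sr t) = \<one>\<^bsub>W\<^esub>"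
    using cls_relation[OF assms(1,2)] assms by (simp add: sr_class mult_class numeral_eq_Suc)
  then have "sr s \<otimes>\<^bsub>W\<^esub> sr t \<otimes>\<^bsub>W\<^esub> sr s \<otimes>\<^bsub>W\<^esub> sr t = inv\<^bsub>W\<^esub> (sr s \<otimes>\<^bsub>W\<^esub> sr t \<otimes>\<^bsub>W\<^esub> sr s \<otimes>\<^bsub>W\<^esub> sr t)"
    using assms by (intro W.mult_eq_one_imp_eq_inv) auto
  then show ?thesis using assms by (simp add: W.inv_mult_group sr_inv W.m_assoc)
qed

section \<open>Word length, ascents and faithfulness\<close>

definition len :: "nat word set \<Rightarrow> nat" where
  "len w = (LEAST k. \<exists>xs. length xs = k \<and> set xs \<subseteq> S \<and> w = list_prod W (map sr xs))"

lemma cls_carrier: "u \<in> words S \<Longrightarrow> cls u \<in> carrier W"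
  by (auto simp: coxeter_group_def presented_group_def intro: quotientI)

lemma sr_list_carrier: "set xs \<subseteq> S \<Longrightarrow> set (map sr xs) \<subseteq> carrier W"
  by auto

lemma word_carrier [simp]: "set xs \<subseteq> S \<Longrightarrow> list_prod W (map sr xs) \<in> carrier W"
  by (intro W.list_prod_closed sr_list_carrier)

lemma carrier_word:
  assumes "w \<in> carrier W" shows "\<exists>xs. set xs \<subseteq> S \<and> w = list_prod W (map sr xs)"
proof -
  have *: "cls u = list_prod W (map sr (map fst u))" if "u \<in> words S" for u
    using that
  proof (induction u)
    case Nil
    then show ?case by (simp add: one_class W.list_prod_simps)
  next
    case (Cons l u)
    have l: "l \<in> S \<times> UNIV" "fst l \<le> n" and u: "u \<in> words S" using Cons.hyps by auto
    have "cls [l] = sr (fst l)"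
    proof (cases "snd l")
      case True
      then show ?thesis by (cases l) (simp add: sr_class)
    next
      case False
      then have "cls [l] \<otimes>\<^bsub>W\<^esub> sr (fst l) = cls [(fst l, False), (fst l, True)]"
        using l by (cases l) (simp add: sr_class mult_class)
      also have "\<dots> = \<one>\<^bsub>W\<^esub>"
        unfolding one_class
        using pc_cancel[of "[]" S "[]" "fst l" False "coxeter_relations S M"] l
        by (intro equiv_class_eq[OF equiv_pres_cong]) simp
      finally have "cls [l] = inv\<^bsub>W\<^esub> (sr (fst l))"
        using l cls_carrier[of "[l]"] by (intro W.mult_eq_one_imp_eq_inv) auto
      then show ?thesis using sr_inv l by simp
    qed
    then show ?case using Cons.IH mult_class[of "[l]" u] l u by (simp add: W.list_prod_simps)
  qed
  obtain u where "u \<in> words S" "w = cls u" using assms by (rule carrierE)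
  then show ?thesis using * by (intro exI[of _ "map fst u"]) auto
qed

lemma len_word: "w \<in> carrier W \<Longrightarrow> \<exists>xs. length xs = len w \<and> set xs \<subseteq> S \<and> w = list_prod W (map sr xs)"
proof -
  assume "w \<in> carrier W"
  then obtain xs where "set xs \<subseteq> S" "w = list_prod W (map sr xs)" using carrier_word by metis
  then have "\<exists>ys. length ys = length xs \<and> set ys \<subseteq> S \<and> w = list_prod W (map sr ys)" by metis
  then show ?thesis unfolding len_def by (rule LeastI)
qed

lemma len_le: "set xs \<subseteq> S \<Longrightarrow> len (list_prod W (map sr xs)) \<le> length xs"
  unfolding len_def by (rule Least_le) auto

lemma len_mult_le:
  assumes "w \<in> carrier W" "i \<le> n" shows "len (w \<otimes>\<^bsub>W\<^esub> sr i) \<le> Suc (len w)"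
proof -
  obtain xs where xs: "length xs = len w" "set xs \<subseteq> S" "w = list_prod W (map sr xs)"
    using len_word[OF assms(1)] by metis
  have "list_prod W (map sr (xs @ [i])) = w \<otimes>\<^bsub>W\<^esub> sr i"
    using W.list_prod_append[of "map sr xs" "[sr i]"] sr_list_carrier[OF xs(2)] xs(3) assms
    by (simp add: W.list_prod_simps)
  then show ?thesis using len_le[of "xs @ [i]"] xs assms by simp
qed

lemma mult_sr_sr: "w \<in> carrier W \<Longrightarrow> i \<le> n \<Longrightarrow> w \<otimes>\<^bsub>W\<^esub> sr i \<otimes>\<^bsub>W\<^esub> sr i = w"
  by (simp add: W.m_assoc sr_square)

lemma odd_len: "w \<in> carrier W \<Longrightarrow> parity UNIV w = odd (len w)"
proof -
  assume "w \<in> carrier W"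
  then obtain xs where xs: "length xs = len w" "set xs \<subseteq> S" "w = list_prod W (map sr xs)"
    using len_word by metis
  have "parity UNIV (list_prod W (map sr xs)) = odd (length xs)"
    using xs(2)
    by (induction xs) (auto simp: W.list_prod_simps parity_one parity_mult parity_sr even_cuts)
  then show ?thesis using xs by simp
qed

text \<open>The length changes by at most one, and the sign character \<open>parity UNIV\<close>
  rules out that it stays the same.\<close>

lemma len_mult:
  assumes "w \<in> carrier W" "i \<le> n"
  shows "len (w \<otimes>\<^bsub>W\<^esub> sr i) = Suc (len w) \<or> len w = Suc (len (w \<otimes>\<^bsub>W\<^esub> sr i))"
proof -
  have "parity UNIV (w \<otimes>\<^bsub>W\<^esub> sr i) \<noteq> parity UNIV w"
    using assms parity_mult[of UNIV w "sr i"] parity_sr[of UNIV i] even_cuts by simp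
  then have "len (w \<otimes>\<^bsub>W\<^esub> sr i) \<noteq> len w" using odd_len[OF assms(1)] odd_len[of "w \<otimes>\<^bsub>W\<^esub> sr i"] assms by auto
  then show ?thesis
    using len_mult_le[OF assms] len_mult_le[of "w \<otimes>\<^bsub>W\<^esub> sr i" i] mult_sr_sr assms by fastforce
qed

lemma descent_exists:
  assumes "w \<in> carrier W" "w \<noteq> \<one>\<^bsub>W\<^esub>"
  obtains t where "t \<le> n" "len w = Suc (len (w \<otimes>\<^bsub>W\<^esub> sr t))"
proof -
  obtain xs where xs: "length xs = len w" "set xs \<subseteq> S" "w = list_prod W (map sr xs)"
    using len_word[OF assms(1)] by metis
  show ?thesis
  proof (cases xs rule: rev_cases)
    case Nil
    then show ?thesis using xs assms by (simp add: W.list_prod_simps)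
  next
    case (snoc ys t)
    have t: "t \<le> n" "set ys \<subseteq> S" using xs snoc by auto
    have "w = list_prod W (map sr ys) \<otimes>\<^bsub>W\<^esub> sr t"
      using W.list_prod_append[of "map sr ys" "[sr t]"] sr_list_carrier[OF t(2)] xs(3) snoc t
      by (simp add: W.list_prod_simps)
    then have "w \<otimes>\<^bsub>W\<^esub> sr t = list_prod W (map sr ys)"
      using mult_sr_sr[OF W.list_prod_closed[OF sr_list_carrier[OF t(2)]] t(1)] by simp
    then have "len (w \<otimes>\<^bsub>W\<^esub> sr t) \<le> length ys" using len_le[OF t(2)] by simp
    then show ?thesis using that[of t] t len_mult[OF assms(1) t(1)] xs(1) snoc by simp
  qed
qed

text \<open>Equivariant maps send \<open>0\<close> to \<open>0\<close> and \<open>n + 1 = N - n\<close> to \<open>N - f n\<close>, so that the cases \<open>i = 0\<close> and \<open>i = n\<close>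
  say \<open>f 1 > 0\<close> and \<open>2 f n < N\<close>.\<close>

definition ascends :: "(int \<Rightarrow> int) \<Rightarrow> nat \<Rightarrow> bool" where
  "ascends f i \<longleftrightarrow> f (int i) < f (int i + 1)"

lemma gen_map_far:
  assumes "s \<le> n" "t \<le> n" "Suc s < t \<or> Suc t < s"
  shows "gen_map t (int s) = int s" "gen_map t (int s + 1) = int s + 1"
proof -
  show "gen_map t (int s) = int s"
    using assms by (cases "t = 0"; cases "t = n") (auto simp: gen_map_0 gen_map_n gen_map_mid)
  show "gen_map t (int s + 1) = int s + 1"
  proof (cases "s = n")
    case True
    then have t: "t < n" "t \<noteq> n" using assms by auto
    have "gen_map t (N - int n) = N - int n"
      using assms True t by (cases "t = 0") (auto simp: gen_map_diff gen_map_0 gen_map_mid)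
    then show ?thesis using True by (simp add: N_def)
  next
    case False
    then have "gen_map t (int (Suc s)) = int (Suc s)"
      using assms by (cases "t = 0"; cases "t = n") (auto simp: gen_map_0 gen_map_n gen_map_mid simp del: of_nat_Suc)
    then show ?thesis by (simp add: add.commute)
  qed
qed

text \<open>Here \<open>v\<close> is the shortest element of its coset modulo two adjacent generators \<open>s\<close> and \<open>t\<close>.\<close>

lemma ascends_rank2_mid:
  assumes v: "ascends v s" "ascends v t" and "1 \<le> s" "1 \<le> t" "s < n" "t < n" "t = Suc s \<or> s = Suc t"
  shows "ascends (v \<circ> gen_map t) s" "ascends (v \<circ> gen_map s \<circ> gen_map t) s"
proof -
  have g: "gen_map i (int x) = (if x = i then int (Suc i) else if x = Suc i then int i else int x)"
    if "i = s \<or> i = t" "x \<le> n" for i x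
    using gen_map_mid[of i x] that assms by auto
  have e: "int x + 1 = int (Suc x)" for x by simp
  from assms(7) show "ascends (v \<circ> gen_map t) s" "ascends (v \<circ> gen_map s \<circ> gen_map t) s"
    using v assms(3-6) unfolding ascends_def e by (auto simp: g simp del: of_nat_Suc)
qed

lemma ascends_rank2_0:
  assumes v: "equivariant v" "ascends v 0" "ascends v 1"
  shows "ascends (v \<circ> gen_map 1) 0" "ascends (v \<circ> gen_map 0 \<circ> gen_map 1) 0"
    "ascends (v \<circ> gen_map 1 \<circ> gen_map 0 \<circ> gen_map 1) 0"
    "ascends (v \<circ> gen_map 0) 1" "ascends (v \<circ> gen_map 1 \<circ> gen_map 0) 1"
    "ascends (v \<circ> gen_map 0 \<circ> gen_map 1 \<circ> gen_map 0) 1"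
proof -
  have g: "gen_map 0 0 = 0" "gen_map 1 0 = 0" "gen_map 0 1 = - 1" "gen_map 0 2 = 2" "gen_map 1 1 = 2" "gen_map 1 2 = 1"
    using gen_map_0[of 0] gen_map_0[of 1] gen_map_0[of 2] gen_map_mid[of 1 0] gen_map_mid[of 1 1] gen_map_mid[of 1 2] n_ge_2
    by auto
  have g': "gen_map 0 (- z) = - gen_map 0 z" "gen_map 1 (- z) = - gen_map 1 z" for z
    using gen_map_neg n_ge_2 by auto
  show "ascends (v \<circ> gen_map 1) 0" "ascends (v \<circ> gen_map 0 \<circ> gen_map 1) 0"
    "ascends (v \<circ> gen_map 1 \<circ> gen_map 0 \<circ> gen_map 1) 0"
    "ascends (v \<circ> gen_map 0) 1" "ascends (v \<circ> gen_map 1 \<circ> gen_map 0) 1"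
    "ascends (v \<circ> gen_map 0 \<circ> gen_map 1 \<circ> gen_map 0) 1"
    using v(2,3) equivariant_0[OF v(1)] equivariant_neg[OF v(1)]
    by (simp_all add: ascends_def g g' del: One_nat_def)
qed

lemma ascends_rank2_n:
  assumes v: "equivariant v" "ascends v m" "ascends v n" and n: "n = Suc m"
  shows "ascends (v \<circ> gen_map m) n" "ascends (v \<circ> gen_map n \<circ> gen_map m) n"
    "ascends (v \<circ> gen_map m \<circ> gen_map n \<circ> gen_map m) n"
    "ascends (v \<circ> gen_map n) m" "ascends (v \<circ> gen_map m \<circ> gen_map n) m"
    "ascends (v \<circ> gen_map n \<circ> gen_map m \<circ> gen_map n) m"
proof -
  define a b where "a = int m" "b = int n"
  have g: "gen_map m a = b" "gen_map m b = a" "gen_map n a = a" "gen_map n b = N - b"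
    using gen_map_n[of m] gen_map_n[of n] gen_map_mid[of m m] gen_map_mid[of m n] n n_ge_2
    by (auto simp: a_b_def simp del: of_nat_Suc)
  have g': "gen_map m (N - z) = N - gen_map m z" "gen_map n (N - z) = N - gen_map n z" for z
    using gen_map_diff[of m] gen_map_diff[of n] n by auto
  have v': "v (N - z) = N - v z" for z using equivariant_diff[OF v(1), of 1 z] by simp
  have e: "a + 1 = b" "b + 1 = N - b" "int m = a" "int n = b"
  proof -
    show "a + 1 = b" "int m = a" "int n = b" using n by (simp_all add: a_b_def)
    show "b + 1 = N - b" by (simp add: a_b_def N_def)
  qed
  show "ascends (v \<circ> gen_map m) n" "ascends (v \<circ> gen_map n \<circ> gen_map m) n"
    "ascends (v \<circ> gen_map m \<circ> gen_map n \<circ> gen_map m) n"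
    "ascends (v \<circ> gen_map n) m" "ascends (v \<circ> gen_map m \<circ> gen_map n) m"
    "ascends (v \<circ> gen_map n \<circ> gen_map m \<circ> gen_map n) m"
    using v(2,3) unfolding ascends_def e by (simp_all add: g g' v')
qed

text \<open>The alternating words ending in \<open>t\<close> that are shorter than
  \<open>M s t\<close> are t, s t and t s t, as far as they occur. As in the finite dihedral group
  generated by \<open>s\<close> and \<open>t\<close>, such words do not destroy the ascent at
  \<open>s\<close>.\<close>

lemma ascends_rank2:
  assumes "s \<le> n" "t \<le> n" "s \<noteq> t" "equivariant v" "ascends v s" "ascends v t"
  shows "ascends (v \<circ> gen_map t) s"
    and "M s t > 2 \<Longrightarrow> ascends (v \<circ> gen_map s \<circ> gen_map t) s"
    and "M s t > 3 \<Longrightarrow> ascends (v \<circ> gen_map t \<circ> gen_map s \<circ> gen_map t) s"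
proof -
  note v = assms(4-6)
  from assms(1,2) have "ascends (v \<circ> gen_map t) s \<and> (M s t > 2 \<longrightarrow> ascends (v \<circ> gen_map s \<circ> gen_map t) s)
    \<and> (M s t > 3 \<longrightarrow> ascends (v \<circ> gen_map t \<circ> gen_map s \<circ> gen_map t) s)"
  proof (cases rule: M_cases)
    case 1 then show ?thesis using assms by simp
  next
    case 2 then show ?thesis using v gen_map_far[OF assms(1,2)] by (simp add: ascends_def)
  next
    case 3 then show ?thesis using ascends_rank2_mid[OF v(2,3)] by simp
  next
    case 4 then show ?thesis using ascends_rank2_mid[OF v(2,3)] by simp
  next
    case 5 then show ?thesis using ascends_rank2_0[OF v(1)] v by simp
  next
    case 6 then show ?thesis using ascends_rank2_0[OF v(1)] v by simp
  next
    case 7 then show ?thesis using ascends_rank2_n[OF v(1) _ _ 7(1)] v by blast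
  next
    case 8 then show ?thesis using ascends_rank2_n[OF v(1) _ _ 8(1)] v by blast
  qed
  then show "ascends (v \<circ> gen_map t) s"
    "M s t > 2 \<Longrightarrow> ascends (v \<circ> gen_map s \<circ> gen_map t) s"
    "M s t > 3 \<Longrightarrow> ascends (v \<circ> gen_map t \<circ> gen_map s \<circ> gen_map t) s" by auto
qed

text \<open>As for the geometric representation of a Coxeter group: splitting off an alternating word in \<open>s\<close> and a
  descent \<open>t\<close> that is as long as possible reduces the claim to rank two.\<close>

lemma len_imp_ascends:
  assumes "w \<in> carrier W" "s \<le> n" "len w < len (w \<otimes>\<^bsub>W\<^esub> sr s)"
  shows "ascends (act w) s"
  using assms
proof (induction "len w" arbitrary: w s rule: less_induct)
  case less
  note w = less.prems(1) and s = less.prems(2)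
  have IH: "ascends (act v) i" if "v \<in> carrier W" "len v < len w" "i \<le> n" "len v < len (v \<otimes>\<^bsub>W\<^esub> sr i)" for v i
    using less.hyps that by blast
  show ?case
  proof (cases "w = \<one>\<^bsub>W\<^esub>")
    case True
    then show ?thesis by (simp add: act_one ascends_def)
  next
    case False
    then obtain t where t: "t \<le> n" "len w = Suc (len (w \<otimes>\<^bsub>W\<^esub> sr t))"
      using descent_exists w by blast
    have st: "s \<noteq> t" using t less.prems(3) by auto
    note lm = len_mult_le
    define w1 where "w1 = w \<otimes>\<^bsub>W\<^esub> sr t"
    have w1: "w1 \<in> carrier W" "w = w1 \<otimes>\<^bsub>W\<^esub> sr t" "len w = Suc (len w1)"
      using w t mult_sr_sr by (auto simp: w1_def)
    have a1: "act w = act w1 \<circ> gen_map t" using w1 t by (simp add: act_mult act_sr)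
    show ?thesis
    proof (cases "len w1 < len (w1 \<otimes>\<^bsub>W\<^esub> sr s)")
      case True
      have "ascends (act w1) s" "ascends (act w1) t"
        using IH[OF w1(1) _ s True] IH[OF w1(1) _ t(1)] w1 by auto
      then show ?thesis using ascends_rank2(1)[OF s t(1) st equivariant_act[OF w1(1)]] a1 by simp
    next
      case F1: False
      define w2 where "w2 = w1 \<otimes>\<^bsub>W\<^esub> sr s"
      have w2: "w2 \<in> carrier W" "w1 = w2 \<otimes>\<^bsub>W\<^esub> sr s" "len w1 = Suc (len w2)"
        using w1 s mult_sr_sr F1 len_mult[OF w1(1) s] by (auto simp: w2_def)
      have a2: "act w = act w2 \<circ> gen_map s \<circ> gen_map t" using a1 w2 s by (simp add: act_mult act_sr)
      \<comment> \<open>If \<open>s\<close> and \<open>t\<close> commuted, \<open>w\<close> would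
        have a shortest word ending in \<open>s\<close>, and multiplying by \<open>s\<close> would
        shorten it. The braid relations of order 3 and 4 exclude longer alternating tails in the
        same way.\<close>
      have m2: "M s t \<noteq> 2"
      proof
        assume "M s t = 2"
        then have "w = w2 \<otimes>\<^bsub>W\<^esub> sr t \<otimes>\<^bsub>W\<^esub> sr s"
          using sr_commute[OF s t(1)] w1 w2 s t by (simp add: W.m_assoc)
        then have "w \<otimes>\<^bsub>W\<^esub> sr s = w2 \<otimes>\<^bsub>W\<^esub> sr t" using mult_sr_sr w2 s t by simp
        then show False using lm[OF w2(1) t(1)] less.prems(3) w1 w2 by simp
      qed
      have m2': "M s t > 2" by (cases rule: M_cases[OF s t(1)]) (use st m2 in auto)
      show ?thesis
      proof (cases "len w2 < len (w2 \<otimes>\<^bsub>W\<^esub> sr t)")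
        case True
        have "ascends (act w2) s" "ascends (act w2) t"
          using IH[OF w2(1) _ t(1) True] IH[OF w2(1) _ s] w1 w2 by auto
        then show ?thesis using ascends_rank2(2)[OF s t(1) st equivariant_act[OF w2(1)] _ _ m2'] a2 by simp
      next
        case F2: False
        define w3 where "w3 = w2 \<otimes>\<^bsub>W\<^esub> sr t"
        have w3: "w3 \<in> carrier W" "w2 = w3 \<otimes>\<^bsub>W\<^esub> sr t" "len w2 = Suc (len w3)"
          using w2 t mult_sr_sr F2 len_mult[OF w2(1) t(1)] by (auto simp: w3_def)
        have a3: "act w = act w3 \<circ> gen_map t \<circ> gen_map s \<circ> gen_map t" using a2 w3 t by (simp add: act_mult act_sr)
        have m3: "M s t \<noteq> 3"
        proof
          assume "M s t = 3"
          then have "w = w3 \<otimes>\<^bsub>W\<^esub> sr s \<otimes>\<^bsub>W\<^esub> sr t \<otimes>\<^bsub>W\<^esub> sr s"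
            using sr_braid[OF s t(1)] w1 w2 w3 s t by (simp add: W.m_assoc)
          then have "w \<otimes>\<^bsub>W\<^esub> sr s = w3 \<otimes>\<^bsub>W\<^esub> sr s \<otimes>\<^bsub>W\<^esub> sr t" using mult_sr_sr w3 s t by simp
          then show False using lm[OF w3(1) s] lm[OF _ t(1), of "w3 \<otimes>\<^bsub>W\<^esub> sr s"] less.prems(3) w1 w2 w3 s by simp
        qed
        have m4: "M s t = 4" by (cases rule: M_cases[OF s t(1)]) (use st m2 m3 in auto)
        show ?thesis
        proof (cases "len w3 < len (w3 \<otimes>\<^bsub>W\<^esub> sr s)")
          case True
          have "ascends (act w3) s" "ascends (act w3) t"
            using IH[OF w3(1) _ s True] IH[OF w3(1) _ t(1)] w1 w2 w3 by auto
          then show ?thesis using ascends_rank2(3)[OF s t(1) st equivariant_act[OF w3(1)]] a3 m4 by simp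
        next
          case F3: False
          define w4 where "w4 = w3 \<otimes>\<^bsub>W\<^esub> sr s"
          have w4: "w4 \<in> carrier W" "w3 = w4 \<otimes>\<^bsub>W\<^esub> sr s" "len w3 = Suc (len w4)"
            using w3 s mult_sr_sr F3 len_mult[OF w3(1) s] by (auto simp: w4_def)
          have "w = w4 \<otimes>\<^bsub>W\<^esub> sr t \<otimes>\<^bsub>W\<^esub> sr s \<otimes>\<^bsub>W\<^esub> sr t \<otimes>\<^bsub>W\<^esub> sr s"
            using sr_braid4[OF s t(1) m4] w1 w2 w3 w4 s t by (simp add: W.m_assoc)
          then have "w \<otimes>\<^bsub>W\<^esub> sr s = w4 \<otimes>\<^bsub>W\<^esub> sr t \<otimes>\<^bsub>W\<^esub> sr s \<otimes>\<^bsub>W\<^esub> sr t" using mult_sr_sr w4 s t by simp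
          then show ?thesis
            using lm[OF w4(1) t(1)] lm[OF _ s, of "w4 \<otimes>\<^bsub>W\<^esub> sr t"] lm[OF _ t(1), of "w4 \<otimes>\<^bsub>W\<^esub> sr t \<otimes>\<^bsub>W\<^esub> sr s"]
              less.prems(3) w1 w2 w3 w4 s t by simp
        qed
      qed
    qed
  qed
qed

text \<open>Faithfulness: cut a descent \<open>t\<close> off a nontrivial \<open>w\<close> in the
  kernel. The rest ascends at \<open>t\<close> by \<open>len_imp_ascends\<close>, but it acts as the
  generator \<open>t\<close>, which does not.\<close>

lemma act_eq_id:
  assumes "w \<in> carrier W" "act w = id" shows "w = \<one>\<^bsub>W\<^esub>"
proof (rule ccontr)
  assume "w \<noteq> \<one>\<^bsub>W\<^esub>"
  then obtain t where t: "t \<le> n" "len w = Suc (len (w \<otimes>\<^bsub>W\<^esub> sr t))" using descent_exists assms by blast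
  let ?v = "w \<otimes>\<^bsub>W\<^esub> sr t"
  have v: "?v \<in> carrier W" using assms t by simp
  have "ascends (act ?v) t" by (rule len_imp_ascends) (use v t assms mult_sr_sr in auto)
  moreover have "act ?v = gen_map t" using assms t by (simp add: act_mult act_sr)
  moreover have "\<not> ascends (gen_map t) t"
  proof -
    consider "t = 0" | "t = n" | "1 \<le> t" "t < n" using t by linarith
    then show ?thesis
    proof cases
      case 1 then show ?thesis using gen_map_0[of 0] gen_map_0[of 1] n_ge_2 by (simp add: ascends_def)
    next
      case 2 then show ?thesis using gen_map_n[of n] gen_map_diff[of n "int n"] n_ge_2 by (simp add: ascends_def N_def)
    next
      case 3 then show ?thesis using gen_map_mid[of t t] gen_map_mid[of t "Suc t"]
        by (simp add: ascends_def add.commute)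
    qed
  qed
  ultimately show False by simp
qed

lemma act_inject:
  assumes "v \<in> carrier W" "w \<in> carrier W" "act v = act w" shows "v = w"
proof -
  have "act (v \<otimes>\<^bsub>W\<^esub> inv\<^bsub>W\<^esub> w) = id"
    using assms act_inv(2)[of w] by (auto simp: act_mult)
  then have "v \<otimes>\<^bsub>W\<^esub> inv\<^bsub>W\<^esub> w = \<one>\<^bsub>W\<^esub>" using assms by (intro act_eq_id) auto
  then show ?thesis using assms W.mult_eq_one_imp_eq_inv[of v "inv\<^bsub>W\<^esub> w"] by simp
qed

end

section \<open>Reflections and labellings\<close>

text \<open>Each pair of \<open>E\<close> merges at most two of the current values, so it costs at
  most one. This stands in for the bound that a graph has at least as many components as vertices
  minus edges.\<close>

lemma merge_labels:
  assumes "finite A"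
  shows "\<exists>\<phi>::'b \<Rightarrow> 'b. (\<forall>(a, b)\<in>set E. \<phi> a = \<phi> b) \<and> card A \<le> card (\<phi> ` A) + length E"
proof (induction E)
  case Nil
  show ?case by (rule exI[of _ id]) simp
next
  case (Cons p E)
  obtain a b where p: "p = (a, b)" by (cases p)
  from Cons.IH obtain \<phi> :: "'b \<Rightarrow> 'b" where
    \<phi>: "\<forall>(a, b)\<in>set E. \<phi> a = \<phi> b" "card A \<le> card (\<phi> ` A) + length E" by blast
  define \<psi> where "\<psi> x = (if \<phi> x = \<phi> a then \<phi> b else \<phi> x)" for x
  have "\<phi> ` A \<subseteq> insert (\<phi> a) (\<psi> ` A)" by (auto simp: \<psi>_def)
  then have "card (\<phi> ` A) \<le> card (insert (\<phi> a) (\<psi> ` A))" using assms by (intro card_mono) auto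
  also have "\<dots> \<le> Suc (card (\<psi> ` A))" using assms by (simp add: card_insert_if)
  finally have "card A \<le> card (\<psi> ` A) + length (p # E)" using \<phi>(2) by simp
  moreover have "\<forall>(a, b)\<in>set (p # E). \<psi> a = \<psi> b" using \<phi>(1) p by (auto simp: \<psi>_def)
  ultimately show ?case by blast
qed

context affine_C
begin

section \<open>Types of reflections\<close>

abbreviation "R \<equiv> reflections S M"
abbreviation "loopA \<equiv> parity {0}"
abbreviation "loopB \<equiv> parity {n}"
abbreviation "edge r \<equiv> \<not> loopA r \<and> \<not> loopB r"
abbreviation "X \<equiv> {x. \<not> N dvd x}"

lemma R_carrier: "r \<in> R \<Longrightarrow> r \<in> carrier W"
  using reflections_carrier by blast

lemma R_list_carrier: "set L \<subseteq> R \<Longrightarrow> set L \<subseteq> carrier W"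
  using R_carrier by blast

lemma list_prod_R [simp]: "set L \<subseteq> R \<Longrightarrow> list_prod W L \<in> carrier W"
  by (intro W.list_prod_closed R_list_carrier)

lemma R_conj: "g \<in> carrier W \<Longrightarrow> r \<in> R \<Longrightarrow> g \<otimes>\<^bsub>W\<^esub> r \<otimes>\<^bsub>W\<^esub> inv\<^bsub>W\<^esub> g \<in> R"
  by (rule reflections_conj)

lemma R_conj': "g \<in> carrier W \<Longrightarrow> r \<in> R \<Longrightarrow> inv\<^bsub>W\<^esub> g \<otimes>\<^bsub>W\<^esub> r \<otimes>\<^bsub>W\<^esub> g \<in> R"
  using R_conj[of "inv\<^bsub>W\<^esub> g" r] by simp

lemma parity_conj:
  assumes "even_cut J" "g \<in> carrier W" "r \<in> carrier W"
  shows "parity J (g \<otimes>\<^bsub>W\<^esub> r \<otimes>\<^bsub>W\<^esub> inv\<^bsub>W\<^esub> g) \<longleftrightarrow> parity J r"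
proof -
  have "parity J (inv\<^bsub>W\<^esub> g) \<longleftrightarrow> parity J g"
    using parity_mult[OF assms(1), of g "inv\<^bsub>W\<^esub> g"] parity_one[OF assms(1)] assms(2) by simp
  then show ?thesis using assms by (auto simp: parity_mult)
qed

lemma act_conj:
  assumes "g \<in> carrier W" "r \<in> carrier W" "act r = mirror x y" "mirror_pair x y"
  shows "act (g \<otimes>\<^bsub>W\<^esub> r \<otimes>\<^bsub>W\<^esub> inv\<^bsub>W\<^esub> g) = mirror (act g x) (act g y)" "mirror_pair (act g x) (act g y)"
proof -
  note c = conj_mirror[OF assms(4) equivariant_act[OF assms(1)] equivariant_act[OF W.inv_closed[OF assms(1)]] act_inv(1)[OF assms(1)]]
  show "mirror_pair (act g x) (act g y)" by (rule c)
  show "act (g \<otimes>\<^bsub>W\<^esub> r \<otimes>\<^bsub>W\<^esub> inv\<^bsub>W\<^esub> g) = mirror (act g x) (act g y)"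
    using assms c(2) by (auto simp: act_mult act_inv fun_eq_iff)
qed

text \<open>Conjugation by \<open>g\<close> moves the two points of a generator's mirror by
  \<open>g\<close> and keeps both parities, so the geometric type and the parity type of a
  reflection determine each other. The partner of \<open>x\<close> stays \<open>- x\<close> or
  \<open>N - x\<close> because \<open>g\<close> is equivariant.\<close>

lemma reflE:
  assumes "r \<in> R"
  obtains x y where "act r = mirror x y" "mirror_pair x y" "\<not> sim x y" "\<not> loopA r" "\<not> loopB r"
  | x where "act r = mirror x (- x)" "mirror_pair x (- x)" "loopA r" "\<not> loopB r"
  | x where "act r = mirror x (N - x)" "mirror_pair x (N - x)" "\<not> loopA r" "loopB r"
proof -
  obtain g i where g: "g \<in> carrier W" "i \<le> n" "r = g \<otimes>\<^bsub>W\<^esub> sr i \<otimes>\<^bsub>W\<^esub> inv\<^bsub>W\<^esub> g"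
    using assms by (auto simp: reflections_def)
  have p: "loopA r \<longleftrightarrow> i = 0" "loopB r \<longleftrightarrow> i = n"
    unfolding g(3) using parity_conj[OF _ g(1) sr_carrier[OF g(2)]] parity_sr[OF _ g(2)] even_cuts by auto
  note eg = equivariant_act[OF g(1)]
  consider "i = 0" | "i = n" | "1 \<le> i" "i < n" using g(2) by linarith
  then show ?thesis
  proof cases
    case 1
    have "act (sr i) = mirror 1 (- 1)" using 1 by (simp add: act_sr gen_map_def)
    from act_conj[OF g(1) sr_carrier[OF g(2)] this mirror_pair_gen(1)] show ?thesis
      using that(2)[of "act g 1"] p 1 n_ge_2 equivariant_neg[OF eg] g(3) by simp
  next
    case 2
    have i: "1 \<le> i" using 2 n_ge_2 by simp
    have "act (sr i) = mirror (int i) (int i + 1)" using i g(2) by (simp add: act_sr gen_map_def)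
    from act_conj[OF g(1) sr_carrier[OF g(2)] this mirror_pair_gen(2)[OF i g(2)]]
    have *: "act r = mirror (act g (int i)) (act g (int i + 1))" "mirror_pair (act g (int i)) (act g (int i + 1))"
      using g(3) by simp_all
    have "act g (int i + 1) = act g (1 * N - int i)" using 2 by (simp add: N_def)
    also have "\<dots> = N - act g (int i)" using equivariant_diff[OF eg, of 1 "int i"] by simp
    finally have "act g (int i + 1) = N - act g (int i)" .
    then show ?thesis using that(3)[of "act g (int i)"] p 2 n_ge_2 * by simp
  next
    case 3
    have "act (sr i) = mirror (int i) (int i + 1)" using 3 g(2) by (simp add: act_sr gen_map_def)
    from act_conj[OF g(1) sr_carrier[OF g(2)] this mirror_pair_gen(2)[OF 3(1) g(2)]]
    have *: "act r = mirror (act g (int i)) (act g (int i + 1))" "mirror_pair (act g (int i)) (act g (int i + 1))"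
      using g(3) by simp_all
    have "\<not> sim (int i) (int i + 1)" using not_sim_nodes[of i "Suc i"] 3 by (simp add: add.commute)
    then have "\<not> sim (act g (int i)) (act g (int i + 1))"
      using equivariant_sim[OF equivariant_act[OF W.inv_closed[OF g(1)]], of "act g (int i)" "act g (int i + 1)"]
        act_inv(1)[OF g(1)] by auto
    then show ?thesis using that(1) * p 3 by simp
  qed
qed

lemma refl_moved:
  assumes "r \<in> R" "act r z \<noteq> z"
  shows "act r = mirror z (act r z)" "mirror_pair z (act r z)"
proof -
  obtain x y where "act r = mirror x y" "mirror_pair x y" using assms(1) by (rule reflE)
  then show "act r = mirror z (act r z)" "mirror_pair z (act r z)"
    using mirror_rebase[of x y z] assms(2) by simp_all
qed

lemma not_loopA_and_loopB: "r \<in> R \<Longrightarrow> \<not> (loopA r \<and> loopB r)"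
  by (erule reflE) auto

text \<open>The mirror of \<open>x\<close> and \<open>- x\<close> reflects each translate of the
  pair in a multiple k N of \<open>N\<close>, which makes the sum of the two exchanged points 2 k N.
  For the other class the centres are (k + 1/2) N, whence the odd multiples in
  \<open>loopB_moved\<close>.\<close>

lemma loopA_moved:
  assumes "r \<in> R" "loopA r" "act r z \<noteq> z" shows "\<exists>k. act r z = 2 * k * N - z"
  using assms(1)
proof (cases rule: reflE)
  case (2 x)
  show ?thesis using 2(2) assms(3) unfolding 2(1)
    by (cases rule: mirror_cases[where z = z]) auto
qed (use assms in auto)

lemma loopB_moved:
  assumes "r \<in> R" "loopB r" "act r z \<noteq> z" shows "\<exists>k. act r z = (2 * k + 1) * N - z"
  using assms(1)
proof (cases rule: reflE)
  case (3 x)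
  show ?thesis using 3(2) assms(3) unfolding 3(1)
  proof (cases rule: mirror_cases[where z = z])
    case (pos k) then show "\<exists>k. mirror x (N - x) z = (2 * k + 1) * N - z" by (intro exI[of _ k]) (simp add: algebra_simps)
  next
    case (neg k) then show "\<exists>k. mirror x (N - x) z = (2 * k + 1) * N - z" by (intro exI[of _ "k - 1"]) (simp add: algebra_simps)
  next
    case (pos' k) then show "\<exists>k. mirror x (N - x) z = (2 * k + 1) * N - z" by (intro exI[of _ k]) (simp add: algebra_simps)
  next
    case (neg' k) then show "\<exists>k. mirror x (N - x) z = (2 * k + 1) * N - z" by (intro exI[of _ "k - 1"]) (simp add: algebra_simps)
  qed simp
qed (use assms in auto)

lemma loop_sim:
  assumes "r \<in> R" "\<not> edge r" shows "sim (act r z) z"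
proof (cases "act r z = z")
  case False
  obtain k where "act r z = k * N - z"
    using loopA_moved[OF assms(1) _ False] loopB_moved[OF assms(1) _ False] assms(2) by blast
  then show ?thesis by (simp only: simI2)
qed simp

section \<open>Counting labels\<close>

definition dihedral_invariant :: "(int \<Rightarrow> 'b) \<Rightarrow> bool" where
  "dihedral_invariant f \<longleftrightarrow> (\<forall>x y. sim x y \<longrightarrow> f x = f y)"

text \<open>The representative of the dihedral orbit of \<open>x\<close> among 0, ..., n.\<close>

definition vertex :: "int \<Rightarrow> int" where
  "vertex x = min (x mod N) ((- x) mod N)"

lemma vertex_invariant: "dihedral_invariant vertex"
  unfolding dihedral_invariant_def
proof (intro allI impI)
  fix x y assume "sim x y"
  then show "vertex x = vertex y"
  proof (cases rule: simE)
    case (1 k)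
    have "- x = - y + (- k) * N" using 1 by simp
    then have "(- x) mod N = (- y) mod N" by (metis mod_mult_self1)
    then show ?thesis using 1 by (simp add: vertex_def)
  next
    case (2 k)
    have "- x = y + (- k) * N" "x = - y + k * N" using 2 by simp_all
    then have "(- x) mod N = y mod N" "x mod N = (- y) mod N" by (metis mod_mult_self1)+
    then show ?thesis by (simp add: vertex_def min.commute)
  qed
qed

lemma vertex_node: assumes "1 \<le> x" "x \<le> n" shows "vertex (int x) = int x"
proof -
  have "int x mod N = int x" using assms by (simp add: N_def)
  moreover have "(- int x) mod N = N - int x"
    using assms int_mod_pos_eq[of "- int x" N "- 1" "N - int x"] by (simp add: N_def)
  ultimately show ?thesis using assms by (simp add: vertex_def N_def)
qed

lemma card_vertex: "finite (vertex ` X)" "n \<le> card (vertex ` X)"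
proof -
  have "vertex ` X \<subseteq> {0..<N}" using N_ge_5 by (auto simp: vertex_def min_def)
  then show f: "finite (vertex ` X)" by (rule finite_subset) simp
  have "int ` {1..n} \<subseteq> vertex ` X"
  proof
    fix z assume "z \<in> int ` {1..n}"
    then obtain x where "z = int x" "1 \<le> x" "x \<le> n" by auto
    then show "z \<in> vertex ` X" using vertex_node[of x] node_not_dvd[of x]
      by (intro image_eqI[of _ _ "int x"]) auto
  qed
  then have "card (int ` {1..n}) \<le> card (vertex ` X)" by (rule card_mono[OF f])
  then show "n \<le> card (vertex ` X)" by (simp add: card_image)
qed

text \<open>Each of the 2 n nonzero residues modulo \<open>N\<close> has \<open>K\<close> lifts
  modulo \<open>K * N\<close>.\<close>

lemma card_residues:
  fixes K :: nat assumes "K > 0"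
  shows "finite ((\<lambda>x. x mod (int K * N)) ` X)" "2 * n * K \<le> card ((\<lambda>x. x mod (int K * N)) ` X)"
proof -
  let ?f = "\<lambda>x. x mod (int K * N)"
  let ?g = "\<lambda>(j, i). int j * N + int i"
  have KN: "int K * N > 0" using assms N_ge_5 by simp
  have "?f ` X \<subseteq> {0..<int K * N}" using KN by auto
  then show f: "finite (?f ` X)" by (rule finite_subset) simp
  have i: "inj_on ?g ({..<K} \<times> {1..2 * n})"
  proof (rule inj_onI, clarify)
    fix j i j' i' assume *: "i \<in> {1..2 * n}" "i' \<in> {1..2 * n}" "int j * N + int i = int j' * N + int i'"
    have "(int j * N + int i) mod N = int i" "(int j' * N + int i') mod N = int i'"
      using *(1,2) by (simp_all add: N_def)
    then have "i = i'" using *(3) by simp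
    moreover from this *(3) have "j = j'" using N_ge_5 by simp
    ultimately show "j = j' \<and> i = i'" by simp
  qed
  have "?g ` ({..<K} \<times> {1..2 * n}) \<subseteq> ?f ` X"
  proof clarify
    fix j i assume *: "j < K" "i \<in> {1..2 * n}"
    have "(int j + 1) * N \<le> int K * N" using *(1) N_ge_5 by (intro mult_right_mono) auto
    then have "int j * N + int i < int K * N" using *(2) by (simp add: N_def algebra_simps)
    moreover have "0 \<le> int j * N + int i" using N_ge_5 by simp
    ultimately have "?f (int j * N + int i) = int j * N + int i" by (rule mod_pos_pos_trivial[rotated])
    moreover have "\<not> N dvd int i" using *(2) zdvd_imp_le[of N "int i"] by (auto simp: N_def)
    then have "\<not> N dvd int j * N + int i" by (simp add: dvd_add_right_iff)
    ultimately show "int j * N + int i \<in> ?f ` X" by (intro image_eqI[of _ _ "int j * N + int i"]) auto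
  qed
  then have "card (?g ` ({..<K} \<times> {1..2 * n})) \<le> card (?f ` X)" by (rule card_mono[OF f])
  then show "2 * n * K \<le> card (?f ` X)" unfolding card_image[OF i] by (simp add: mult.commute)
qed

text \<open>The common part of \<open>invariant_label\<close> and \<open>periodic_label\<close>:
  \<open>f0\<close> gives the initial labels, and \<open>d\<close> bounds the number of
  identifications after which one mirror preserves them. Only the edges of \<open>L\<close> are
  merged.\<close>

lemma edges_merge:
  fixes f0 :: "int \<Rightarrow> int"
  assumes "\<And>x y. mirror_pair x y \<Longrightarrow> \<exists>E. length E \<le> d \<and> (\<forall>\<phi>::int \<Rightarrow> int. (\<forall>(a, b)\<in>set E. \<phi> a = \<phi> b) \<longrightarrow>
      (\<forall>k. \<phi> (f0 (x + k * N)) = \<phi> (f0 (y + k * N)) \<and> \<phi> (f0 (k * N - x)) = \<phi> (f0 (k * N - y))))"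
    and "finite (f0 ` X)" "set L \<subseteq> R"
  shows "\<exists>\<phi>::int \<Rightarrow> int. (\<forall>r\<in>set L. \<forall>z. edge r \<longrightarrow> \<phi> (f0 (act r z)) = \<phi> (f0 z)) \<and>
    card (f0 ` X) \<le> card ((\<phi> \<circ> f0) ` X) + d * length (filter edge L)"
proof -
  have "\<exists>E. length E \<le> d * length (filter edge L) \<and> (\<forall>\<phi>::int \<Rightarrow> int. (\<forall>(a, b)\<in>set E. \<phi> a = \<phi> b) \<longrightarrow>
      (\<forall>r\<in>set L. \<forall>z. edge r \<longrightarrow> \<phi> (f0 (act r z)) = \<phi> (f0 z)))"
    using assms(3)
  proof (induction L)
    case Nil
    show ?case by (rule exI[of _ "[]"]) simp
  next
    case (Cons r L)
    obtain E where E: "length E \<le> d * length (filter edge L)"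
      "\<And>\<phi>::int \<Rightarrow> int. (\<forall>(a, b)\<in>set E. \<phi> a = \<phi> b) \<Longrightarrow> \<forall>r\<in>set L. \<forall>z. edge r \<longrightarrow> \<phi> (f0 (act r z)) = \<phi> (f0 z)"
      using Cons by auto
    show ?case
    proof (cases "edge r")
      case False
      then show ?thesis using E by (intro exI[of _ E]) auto
    next
      case True
      have r: "r \<in> R" using Cons.prems by simp
      from r obtain x y where xy: "act r = mirror x y" "mirror_pair x y"
        by (cases rule: reflE) (use True in auto)
      obtain E' where E': "length E' \<le> d" "\<And>\<phi>::int \<Rightarrow> int. (\<forall>(a, b)\<in>set E'. \<phi> a = \<phi> b) \<Longrightarrow>
        (\<forall>k. \<phi> (f0 (x + k * N)) = \<phi> (f0 (y + k * N)) \<and> \<phi> (f0 (k * N - x)) = \<phi> (f0 (k * N - y)))"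
        using assms(1)[OF xy(2)] by auto
      show ?thesis
      proof (intro exI[of _ "E' @ E"] conjI allI impI ballI)
        show "length (E' @ E) \<le> d * length (filter edge (r # L))" using E(1) E'(1) True by simp
        fix \<phi> :: "int \<Rightarrow> int" and q z assume *: "\<forall>(a, b)\<in>set (E' @ E). \<phi> a = \<phi> b" "q \<in> set (r # L)" "edge q"
        have "\<phi> (f0 (mirror x y z)) = \<phi> (f0 z)"
          using mirror_label[OF xy(2), of "\<lambda>z. \<phi> (f0 z)" z] E'(2)[of \<phi>] *(1) by auto
        moreover have "\<forall>r\<in>set L. \<forall>z. edge r \<longrightarrow> \<phi> (f0 (act r z)) = \<phi> (f0 z)"
          using E(2)[of \<phi>] *(1) by auto
        ultimately show "\<phi> (f0 (act q z)) = \<phi> (f0 z)" using *(2,3) xy(1) by auto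
      qed
    qed
  qed
  then obtain E where E: "length E \<le> d * length (filter edge L)" "\<And>\<phi>::int \<Rightarrow> int. (\<forall>(a, b)\<in>set E. \<phi> a = \<phi> b) \<Longrightarrow>
      (\<forall>r\<in>set L. \<forall>z. edge r \<longrightarrow> \<phi> (f0 (act r z)) = \<phi> (f0 z))" by auto
  obtain \<phi> :: "int \<Rightarrow> int" where "\<forall>(a, b)\<in>set E. \<phi> a = \<phi> b" "card (f0 ` X) \<le> card (\<phi> ` f0 ` X) + length E"
    using merge_labels[OF assms(2), of E] by blast
  then show ?thesis using E by (intro exI[of _ \<phi>]) (auto simp: image_comp)
qed

text \<open>The values play the role of the connected components of the graph whose edges are those
  of \<open>L\<close>. Loops preserve the label because they keep every point at its vertex.\<close>

lemma invariant_label: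
  assumes "set L \<subseteq> R"
  obtains f :: "int \<Rightarrow> int" where "dihedral_invariant f" "\<And>r z. r \<in> set L \<Longrightarrow> f (act r z) = f z"
    "n \<le> card (f ` X) + length (filter edge L)"
proof -
  have "\<exists>E. length E \<le> 1 \<and> (\<forall>\<phi>::int \<Rightarrow> int. (\<forall>(a, b)\<in>set E. \<phi> a = \<phi> b) \<longrightarrow>
      (\<forall>k. \<phi> (vertex (x + k * N)) = \<phi> (vertex (y + k * N)) \<and> \<phi> (vertex (k * N - x)) = \<phi> (vertex (k * N - y))))" for x y
  proof -
    have "vertex (x + k * N) = vertex x" "vertex (k * N - x) = vertex x" for x k
      using vertex_invariant simI1 simI2 unfolding dihedral_invariant_def by blast+
    then show ?thesis by (intro exI[of _ "[(vertex x, vertex y)]"]) simp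
  qed
  from edges_merge[of 1 vertex, OF this card_vertex(1) assms]
  obtain \<phi> :: "int \<Rightarrow> int" where \<phi>: "\<And>r z. r \<in> set L \<Longrightarrow> edge r \<Longrightarrow> \<phi> (vertex (act r z)) = \<phi> (vertex z)"
    "card (vertex ` X) \<le> card ((\<phi> \<circ> vertex) ` X) + 1 * length (filter edge L)" by blast
  have inv: "dihedral_invariant (\<phi> \<circ> vertex)" using vertex_invariant by (auto simp: dihedral_invariant_def)
  show ?thesis
  proof (rule that[of "\<phi> \<circ> vertex", OF inv])
    show "(\<phi> \<circ> vertex) (act r z) = (\<phi> \<circ> vertex) z" if "r \<in> set L" for r z
      using \<phi>(1)[OF that] loop_sim[of r z] that assms inv by (cases "edge r") (auto simp: dihedral_invariant_def)
    show "n \<le> card ((\<phi> \<circ> vertex) ` X) + length (filter edge L)" using \<phi>(2) card_vertex(2) by simp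
  qed
qed

text \<open>A finer count that remembers signs and translations modulo \<open>K * N\<close>. An edge
  costs \<open>K\<close> identifications for the translates of its pair and \<open>K\<close> more
  for their negatives. Loops are left out and may change the label.\<close>

lemma periodic_label:
  fixes K :: nat
  assumes "set L \<subseteq> R" "K > 0"
  obtains f :: "int \<Rightarrow> int" where "\<And>x k. f (x + k * (int K * N)) = f x" "\<And>r z. r \<in> set L \<Longrightarrow> edge r \<Longrightarrow> f (act r z) = f z"
    "2 * n * K \<le> card (f ` X) + 2 * K * length (filter edge L)"
proof -
  let ?f = "\<lambda>x. x mod (int K * N)"
  have red: "?f (x + k * N) = ?f (x + (k mod int K) * N)" for x k
  proof -
    have "k * N = (k mod int K) * N + (k div int K) * (int K * N)"
      by (metis (no_types, lifting) add.commute distrib_right div_mult_mod_eq mult.assoc)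
    then have "x + k * N = (x + (k mod int K) * N) + (k div int K) * (int K * N)" by simp
    then show ?thesis by (metis mod_mult_self1)
  qed
  have "\<exists>E. length E \<le> 2 * K \<and> (\<forall>\<phi>::int \<Rightarrow> int. (\<forall>(a, b)\<in>set E. \<phi> a = \<phi> b) \<longrightarrow>
      (\<forall>k. \<phi> (?f (x + k * N)) = \<phi> (?f (y + k * N)) \<and> \<phi> (?f (k * N - x)) = \<phi> (?f (k * N - y))))" for x y
  proof (intro exI conjI allI impI)
    let ?E = "map (\<lambda>j. (?f (x + int j * N), ?f (y + int j * N))) [0..<K] @ map (\<lambda>j. (?f (- x + int j * N), ?f (- y + int j * N))) [0..<K]"
    show "length ?E \<le> 2 * K" by simp
    fix \<phi> :: "int \<Rightarrow> int" and k :: int assume *: "\<forall>(a, b)\<in>set ?E. \<phi> a = \<phi> b"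
    obtain j where j: "j \<in> set [0..<K]" "k mod int K = int j"
      using assms(2) by (intro that[of "nat (k mod int K)"]) (auto simp: nat_less_iff)
    have "(?f (x + int j * N), ?f (y + int j * N)) \<in> set ?E" "(?f (- x + int j * N), ?f (- y + int j * N)) \<in> set ?E"
      using j(1) by auto
    then have "\<phi> (?f (x + int j * N)) = \<phi> (?f (y + int j * N))" "\<phi> (?f (- x + int j * N)) = \<phi> (?f (- y + int j * N))"
      using * by blast+
    then show "\<phi> (?f (x + k * N)) = \<phi> (?f (y + k * N))" "\<phi> (?f (k * N - x)) = \<phi> (?f (k * N - y))"
      using red[of x k] red[of y k] red[of "- x" k] red[of "- y" k] j(2) by simp_all
  qed
  from edges_merge[of "2 * K" ?f, OF this card_residues(1)[OF assms(2)] assms(1)]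
  obtain \<phi> :: "int \<Rightarrow> int" where \<phi>: "\<And>r z. r \<in> set L \<Longrightarrow> edge r \<Longrightarrow> \<phi> (?f (act r z)) = \<phi> (?f z)"
    "card (?f ` X) \<le> card ((\<phi> \<circ> ?f) ` X) + 2 * K * length (filter edge L)" by blast
  show ?thesis
    by (rule that[of "\<phi> \<circ> ?f"]) (use \<phi> card_residues(2)[OF assms(2)] in auto)
qed

lemma act_list_prod_label:
  assumes "set L \<subseteq> R" "\<And>r z. r \<in> set L \<Longrightarrow> f (act r z) = f z"
  shows "f (act (list_prod W L) z) = f z"
  using assms
proof (induction L arbitrary: z)
  case (Cons r L)
  then show ?case by (simp add: W.list_prod_simps act_mult R_carrier)
qed (simp add: W.list_prod_simps act_one)

lemma parity_list_prod:
  assumes "even_cut J" "set L \<subseteq> R"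
  shows "parity J (list_prod W L) = odd (length (filter (parity J) L))"
  using assms(2)
  by (induction L) (auto simp: W.list_prod_simps parity_one parity_mult assms(1) R_carrier)

end

section \<open>Transitivity below a Coxeter element\<close>

context affine_C
begin

section \<open>Edges and loops in decompositions of a Coxeter element\<close>

abbreviation "hurwitz \<equiv> W.hurwitz_equiv"
abbreviation "prd \<equiv> list_prod W"
abbreviation "edges L \<equiv> length (filter edge L)"
abbreviation "loopsA L \<equiv> length (filter loopA L)"
abbreviation "loopsB L \<equiv> length (filter loopB L)"

text \<open>The condition on labels \<open>f\<close> says that \<open>c\<close> has at most two orbits outside the multiples of \<open>N\<close>, those of \<open>x0\<close>
  and \<open>- x0\<close>; unlike an explicit formula for \<open>c\<close>, it is invariant under conjugation.\<close>

definition coxeter_like :: "nat word set \<Rightarrow> bool" where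
  "coxeter_like c \<longleftrightarrow> c \<in> carrier W \<and> loopA c \<and> loopB c \<and>
    (\<exists>x0. \<forall>f::int \<Rightarrow> int. (\<forall>z. f (act c z) = f z) \<longrightarrow> (\<forall>x\<in>X. f x = f x0 \<or> f x = f (- x0)))"

text \<open>A contiguous stretch of a decomposition of \<open>c\<close> into n + 1 reflections.
  Being a condition on lists, it passes to prefixes and suffixes and along Hurwitz moves, as the
  inductions require.\<close>

definition admissible :: "nat word set \<Rightarrow> nat word set list \<Rightarrow> bool" where
  "admissible c L \<longleftrightarrow> (\<exists>vs us. set (vs @ L @ us) \<subseteq> R \<and> length (vs @ L @ us) = Suc n \<and> prd (vs @ L @ us) = c)"

lemma prd_append: "set L \<subseteq> R \<Longrightarrow> set L' \<subseteq> R \<Longrightarrow> prd (L @ L') = prd L \<otimes>\<^bsub>W\<^esub> prd L'"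
  by (intro W.list_prod_append R_list_carrier)

lemma prd_Cons: "prd (r # L) = r \<otimes>\<^bsub>W\<^esub> prd L"
  by (simp add: W.list_prod_simps)

lemma prd_snoc: "set L \<subseteq> R \<Longrightarrow> r \<in> R \<Longrightarrow> prd (L @ [r]) = prd L \<otimes>\<^bsub>W\<^esub> r"
  by (simp add: prd_append W.list_prod_simps R_carrier)

lemma act_prd_Cons: "r \<in> R \<Longrightarrow> set L \<subseteq> R \<Longrightarrow> act (prd (r # L)) x = act r (act (prd L) x)"
  by (simp add: prd_Cons act_mult R_carrier)

lemma length_types: "set L \<subseteq> R \<Longrightarrow> length L = edges L + loopsA L + loopsB L"
proof (induction L)
  case (Cons r L)
  then show ?case using not_loopA_and_loopB[of r] by auto
qed simp

text \<open>A label preserved by all factors is preserved by \<open>c\<close>. If it is also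
  constant on dihedral orbits, it cannot tell \<open>x0\<close> from \<open>- x0\<close>, so it has
  a single value: the graph is connected. The loop counts are odd by the parity characters.\<close>

lemma coxeter_like_counts:
  assumes "coxeter_like c" "set L \<subseteq> R" "prd L = c"
  shows "n \<le> Suc (edges L)" "odd (loopsA L)" "odd (loopsB L)"
proof -
  show "odd (loopsA L)" "odd (loopsB L)"
    using assms(1) parity_list_prod[OF even_cuts(1) assms(2)] parity_list_prod[OF even_cuts(2) assms(2)] assms(3)
    by (simp_all add: coxeter_like_def)
  obtain f :: "int \<Rightarrow> int" where f: "dihedral_invariant f" "\<And>r z. r \<in> set L \<Longrightarrow> f (act r z) = f z"
    "n \<le> card (f ` X) + edges L" by (rule invariant_label[OF assms(2)]) (rule that)
  have "f (act c z) = f z" for z using act_list_prod_label[OF assms(2) f(2)] assms(3) by simp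
  then obtain x0 where x0: "\<And>x. x \<in> X \<Longrightarrow> f x = f x0 \<or> f x = f (- x0)"
    using assms(1) unfolding coxeter_like_def by metis
  have "f (- x0) = f x0" using f(1) simI2[of 0 x0] by (simp add: dihedral_invariant_def)
  then have "f ` X \<subseteq> {f x0}" using x0 by auto
  then have "card (f ` X) \<le> card {f x0}" by (intro card_mono) auto
  then show "n \<le> Suc (edges L)" using f(3) by simp
qed

text \<open>At least n - 1 edges and one loop of each class add up to n + 1, and equality of the sum
  forces equality in each count.\<close>

lemma coxeter_like_length:
  assumes "coxeter_like c" "set L \<subseteq> R" "prd L = c"
  shows "Suc n \<le> length L"
    and "length L = Suc n \<Longrightarrow> Suc (edges L) = n \<and> loopsA L = 1 \<and> loopsB L = 1"
proof -
  have pos: "1 \<le> k" if "odd k" for k :: nat using that by presburger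
  note * = coxeter_like_counts(1)[OF assms] pos[OF coxeter_like_counts(2)[OF assms]]
    pos[OF coxeter_like_counts(3)[OF assms]] length_types[OF assms(2)]
  show "Suc n \<le> length L" using * by linarith
  show "Suc (edges L) = n \<and> loopsA L = 1 \<and> loopsB L = 1" if "length L = Suc n"
    using * that by linarith
qed

lemma admissible_R: "admissible c L \<Longrightarrow> set L \<subseteq> R"
  by (auto simp: admissible_def)

lemma admissible_append:
  assumes "admissible c (L @ L')" shows "admissible c L" "admissible c L'"
proof -
  obtain vs us where *: "set (vs @ (L @ L') @ us) \<subseteq> R" "length (vs @ (L @ L') @ us) = Suc n" "prd (vs @ (L @ L') @ us) = c"
    using assms by (auto simp: admissible_def)
  show "admissible c L" unfolding admissible_def using * by (intro exI[of _ vs] exI[of _ "L' @ us"]) simp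
  show "admissible c L'" unfolding admissible_def using * by (intro exI[of _ "vs @ L"] exI[of _ us]) simp
qed

lemma admissible_Cons: "admissible c (r # L) \<Longrightarrow> r \<in> R \<and> admissible c L"
  using admissible_append(2)[of c "[r]" L] admissible_R[of c "r # L"] by simp

lemma hurwitz_R:
  assumes "hurwitz L L'" "set L \<subseteq> R"
  shows "set L' \<subseteq> R" "length L' = length L" "prd L' = prd L"
proof -
  have "set L' \<subseteq> R \<and> length L' = length L \<and> prd L' = prd L
    \<and> (\<exists>u\<in>words {i. Suc i < length L}. hurwitz_word W u L = L')"
    by (rule W.hurwitz_equiv_invariant[OF assms(1) reflections_carrier _ assms(2)])
      (intro conjI R_conj R_conj' R_carrier)
  then show "set L' \<subseteq> R" "length L' = length L" "prd L' = prd L" by simp_all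
qed

lemma admissible_hurwitz:
  assumes "admissible c L" "hurwitz L L'" shows "admissible c L'"
proof -
  obtain vs us where *: "set (vs @ L @ us) \<subseteq> R" "length (vs @ L @ us) = Suc n" "prd (vs @ L @ us) = c"
    using assms(1) by (auto simp: admissible_def)
  have "hurwitz (vs @ L @ us) (vs @ L' @ us)"
    by (rule W.hurwitz_equiv_context[OF assms(2)]) (use * R_carrier in auto)
  from hurwitz_R[OF this *(1)] * show ?thesis unfolding admissible_def by (intro exI[of _ vs] exI[of _ us]) simp
qed

lemma admissible_loops:
  assumes "coxeter_like c" "admissible c L" shows "loopsA L \<le> 1" "loopsB L \<le> 1"
proof -
  obtain vs us where *: "set (vs @ L @ us) \<subseteq> R" "length (vs @ L @ us) = Suc n" "prd (vs @ L @ us) = c"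
    using assms(2) by (auto simp: admissible_def)
  from coxeter_like_length(2)[OF assms(1) *(1,3,2)] show "loopsA L \<le> 1" "loopsB L \<le> 1" by auto
qed

text \<open>Each edge of a shortest decomposition of \<open>c\<close> is a bridge of the graph of all its edges.\<close>

lemma edge_separates:
  assumes c: "coxeter_like c" and adm: "admissible c (t # L)" and t: "edge t"
  obtains f :: "int \<Rightarrow> int" where "dihedral_invariant f" "\<And>z. f (act (prd L) z) = f z"
    "\<And>z. act t z \<noteq> z \<Longrightarrow> f (act t z) \<noteq> f z"
proof -
  obtain vs us where *: "set (vs @ (t # L) @ us) \<subseteq> R" "length (vs @ (t # L) @ us) = Suc n" "prd (vs @ (t # L) @ us) = c"
    using adm by (auto simp: admissible_def)
  have sub: "set (vs @ L @ us) \<subseteq> R" and tR: "t \<in> R" using *(1) by auto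
  \<comment> \<open>Without \<open>t\<close> only n - 2 edges are left, so at least two labels
    survive. If \<open>t\<close> joined equal labels, \<open>c\<close> would preserve
    \<open>f\<close> and leave just one.\<close>
  from coxeter_like_length(2)[OF c *(1,3,2)] have "Suc (Suc (edges (vs @ L @ us))) = n" using t by simp
  moreover obtain f :: "int \<Rightarrow> int" where f: "dihedral_invariant f" "\<And>r z. r \<in> set (vs @ L @ us) \<Longrightarrow> f (act r z) = f z"
    "n \<le> card (f ` X) + edges (vs @ L @ us)" by (rule invariant_label[OF sub]) (rule that)
  ultimately have card: "card (f ` X) \<ge> 2" by linarith
  show ?thesis
  proof (rule that[OF f(1)])
    show "f (act (prd L) z) = f z" for z using act_list_prod_label[of L f] f(2) sub by auto
    fix z assume z: "act t z \<noteq> z"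
    show "f (act t z) \<noteq> f z"
    proof
      assume eq: "f (act t z) = f z"
      note m = refl_moved[OF tR z]
      have v: "f (y + k * N) = f y" "f (k * N - y) = f y" for y k
        using f(1) simI1 simI2 unfolding dihedral_invariant_def by blast+
      have "f (act t y) = f y" for y
        using mirror_label[OF m(2), of f y] m(1) eq v by simp
      then have "f (act r y) = f y" if "r \<in> set (vs @ (t # L) @ us)" for r y using that f(2) by auto
      then have "f (act c y) = f y" for y using act_list_prod_label[OF *(1)] *(3) by metis
      then obtain x0 where x0: "\<And>x. x \<in> X \<Longrightarrow> f x = f x0 \<or> f x = f (- x0)"
        using c unfolding coxeter_like_def by metis
      have "f (- x0) = f x0" using v(2)[of 0 x0] by simp
      then have "f ` X \<subseteq> {f x0}" using x0 by auto
      then have "card (f ` X) \<le> card {f x0}" by (intro card_mono) auto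
      then show False using card by simp
    qed
  qed
qed

text \<open>Let \<open>z\<close> be the point reached just before the leftmost factor
  \<open>t\<close>. If \<open>t\<close> is an edge, a label that is preserved by the other factors
  and separates the ends of \<open>t\<close> agrees at \<open>x\<close>, at \<open>z\<close> and at
  the image of \<open>z\<close>, which lies at the vertex of \<open>x\<close>; so \<open>t\<close>
  fixes \<open>z\<close>. In every case \<open>z\<close> is already at the vertex of
  \<open>x\<close>, and the induction continues with the other factors.\<close>

lemma no_edge_at_fixed_vertex:
  assumes "coxeter_like c" "admissible c L" "sim (act (prd L) x) x" "r \<in> set L"
  shows "sim (act r x) x"
  using assms(2-4)
proof (induction L arbitrary: r)
  case (Cons t L)
  have t: "t \<in> R" and adm: "admissible c L" using admissible_Cons Cons.prems(1) by auto
  have L: "set L \<subseteq> R" using admissible_R adm by blast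
  define z where "z = act (prd L) x"
  have tz: "sim (act t z) x" using Cons.prems(2) act_prd_Cons[OF t L] by (simp add: z_def)
  have "sim z x \<and> sim (act t x) x"
  proof (cases "edge t")
    case False
    then show ?thesis using loop_sim[OF t] tz sim_trans sim_sym by metis
  next
    case True
    obtain f :: "int \<Rightarrow> int" where f: "dihedral_invariant f" "\<And>z. f (act (prd L) z) = f z"
      "\<And>z. act t z \<noteq> z \<Longrightarrow> f (act t z) \<noteq> f z" by (rule edge_separates[OF assms(1) Cons.prems(1) True]) (rule that)
    have "f (act t z) = f x" "f z = f x" using tz f(1,2) by (auto simp: dihedral_invariant_def z_def)
    then have e: "act t z = z" using f(3)[of z] by auto
    have "sim (act t x) (act t z)"
      using equivariant_sim[OF equivariant_act[OF R_carrier[OF t]], of x z] tz e sim_sym[of z x] by simp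
    then show ?thesis using tz e sim_trans by metis
  qed
  then show ?case using Cons.IH[OF adm] Cons.prems(3) by (auto simp: z_def)
qed simp

section \<open>Moving a prescribed factor to the end\<close>

lemma act_inv_fixed: "g \<in> carrier W \<Longrightarrow> act g y = y \<Longrightarrow> act (inv\<^bsub>W\<^esub> g) y = y"
  using act_inv(1)[of g y] by simp

lemma act_conj_apply: "g \<in> carrier W \<Longrightarrow> r \<in> carrier W \<Longrightarrow>
    act (g \<otimes>\<^bsub>W\<^esub> r \<otimes>\<^bsub>W\<^esub> inv\<^bsub>W\<^esub> g) x = act g (act r (act (inv\<^bsub>W\<^esub> g) x))"
  "g \<in> carrier W \<Longrightarrow> r \<in> carrier W \<Longrightarrow>
    act (inv\<^bsub>W\<^esub> g \<otimes>\<^bsub>W\<^esub> r \<otimes>\<^bsub>W\<^esub> g) x = act (inv\<^bsub>W\<^esub> g) (act r (act g x))"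
  by (simp_all add: act_mult)

lemma refl_fixes:
  assumes "r \<in> R" "act r z \<noteq> z" "\<not> sim y z" "\<not> sim y (act r z)" shows "act r y = y"
  using mirror_fix[OF assms(3,4)] refl_moved(1)[OF assms(1,2)] by simp

text \<open>All of \<open>L\<close> keeps \<open>x\<close> at its vertex and \<open>t\<close> leaves
  it. Let \<open>z\<close> be the point reached before the next factor \<open>s\<close>. If
  \<open>s\<close> fixes \<open>z\<close>, then \<open>t\<close> passes \<open>s\<close> unchanged.
  Otherwise \<open>s\<close> is a loop at this vertex and fixes \<open>y\<close>, so
  \<open>s\<close> passes \<open>t\<close> instead and the conjugate of \<open>t\<close> by
  \<open>s\<close> still sends \<open>z\<close> to \<open>y\<close>.\<close>

lemma move_edge_past_loops:
  assumes "t \<in> R" "set L \<subseteq> R" "act t (act (prd L) x) = y" "\<not> sim y x" "\<And>s. s \<in> set L \<Longrightarrow> sim (act s x) x"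
  shows "\<exists>us r. hurwitz (t # L) (us @ [r]) \<and> act r x = y"
  using assms
proof (induction L arbitrary: t)
  case Nil
  then show ?case by (intro exI[of _ "[]"] exI[of _ t]) (simp add: W.list_prod_simps act_one)
next
  case (Cons s L)
  have s: "s \<in> R" and L: "set L \<subseteq> R" using Cons.prems by auto
  have tc: "t \<in> carrier W" and sc: "s \<in> carrier W" using Cons.prems(1) s R_carrier by auto
  have Lc: "set L \<subseteq> carrier W" using L R_carrier by auto
  define z where "z = act (prd L) x"
  have stable: "sim (act q u) x" if "q \<in> set (s # L)" "sim u x" for q u
  proof -
    have "q \<in> carrier W" using that(1) Cons.prems(2) R_carrier by auto
    then show ?thesis using equivariant_sim[OF equivariant_act that(2)] Cons.prems(5)[OF that(1)] sim_trans by blast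
  qed
  have "sim (act (prd L') x) x" if "set L' \<subseteq> set L" for L'
    using that
  proof (induction L')
    case (Cons q L')
    then have "set L' \<subseteq> R" "q \<in> R" "q \<in> set (s # L)" "sim (act (prd L') x) x" using L by auto
    then show ?case using stable[of q "act (prd L') x"] act_prd_Cons[of q L'] by simp
  qed (simp add: W.list_prod_simps act_one)
  then have zx: "sim z x" by (simp add: z_def)
  have tsz: "act t (act s z) = y" using Cons.prems(3) act_prd_Cons[OF s L] by (simp add: z_def)
  have cont: ?case if h: "hurwitz (t # s # L) (p # q # L)" "p \<in> R" "q \<in> R" "act q z = y" for p q
  proof -
    obtain us r where u: "hurwitz (q # L) (us @ [r])" "act r x = y"
      using Cons.IH[OF h(3) L] h(4) Cons.prems(4,5) by (auto simp: z_def)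
    have "hurwitz (p # q # L) (p # us @ [r])"
      using W.hurwitz_equiv_context[OF u(1), of "[p]" "[]"] h(2) R_carrier by simp
    from equivclp_trans[OF h(1) this] have "hurwitz (t # s # L) ((p # us) @ [r])" by simp
    then show ?thesis using u(2) by (intro exI conjI)
  qed
  show ?case
  proof (cases "act s z = z")
    case True
    show ?thesis
    proof (rule cont)
      show "hurwitz (t # s # L) ((t \<otimes>\<^bsub>W\<^esub> s \<otimes>\<^bsub>W\<^esub> inv\<^bsub>W\<^esub> t) # t # L)"
        using W.hurwitz_stepI[of "[]" t s L] tc sc Lc by simp
    qed (use R_conj[OF tc s] Cons.prems(1) tsz True in auto)
  next
    case False
    have "sim (act s z) x" using stable[of s z] zx by simp
    then have "\<not> sim y z" "\<not> sim y (act s z)" using Cons.prems(4) zx sim_trans by blast+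
    then have "act s y = y" using refl_fixes[OF s False] by simp
    then have "act (inv\<^bsub>W\<^esub> s \<otimes>\<^bsub>W\<^esub> t \<otimes>\<^bsub>W\<^esub> s) z = y"
      using act_conj_apply(2)[OF sc tc] tsz act_inv_fixed[OF sc] by simp
    moreover have "hurwitz (t # s # L) (s # (inv\<^bsub>W\<^esub> s \<otimes>\<^bsub>W\<^esub> t \<otimes>\<^bsub>W\<^esub> s) # L)"
      using W.hurwitz_stepI'[of "[]" t s L] tc sc Lc by simp
    ultimately show ?thesis using cont s R_conj'[OF sc Cons.prems(1)] by blast
  qed
qed

text \<open>The leftmost factor \<open>t\<close> acts last. If the other factors bring
  \<open>x\<close> back to its vertex, it is \<open>t\<close> that leaves it. Otherwise a last
  factor \<open>r\<close> with \<open>act r x = z\<close> exists by induction. If \<open>t\<close>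
  moves \<open>z\<close>, then \<open>x\<close> lies at neither vertex that \<open>t\<close>
  touches; so \<open>t\<close> fixes \<open>x\<close>, and conjugating \<open>r\<close> by
  \<open>t\<close> gives a reflection that sends \<open>x\<close> to the image of
  \<open>z\<close>.\<close>

lemma move_to_end:
  assumes "coxeter_like c" "admissible c L" "\<not> sim (act (prd L) x) x"
  shows "\<exists>us r. hurwitz L (us @ [r]) \<and> act r x = act (prd L) x"
  using assms(2,3)
proof (induction L)
  case Nil
  then show ?case by (simp add: W.list_prod_simps act_one)
next
  case (Cons t L)
  have t: "t \<in> R" and adm: "admissible c L" using admissible_Cons Cons.prems(1) by auto
  have L: "set L \<subseteq> R" using admissible_R adm by blast
  have tc: "t \<in> carrier W" using t R_carrier by blast
  define z where "z = act (prd L) x"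
  define y where "y = act t z"
  have w: "act (prd (t # L)) x = y" using act_prd_Cons[OF t L] by (simp add: z_def y_def)
  then have yx: "\<not> sim y x" using Cons.prems(2) by simp
  show ?case
  proof (cases "sim z x")
    case True
    have "sim (act s x) x" if "s \<in> set L" for s
      using no_edge_at_fixed_vertex[OF assms(1) adm _ that] True by (simp add: z_def)
    then show ?thesis
      using move_edge_past_loops[OF t L, of x y] yx w by (simp add: z_def y_def)
  next
    case F: False
    then obtain us r where u: "hurwitz L (us @ [r])" "act r x = z"
      using Cons.IH[OF adm] by (auto simp: z_def)
    have uR: "set us \<subseteq> R" "r \<in> R" using hurwitz_R(1)[OF u(1) L] by auto
    then have uc: "set us \<subseteq> carrier W" "r \<in> carrier W" using R_carrier by auto
    have h1: "hurwitz (t # L) (t # us @ [r])"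
      using W.hurwitz_equiv_context[OF u(1), of "[t]" "[]"] tc by simp
    show ?thesis
    proof (cases "y = z")
      case True
      then have "hurwitz (t # L) ((t # us) @ [r])" "act r x = act (prd (t # L)) x" using h1 u(2) w by simp_all
      then show ?thesis by (intro exI conjI)
    next
      case False
      then have tz: "act t z \<noteq> z" by (simp add: y_def)
      have xz: "\<not> sim x z" "\<not> sim x (act t z)" using F yx sim_sym by (auto simp: y_def)
      have tx: "act t x = x" by (rule refl_fixes[OF t tz xz])
      define q where "q = t \<otimes>\<^bsub>W\<^esub> r \<otimes>\<^bsub>W\<^esub> inv\<^bsub>W\<^esub> t"
      have qc: "q \<in> carrier W" using tc uc by (simp add: q_def)
      have qx: "act q x = y"
        using act_conj_apply(1)[OF tc uc(2)] act_inv_fixed[OF tc tx] u(2) by (simp add: q_def y_def)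
      \<comment> \<open>Passing to the right end, \<open>t\<close> turns \<open>r\<close> into
        \<open>q\<close>; one more move brings \<open>q\<close> back to the last place.\<close>
      let ?us = "map (\<lambda>u. t \<otimes>\<^bsub>W\<^esub> u \<otimes>\<^bsub>W\<^esub> inv\<^bsub>W\<^esub> t) us"
      have usc: "set ?us \<subseteq> carrier W" using tc uc by auto
      have "hurwitz (t # us @ [r]) (?us @ q # t # [])"
        using W.hurwitz_equiv_move_right[OF tc, of "us @ [r]"] uc by (simp add: q_def)
      moreover have "hurwitz (?us @ q # t # []) (?us @ (q \<otimes>\<^bsub>W\<^esub> t \<otimes>\<^bsub>W\<^esub> inv\<^bsub>W\<^esub> q) # q # [])"
        by (rule W.hurwitz_stepI) (use usc qc tc in auto)
      ultimately have "hurwitz (t # L) ((?us @ [q \<otimes>\<^bsub>W\<^esub> t \<otimes>\<^bsub>W\<^esub> inv\<^bsub>W\<^esub> q]) @ [q])"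
        using equivclp_trans[OF equivclp_trans[OF h1]] by (simp only: append_assoc append_Cons append_Nil)
      moreover have "act q x = act (prd (t # L)) x" using qx w by simp
      ultimately show ?thesis by (intro exI conjI)
    qed
  qed
qed

section \<open>Pairs of loops\<close>

lemma act_shift: "g \<in> carrier W \<Longrightarrow> act g (z + k * N) = act g z + k * N"
  "g \<in> carrier W \<Longrightarrow> act g (k * N - z) = k * N - act g z"
  "g \<in> carrier W \<Longrightarrow> act g (- z) = - act g z"
  using equivariant_add equivariant_diff equivariant_neg equivariant_act by blast+

text \<open>Two loops at the same vertex compose to a translation, whose length is determined by counting
  labels modulo that length: a shift by \<open>q\<close> leaves room for at least \<open>2\<bar>q\<bar>\<close> labels, while \<open>c\<close> allows only two.\<close>

lemma loops_translation:
  assumes c: "coxeter_like c" and adm: "admissible c [a, b]" and ab: "loopA a" "loopB b"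
    and x: "\<not> N dvd x" "act a x = - x" "act b x = q * N - x" and q: "odd q"
  shows "q = 1 \<or> q = - 1"
proof -
  obtain vs us where *: "set (vs @ [a, b] @ us) \<subseteq> R" "length (vs @ [a, b] @ us) = Suc n" "prd (vs @ [a, b] @ us) = c"
    using adm by (auto simp: admissible_def)
  have sub: "set vs \<subseteq> R" "set us \<subseteq> R" "a \<in> R" "b \<in> R" using *(1) by auto
  note abc = R_carrier[OF sub(3)] R_carrier[OF sub(4)]
  let ?F = "vs @ [a, b] @ us"
  define K where "K = nat \<bar>q\<bar>"
  have "q \<noteq> 0" using q by auto
  then have K: "K > 0" by (simp add: K_def)
  have cnt: "Suc (edges ?F) = n" "loopsA ?F = 1" "loopsB ?F = 1"
    using coxeter_like_length(2)[OF c *(1,3,2)] by auto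
  have nb: "\<not> loopB a" "\<not> loopA b" using not_loopA_and_loopB sub ab by auto
  \<comment> \<open>\<open>a\<close> and \<open>b\<close> use up the single loop of each
    class.\<close>
  have e: "edge r" if "r \<in> set vs \<union> set us" for r
  proof -
    have "loopsA vs = 0" "loopsA us = 0" "loopsB vs = 0" "loopsB us = 0" using cnt(2,3) ab nb by auto
    then show ?thesis using that by (auto simp: filter_empty_conv)
  qed
  obtain f :: "int \<Rightarrow> int" where f: "\<And>x k. f (x + k * (int K * N)) = f x"
    "\<And>r z. r \<in> set ?F \<Longrightarrow> edge r \<Longrightarrow> f (act r z) = f z"
    "2 * n * K \<le> card (f ` X) + 2 * K * edges ?F" by (rule periodic_label[OF *(1) K]) (rule that)
  have fq: "f (z + q * N) = f z" "f (z - q * N) = f z" for z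
  proof -
    have "sgn q * int K = q" by (simp add: K_def sgn_mult_abs)
    then have e: "sgn q * (int K * N) = q * N" by (metis mult.assoc)
    show "f (z + q * N) = f z" using f(1)[of z "sgn q"] unfolding e .
    show "f (z - q * N) = f z" using f(1)[of "z - q * N" "sgn q"] unfolding e diff_add_cancel by (rule sym)
  qed
  have wx: "act a (act b x) = x + q * N"
    using act_shift(2)[OF abc(1), of q x] x by simp
  have xx: "x \<noteq> - x" "x \<noteq> q * N - x"
  proof -
    show "x \<noteq> - x" using x(1) by auto
    show "x \<noteq> q * N - x"
    proof
      assume "x = q * N - x"
      then have "2 * x = q * N" by simp
      then have "N dvd 2 * x" by simp
      then show False using N_dvd_2 x(1) by blast
    qed
  qed
  \<comment> \<open>Neither loop alone has to preserve \<open>f\<close>. Their product moves the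
    points x + k N by q N and the points k N - x by - q N, which are periods of \<open>f\<close>,
    and fixes all other points.\<close>
  have w: "f (act a (act b z)) = f z" for z
  proof (cases "sim z x")
    case True
    then show ?thesis
    proof (cases rule: simE)
      case (1 k)
      have "act a (act b z) = z + q * N" using wx act_shift(1)[OF abc(1)] act_shift(1)[OF abc(2)] 1 by simp
      then show ?thesis using fq by simp
    next
      case (2 k)
      have "act a (act b z) = z - q * N" using wx act_shift(2)[OF abc(1)] act_shift(2)[OF abc(2)] 2 by simp
      then show ?thesis using fq by simp
    qed
  next
    case False
    have "\<not> sim z (act a x)" "\<not> sim z (act b x)"
      using False loop_sim[OF sub(3)] loop_sim[OF sub(4)] ab sim_trans by blast+
    then have "act a z = z" "act b z = z"
      using refl_fixes[OF sub(3) _ False] refl_fixes[OF sub(4) _ False] xx x by auto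
    then show ?thesis by simp
  qed
  have "f (act c z) = f z" for z
  proof -
    have "c = prd vs \<otimes>\<^bsub>W\<^esub> ((a \<otimes>\<^bsub>W\<^esub> b) \<otimes>\<^bsub>W\<^esub> prd us)"
      using *(3) sub abc by (simp add: prd_append prd_Cons W.m_assoc)
    then have "act c z = act (prd vs) (act a (act b (act (prd us) z)))"
      using sub abc by (simp add: act_mult)
    moreover have "f (act (prd vs) y) = f y" "f (act (prd us) y) = f y" for y
      using act_list_prod_label[of vs f y] act_list_prod_label[of us f y] sub f(2) e by auto
    ultimately show ?thesis using w by simp
  qed
  then obtain x0 where x0: "\<And>x. x \<in> X \<Longrightarrow> f x = f x0 \<or> f x = f (- x0)"
    using c unfolding coxeter_like_def by metis
  have "f ` X \<subseteq> {f x0, f (- x0)}" using x0 by auto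
  then have "card (f ` X) \<le> card {f x0, f (- x0)}" by (intro card_mono) auto
  also have "\<dots> \<le> 2" by (simp add: card_insert_if)
  finally have "2 * n * K \<le> 2 + 2 * K * edges ?F" using f(3) by linarith
  moreover have e: "2 * Suc e * K = 2 * K + 2 * K * e" for e by (simp add: algebra_simps)
  have "2 * n * K = 2 * K + 2 * K * edges ?F" using e[of "edges ?F"] unfolding cnt(1) .
  ultimately have "K \<le> 1" by linarith
  then show ?thesis using \<open>q \<noteq> 0\<close> unfolding K_def by linarith
qed

lemma conj_pair_hurwitz:
  assumes "a \<in> R" "b \<in> R" "w = a \<otimes>\<^bsub>W\<^esub> b"
  shows "hurwitz [a, b] [w \<otimes>\<^bsub>W\<^esub> a \<otimes>\<^bsub>W\<^esub> inv\<^bsub>W\<^esub> w, w \<otimes>\<^bsub>W\<^esub> b \<otimes>\<^bsub>W\<^esub> inv\<^bsub>W\<^esub> w]"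
    "hurwitz [a, b] [inv\<^bsub>W\<^esub> w \<otimes>\<^bsub>W\<^esub> a \<otimes>\<^bsub>W\<^esub> w, inv\<^bsub>W\<^esub> w \<otimes>\<^bsub>W\<^esub> b \<otimes>\<^bsub>W\<^esub> w]"
proof -
  have c: "a \<in> carrier W" "b \<in> carrier W" "w \<in> carrier W" using assms R_carrier by auto
  show "hurwitz [a, b] [w \<otimes>\<^bsub>W\<^esub> a \<otimes>\<^bsub>W\<^esub> inv\<^bsub>W\<^esub> w, w \<otimes>\<^bsub>W\<^esub> b \<otimes>\<^bsub>W\<^esub> inv\<^bsub>W\<^esub> w]"
    unfolding assms(3) by (rule W.hurwitz_equiv_conj_pair) (use c in auto)
  let ?a = "inv\<^bsub>W\<^esub> w \<otimes>\<^bsub>W\<^esub> a \<otimes>\<^bsub>W\<^esub> w" and ?b = "inv\<^bsub>W\<^esub> w \<otimes>\<^bsub>W\<^esub> b \<otimes>\<^bsub>W\<^esub> w"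
  have "?a \<otimes>\<^bsub>W\<^esub> ?b = inv\<^bsub>W\<^esub> w \<otimes>\<^bsub>W\<^esub> (a \<otimes>\<^bsub>W\<^esub> b) \<otimes>\<^bsub>W\<^esub> w"
    using c by (simp add: W.m_assoc W.inv_cancel_left)
  then have p: "?a \<otimes>\<^bsub>W\<^esub> ?b = w" using c assms(3) by simp
  have "hurwitz [?a, ?b] [w \<otimes>\<^bsub>W\<^esub> ?a \<otimes>\<^bsub>W\<^esub> inv\<^bsub>W\<^esub> w, w \<otimes>\<^bsub>W\<^esub> ?b \<otimes>\<^bsub>W\<^esub> inv\<^bsub>W\<^esub> w]"
    using W.hurwitz_equiv_conj_pair[of ?a ?b] c unfolding p by simp
  also have "[w \<otimes>\<^bsub>W\<^esub> ?a \<otimes>\<^bsub>W\<^esub> inv\<^bsub>W\<^esub> w, w \<otimes>\<^bsub>W\<^esub> ?b \<otimes>\<^bsub>W\<^esub> inv\<^bsub>W\<^esub> w] = [a, b]"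
    using c by (simp add: W.m_assoc W.inv_cancel_left)
  finally show "hurwitz [a, b] [?a, ?b]" by (rule equivclp_sym)
qed

text \<open>Conjugation by the product of the pair, in either direction, shifts the centre p N of
  the first loop by \<plusminus> q N. With \<open>q\<close> equal to 1 or - 1 this reaches every
  \<open>p\<close>.\<close>

lemma translation_orbit:
  assumes ab: "a \<in> R" "b \<in> R" "act a x = - x" "act a (act b x) = x + q * N" and q: "q = 1 \<or> q = - 1"
  shows "\<exists>a' b'. a' \<in> R \<and> b' \<in> R \<and> hurwitz [a, b] [a', b'] \<and> act a' x = 2 * p * N - x"
proof -
  define w where "w = a \<otimes>\<^bsub>W\<^esub> b"
  have wc: "w \<in> carrier W" using ab R_carrier by (simp add: w_def)
  have wx: "act w x = x + q * N" using ab R_carrier by (simp add: w_def act_mult)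
  have wi: "act (inv\<^bsub>W\<^esub> w) x = x - q * N"
    using act_inv(1)[OF wc, of "x + (- q) * N"] act_shift(1)[OF wc, of x "- q"] wx by simp
  have step: "\<exists>a' b'. a' \<in> R \<and> b' \<in> R \<and> hurwitz [a, b] [a', b'] \<and> act a' x = 2 * (p + s) * N - x"
    if h: "\<exists>a' b'. a' \<in> R \<and> b' \<in> R \<and> hurwitz [a, b] [a', b'] \<and> act a' x = 2 * p * N - x" and s: "s = q \<or> s = - q" for p s
  proof -
    obtain a' b' where r: "a' \<in> R" "b' \<in> R" "hurwitz [a, b] [a', b']" "act a' x = 2 * p * N - x"
      using h by blast
    have c: "a' \<in> carrier W" "b' \<in> carrier W" using r R_carrier by auto
    have w: "w = a' \<otimes>\<^bsub>W\<^esub> b'"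
      using hurwitz_R(3)[OF r(3)] ab c R_carrier by (simp add: W.list_prod_simps w_def)
    show ?thesis
    proof (cases "s = - q")
      case True
      let ?a = "w \<otimes>\<^bsub>W\<^esub> a' \<otimes>\<^bsub>W\<^esub> inv\<^bsub>W\<^esub> w" and ?b = "w \<otimes>\<^bsub>W\<^esub> b' \<otimes>\<^bsub>W\<^esub> inv\<^bsub>W\<^esub> w"
      have "act ?a x = act w (act a' (x + (- q) * N))" using act_conj_apply(1)[OF wc c(1)] wi by simp
      also have "act a' (x + (- q) * N) = (2 * p - q) * N - x"
        using act_shift(1)[OF c(1), of x "- q"] r(4) by (simp add: algebra_simps)
      also have "act w \<dots> = 2 * (p + s) * N - x"
        unfolding act_shift(2)[OF wc] wx using True by (simp add: algebra_simps)
      finally show ?thesis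
        using equivclp_trans[OF r(3) conj_pair_hurwitz(1)[OF r(1,2) w]] R_conj[OF wc r(1)] R_conj[OF wc r(2)] by blast
    next
      case False
      let ?a = "inv\<^bsub>W\<^esub> w \<otimes>\<^bsub>W\<^esub> a' \<otimes>\<^bsub>W\<^esub> w" and ?b = "inv\<^bsub>W\<^esub> w \<otimes>\<^bsub>W\<^esub> b' \<otimes>\<^bsub>W\<^esub> w"
      have "act ?a x = act (inv\<^bsub>W\<^esub> w) (act a' (x + q * N))" using act_conj_apply(2)[OF wc c(1)] wx by simp
      also have "act a' (x + q * N) = (2 * p + q) * N - x"
        using act_shift(1)[OF c(1), of x q] r(4) by (simp add: algebra_simps)
      also have "act (inv\<^bsub>W\<^esub> w) \<dots> = 2 * (p + s) * N - x"
        unfolding act_shift(2)[OF W.inv_closed[OF wc]] wi using False s by (simp add: algebra_simps)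
      finally show ?thesis
        using equivclp_trans[OF r(3) conj_pair_hurwitz(2)[OF r(1,2) w]] R_conj'[OF wc r(1)] R_conj'[OF wc r(2)] by blast
    qed
  qed
  show ?thesis
  proof (induction p rule: int_induct[of _ 0])
    case base
    show ?case using ab by (intro exI[of _ a] exI[of _ b]) simp
  next
    case (step1 i)
    then show ?case using step[of i 1] q by auto
  next
    case (step2 i)
    then show ?case using step[of i "- 1"] q by auto
  qed
qed

text \<open>Both act as the mirror of \<open>x\<close> and its image by
  \<open>mirror_rebase\<close>, and the action is faithful.\<close>

lemma reflection_eqI:
  assumes "r \<in> R" "s \<in> R" "act r x \<noteq> x" "act s x = act r x" shows "r = s"
proof -
  have "act s x \<noteq> x" using assms(3,4) by simp
  from refl_moved(1)[OF assms(2) this] have "act s = mirror x (act r x)" unfolding assms(4) .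
  also have "\<dots> = act r" by (rule refl_moved(1)[OF assms(1,3), symmetric])
  finally show ?thesis using act_inject assms(1,2) R_carrier by metis
qed

text \<open>Take a point \<open>x\<close> at the vertex of the loop \<open>a\<close>. If
  \<open>b\<close> fixes \<open>x\<close>, then \<open>b'\<close> does too, and \<open>a'\<close>
  agrees with \<open>a\<close> at \<open>x\<close>. Otherwise both pairs translate \<open>x\<close>
  by the same q N, and Hurwitz moves turn \<open>a\<close> into any loop of its class at this
  vertex, in particular into \<open>a'\<close>. The second factor is then determined by the
  product.\<close>

lemma sorted_loop_pairs:
  assumes c: "coxeter_like c" and adm: "admissible c [a, b]" "admissible c [a', b']"
    and ab: "loopA a" "loopB b" "loopA a'" "loopB b'" and eq: "a \<otimes>\<^bsub>W\<^esub> b = a' \<otimes>\<^bsub>W\<^esub> b'"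
  shows "hurwitz [a, b] [a', b']"
proof -
  have R: "a \<in> R" "b \<in> R" "a' \<in> R" "b' \<in> R" using admissible_R[OF adm(1)] admissible_R[OF adm(2)] by auto
  note C = R[THEN R_carrier]
  have w: "act a (act b z) = act a' (act b' z)" for z
    using arg_cong[OF eq, of act] C by (simp add: act_mult fun_eq_iff)
  obtain x where x: "act a = mirror x (- x)" "mirror_pair x (- x)"
    using R(1) by (cases rule: reflE) (use ab in auto)
  have nx: "\<not> N dvd x" using x(2) by (simp add: mirror_pair_def)
  \<comment> \<open>No point x + l N has the form k N - x. This excludes all impossible cases below
    but one, in which an odd multiple of \<open>N\<close> would vanish.\<close>
  have ne: "2 * x \<noteq> k * N" for k
  proof
    assume "2 * x = k * N"
    then have "N dvd 2 * x" by simp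
    then show False using N_dvd_2 nx by blast
  qed
  have ax: "act a x = - x" using x(1) mirror_add1[of x "- x" 0] by simp
  then have axx: "act a x \<noteq> x" using ne[of 0] by auto
  have finish: ?thesis if "a = a'"
  proof -
    have "b = b'" using eq that C by simp
    then show ?thesis using that by simp
  qed
  show ?thesis
  proof (cases "act b x = x")
    case True
    have w': "act a' (act b' x) = - x" using w[of x] True ax by simp
    have "act b' x = x"
    proof (rule ccontr)
      assume "act b' x \<noteq> x"
      then obtain k where k: "act b' x = (2 * k + 1) * N - x" using loopB_moved[OF R(4) ab(4)] by blast
      show False
      proof (cases "act a' (act b' x) = act b' x")
        case True
        then have "(2 * k + 1) * N = 0" using w' k by simp
        moreover have "2 * k + 1 \<noteq> 0" by presburger
        ultimately show False using N_ge_5 by simp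
      next
        case False
        then obtain l where "act a' (act b' x) = 2 * l * N - act b' x" using loopA_moved[OF R(3) ab(3)] by blast
        then have "2 * x = ((2 * k + 1) - 2 * l) * N" using w' k by (simp add: algebra_simps)
        then show False using ne by blast
      qed
    qed
    then have "act a' x = act a x" using w' ax by simp
    then show ?thesis using finish reflection_eqI[OF R(1,3) axx] by simp
  next
    case False
    then obtain k where k: "act b x = (2 * k + 1) * N - x" using loopB_moved[OF R(2) ab(2)] by blast
    define q where "q = 2 * k + 1"
    have bq: "act b x = q * N - x" using k by (simp add: q_def)
    have q: "q = 1 \<or> q = - 1"
      by (rule loops_translation[OF c adm(1) ab(1,2) nx ax bq]) (simp add: q_def)
    have wx: "act a (act b x) = x + q * N" using act_shift(2)[OF C(1), of q x] ax bq by simp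
    have q0: "q * N \<noteq> 0" using q N_ge_5 by auto
    have "act b' x \<noteq> x"
    proof
      assume b: "act b' x = x"
      then have e: "act a' x = x + q * N" using w[of x] wx by simp
      then have "act a' x \<noteq> x" using q0 by simp
      then obtain l where "act a' x = 2 * l * N - x" using loopA_moved[OF R(3) ab(3)] by blast
      then have "2 * x = (2 * l - q) * N" using e by (simp add: algebra_simps)
      then show False using ne by blast
    qed
    then obtain l where l: "act b' x = (2 * l + 1) * N - x" using loopB_moved[OF R(4) ab(4)] by blast
    have e: "(2 * l + 1) * N - act a' x = x + q * N"
      using w[of x] wx l act_shift(2)[OF C(3), of "2 * l + 1" x] by simp
    have "act a' x \<noteq> x"
    proof
      assume "act a' x = x"
      then have "2 * x = ((2 * l + 1) - q) * N" using e by (simp add: algebra_simps)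
      then show False using ne by blast
    qed
    then obtain p where p: "act a' x = 2 * p * N - x" using loopA_moved[OF R(3) ab(3)] by blast
    obtain a2 b2 where ab2: "a2 \<in> R" "b2 \<in> R" "hurwitz [a, b] [a2, b2]" "act a2 x = 2 * p * N - x"
      using translation_orbit[OF R(1,2) ax wx q, of p] by (elim exE conjE) (rule that)
    have "2 * p * N - x \<noteq> x" using ne[of "2 * p"] by auto
    then have a2: "a2 = a'" using reflection_eqI[OF ab2(1) R(3), of x] ab2(4) p by simp
    have "a2 \<otimes>\<^bsub>W\<^esub> b2 = a \<otimes>\<^bsub>W\<^esub> b"
      using hurwitz_R(3)[OF ab2(3)] R C ab2(1,2) R_carrier by (simp add: W.list_prod_simps)
    then have "b2 = b'" using eq a2 C R_carrier[OF ab2(2)] by simp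
    then show ?thesis using ab2(3) a2 by simp
  qed
qed

lemma sort_loop_pair:
  assumes "coxeter_like c" "admissible c [r, s]" "\<not> edge r" "\<not> edge s"
  shows "\<exists>a b. hurwitz [r, s] [a, b] \<and> loopA a \<and> loopB b"
proof -
  have R: "r \<in> R" "s \<in> R" using admissible_R[OF assms(2)] by auto
  note C = R[THEN R_carrier]
  note l = admissible_loops[OF assms(1,2)]
  show ?thesis
  proof (cases "loopA r")
    case True
    then have "loopB s" using l assms(4) by auto
    then show ?thesis using True by (intro exI[of _ r] exI[of _ s]) simp
  next
    case False
    then have rs: "loopB r" "loopA s" using l assms(3,4) by (auto split: if_splits)
    have "hurwitz [r, s] [r \<otimes>\<^bsub>W\<^esub> s \<otimes>\<^bsub>W\<^esub> inv\<^bsub>W\<^esub> r, r]"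
      using W.hurwitz_stepI[of "[]" r s "[]"] C by simp
    then show ?thesis using rs parity_conj[OF even_cuts(1) C] by blast
  qed
qed

text \<open>An edge would take some point away from its vertex, against
  \<open>no_edge_at_fixed_vertex\<close>. So all factors are loops, and with at most one of each
  class there are at most two.\<close>

lemma loops_transitive:
  assumes c: "coxeter_like c" and adm: "admissible c L" "admissible c L'" and eq: "prd L = prd L'" "length L = length L'"
    and fixed: "\<And>x. sim (act (prd L) x) x"
  shows "hurwitz L L'"
proof -
  have ne: "\<not> edge r" if "admissible c K" "prd K = prd L" "r \<in> set K" for K r
  proof
    assume e: "edge r"
    have r: "r \<in> R" using admissible_R that by blast
    from r obtain x y where xy: "act r = mirror x y" "mirror_pair x y" "\<not> sim x y"
      by (cases rule: reflE) (use e in auto)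
    have "act r x = y" using xy(1) mirror_add1[of x y 0] by simp
    then have "sim y x" using no_edge_at_fixed_vertex[OF c that(1) _ that(3), of x] fixed that(2) by simp
    then show False using xy(3) sim_sym by simp
  qed
  have R: "set L \<subseteq> R" "set L' \<subseteq> R" using admissible_R adm by auto
  have "edges L = 0" using ne[OF adm(1) refl] by (auto simp: filter_empty_conv)
  then have "length L \<le> 2" using length_types[OF R(1)] admissible_loops[OF c adm(1)] by linarith
  then consider "length L = 0" | "length L = 1" | "length L = 2" by linarith
  then show ?thesis
  proof cases
    case 1 then show ?thesis using eq by simp
  next
    case 2
    then obtain r r' where "L = [r]" "L' = [r']" using eq(2) by (auto simp: length_Suc_conv)
    then show ?thesis using eq(1) R R_carrier by (simp add: W.list_prod_simps)
  next
    case 3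
    then obtain r s r' s' where L: "L = [r, s]" "L' = [r', s']"
      using eq(2) by (auto simp: length_Suc_conv numeral_2_eq_2)
    obtain a b where ab: "hurwitz L [a, b]" "loopA a" "loopB b"
      using sort_loop_pair[OF c, of r s] adm(1) ne[OF adm(1) refl] L by auto
    obtain a' b' where ab': "hurwitz L' [a', b']" "loopA a'" "loopB b'"
      using sort_loop_pair[OF c, of r' s'] adm(2) ne[OF adm(2)] eq(1) L by auto
    have "prd [a, b] = prd [a', b']" using hurwitz_R(3)[OF ab(1) R(1)] hurwitz_R(3)[OF ab'(1) R(2)] eq(1) by simp
    moreover have "set [a, b] \<subseteq> R" "set [a', b'] \<subseteq> R" using hurwitz_R(1) ab(1) ab'(1) R by blast+
    ultimately have "a \<otimes>\<^bsub>W\<^esub> b = a' \<otimes>\<^bsub>W\<^esub> b'" using R_carrier by (simp add: W.list_prod_simps)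
    then have "hurwitz [a, b] [a', b']"
      by (intro sorted_loop_pairs[OF c]) (use admissible_hurwitz adm ab ab' in auto)
    from equivclp_trans[OF equivclp_trans[OF ab(1) this] equivclp_sym[OF ab'(1)]] show ?thesis .
  qed
qed

theorem hurwitz_transitive:
  assumes c: "coxeter_like c" and "admissible c L" "admissible c L'" "prd L = prd L'" "length L = length L'"
  shows "hurwitz L L'"
  using assms(2-5)
proof (induction "length L" arbitrary: L L')
  case 0
  then show ?case by simp
next
  case (Suc k)
  have R: "set L \<subseteq> R" "set L' \<subseteq> R" using admissible_R Suc.prems(1,2) by auto
  show ?case
  proof (cases "\<forall>x. sim (act (prd L) x) x")
    case True
    then show ?thesis using loops_transitive[OF c Suc.prems] by blast
  next
    case False
    then obtain x where x: "\<not> sim (act (prd L) x) x" by blast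
    obtain us r where u: "hurwitz L (us @ [r])" "act r x = act (prd L) x"
      using move_to_end[OF c Suc.prems(1) x] by blast
    obtain us' r' where u': "hurwitz L' (us' @ [r'])" "act r' x = act (prd L) x"
      using move_to_end[OF c Suc.prems(2)] x Suc.prems(3) by metis
    have uR: "set us \<subseteq> R" "r \<in> R" and uR': "set us' \<subseteq> R" "r' \<in> R"
      using hurwitz_R(1)[OF u(1) R(1)] hurwitz_R(1)[OF u'(1) R(2)] by auto
    have "act r x \<noteq> x" using x u(2) by auto
    from reflection_eqI[OF uR(2) uR'(2) this] have rr: "r' = r" using u(2) u'(2) by simp
    have "prd us \<otimes>\<^bsub>W\<^esub> r = prd us' \<otimes>\<^bsub>W\<^esub> r"
      using hurwitz_R(3)[OF u(1) R(1)] hurwitz_R(3)[OF u'(1) R(2)] Suc.prems(3) rr uR uR' by (simp add: prd_snoc)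
    then have pe: "prd us = prd us'" using uR uR' R_carrier by simp
    have len: "length us = k" "length us' = k"
      using hurwitz_R(2)[OF u(1) R(1)] hurwitz_R(2)[OF u'(1) R(2)] Suc.hyps(2) Suc.prems(4) by simp_all
    have "hurwitz us us'"
      using Suc.hyps(1)[of us us'] len pe admissible_append(1)[OF admissible_hurwitz[OF Suc.prems(1) u(1)]]
        admissible_append(1)[OF admissible_hurwitz[OF Suc.prems(2) u'(1)]] by simp
    then have "hurwitz (us @ [r]) (us' @ [r'])"
      using W.hurwitz_equiv_context[of us us' "[]" "[r]"] rr uR(2) R_carrier by simp
    from equivclp_trans[OF equivclp_trans[OF u(1) this] equivclp_sym[OF u'(1)]] show ?thesis .
  qed
qed

end

section \<open>Coxeter elements\<close>

context affine_C
begin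

section \<open>Orbits of Coxeter elements\<close>

definition signed_nodes :: "nat \<Rightarrow> int set" where
  "signed_nodes m = {x. \<exists>i. 1 \<le> i \<and> i \<le> m \<and> (x = int i \<or> x = - int i)}"

lemma finite_signed_nodes: "finite (signed_nodes m)"
proof -
  have "signed_nodes m \<subseteq> {- int m..int m}" by (auto simp: signed_nodes_def)
  then show ?thesis by (rule finite_subset) simp
qed

lemma signed_nodes_neg: "x \<in> signed_nodes m \<Longrightarrow> - x \<in> signed_nodes m"
  by (auto simp: signed_nodes_def)

lemma gen_map_signed_nodes:
  assumes "i \<le> m" "m < n" "x \<in> signed_nodes (Suc m)" shows "gen_map i x \<in> signed_nodes (Suc m)"
proof -
  have pos: "gen_map i (int j) \<in> signed_nodes (Suc m)" if j: "1 \<le> j" "j \<le> Suc m" for j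
  proof (cases "i = 0")
    case True
    have "gen_map i (int j) = int j \<or> gen_map i (int j) = - int j"
      using gen_map_0[of j] j assms True by auto
    then show ?thesis using j unfolding signed_nodes_def by blast
  next
    case False
    then have "\<exists>k. gen_map i (int j) = int k \<and> 1 \<le> k \<and> k \<le> Suc m"
      using gen_map_mid[of i j] j assms by (auto simp del: of_nat_Suc)
    then show ?thesis unfolding signed_nodes_def by blast
  qed
  from assms(3) obtain j where "1 \<le> j" "j \<le> Suc m" "x = int j \<or> x = - int j"
    unfolding signed_nodes_def by blast
  then show ?thesis using pos[of j] gen_map_neg[of i "int j"] signed_nodes_neg[of "gen_map i (int j)" "Suc m"] assms by auto
qed

lemma act_word_Cons: "i \<le> n \<Longrightarrow> set xs \<subseteq> S \<Longrightarrow> act (prd (map sr (i # xs))) z = gen_map i (act (prd (map sr xs)) z)"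
  by (simp add: prd_Cons act_mult act_sr)

lemma act_word_append: "set xs \<subseteq> S \<Longrightarrow> set ys \<subseteq> S \<Longrightarrow>
    act (prd (map sr (xs @ ys))) z = act (prd (map sr xs)) (act (prd (map sr ys)) z)"
proof (induction xs)
  case Nil
  show ?case by (simp add: W.list_prod_simps act_one)
next
  case (Cons i xs)
  then have "i \<le> n" "set xs \<subseteq> S" "set (xs @ ys) \<subseteq> S" by auto
  then show ?case using Cons.IH Cons.prems(2) by (simp only: append_Cons act_word_Cons)
qed

lemma act_word_signed_nodes:
  assumes "set xs \<subseteq> {0..m}" "m < n" "x \<in> signed_nodes (Suc m)"
  shows "act (prd (map sr xs)) x \<in> signed_nodes (Suc m)"
  using assms(1)
proof (induction xs)
  case Nil
  show ?case using assms(3) by (simp add: W.list_prod_simps act_one)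
next
  case (Cons i xs)
  then have "i \<le> m" "i \<le> n" "set xs \<subseteq> S" "set xs \<subseteq> {0..m}" using assms(2) by auto
  then show ?case using Cons.IH gen_map_signed_nodes[of i m] assms(2) by (simp only: act_word_Cons)
qed

lemma act_inj: "g \<in> carrier W \<Longrightarrow> act g x = act g y \<longleftrightarrow> x = y"
  using act_inv(1) by metis

lemma act_word_inv_signed_nodes:
  assumes "set xs \<subseteq> {0..m}" "m < n" "x \<in> signed_nodes (Suc m)"
  shows "act (inv\<^bsub>W\<^esub> (prd (map sr xs))) x \<in> signed_nodes (Suc m)"
proof -
  have "set xs \<subseteq> S" using assms by auto
  then have c: "prd (map sr xs) \<in> carrier W" by simp
  have "act (prd (map sr xs)) ` signed_nodes (Suc m) = signed_nodes (Suc m)"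
    by (rule endo_inj_surj) (use finite_signed_nodes act_word_signed_nodes[OF assms(1,2)] act_inj[OF c] in \<open>auto intro: inj_onI\<close>)
  then obtain y where "y \<in> signed_nodes (Suc m)" "x = act (prd (map sr xs)) y" using assms(3) by blast
  then show ?thesis using act_inv(1)[OF c] by simp
qed

lemma act_word_fixes:
  assumes "set xs \<subseteq> {0..m}" "Suc m < n"
  shows "act (prd (map sr xs)) (int (Suc (Suc m))) = int (Suc (Suc m))"
  using assms(1)
proof (induction xs)
  case Nil
  show ?case by (simp add: W.list_prod_simps act_one)
next
  case (Cons i xs)
  then have i: "i \<le> m" "i \<le> n" "set xs \<subseteq> S" "set xs \<subseteq> {0..m}" using assms(2) by auto
  have "gen_map i (int (Suc (Suc m))) = int (Suc (Suc m))"
    using gen_map_0[of "Suc (Suc m)"] gen_map_mid[of i "Suc (Suc m)"] i assms(2) by (cases "i = 0") auto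
  then show ?case using Cons.IH i by (simp only: act_word_Cons)
qed

text \<open>A Coxeter element of the parabolic subgroup generated by \<open>0, \<dots>, m\<close> permutes \<open>\<plusminus>1, \<dots>, \<plusminus>(m + 1)\<close> cyclically.
  Rotating the word puts \<open>m\<close> last, which then merges the fixed points \<open>\<plusminus>(m + 1)\<close> into the cycle on the rest.\<close>

lemma coxeter_word_cycle:
  assumes "distinct xs" "set xs = {0..m}" "m < n"
    and "\<And>x. x \<in> signed_nodes (Suc m) \<Longrightarrow> f (act (prd (map sr xs)) x) = (f x :: bool)"
    and "x \<in> signed_nodes (Suc m)" "y \<in> signed_nodes (Suc m)"
  shows "f x = f y"
  using assms
proof (induction m arbitrary: xs f x y)
  case 0
  have "xs = [0]"
  proof -
    have "length xs = 1" using 0 distinct_card[of xs] by simp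
    then show ?thesis using 0 by (auto simp: length_Suc_conv)
  qed
  then have a: "act (prd (map sr xs)) z = gen_map 0 z" for z by (simp add: W.list_prod_simps act_sr)
  have "f (- 1) = f 1"
    using "0.prems"(4)[of 1] gen_map_0[of 1] n_ge_2 unfolding a by (auto simp: signed_nodes_def)
  then show ?case using "0.prems"(5,6) by (auto simp: signed_nodes_def)
next
  case (Suc m)
  let ?k = "Suc m"
  obtain as bs where xs: "xs = as @ ?k # bs" using Suc.prems(2) split_list[of ?k xs] by auto
  have d: "distinct (bs @ as)" "?k \<notin> set as" "?k \<notin> set bs" using Suc.prems(1) xs by auto
  have st: "set (bs @ as) = {0..m}"
  proof -
    have "insert ?k (set (bs @ as)) = {0..?k}" using Suc.prems(2) xs by auto
    then have "set (bs @ as) = {0..?k} - {?k}" using d by auto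
    also have "\<dots> = {0..m}" by auto
    finally show ?thesis .
  qed
  have "{0..m} \<subseteq> S" using Suc.prems(3) by auto
  moreover have "set as \<subseteq> {0..m}" "set bs \<subseteq> {0..m}" using st by auto
  ultimately have sub: "set as \<subseteq> {0..m}" "set bs \<subseteq> {0..m}" "set as \<subseteq> S" "set bs \<subseteq> S" "set (bs @ as) \<subseteq> S"
    using st by blast+
  define A B where "A = prd (map sr as)" "B = prd (map sr bs)"
  have c: "A \<in> carrier W" "B \<in> carrier W" using sub by (simp_all add: A_B_def)
  let ?D = "signed_nodes (Suc ?k)"
  have bsk: "set bs \<subseteq> {0..?k}" using sub(2) by auto
  have Bi: "act (inv\<^bsub>W\<^esub> B) x \<in> ?D" "act B x \<in> ?D" if "x \<in> ?D" for x
    using act_word_inv_signed_nodes[OF bsk Suc.prems(3) that] act_word_signed_nodes[OF bsk Suc.prems(3) that]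
    by (simp_all add: A_B_def)
  \<comment> \<open>The word acts as \<open>A\<close>, generator \<open>?k\<close>, \<open>B\<close>
    in this order of the product; conjugation by \<open>B\<close> rotates it to \<open>B\<close>,
    \<open>A\<close>, \<open>?k\<close>, and \<open>f'\<close> is the label \<open>f\<close> after
    that change of coordinates.\<close>
  define f' where "f' x = f (act (inv\<^bsub>W\<^esub> B) x)" for x
  have ax: "act (prd (map sr xs)) x = act A (gen_map ?k (act B x))" for x
    using act_word_append[of as "?k # bs" x] act_word_Cons[of ?k bs x] sub Suc.prems(3) xs by (simp add: A_B_def del: list.map(2))
  have f': "f' (act B (act A (gen_map ?k x))) = f' x" if "x \<in> ?D" for x
    using Suc.prems(4)[OF Bi(1)[OF that]] act_inv[OF c(2)] by (simp add: ax f'_def)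
  have G: "act (prd (map sr (bs @ as))) x = act B (act A x)" for x
    using act_word_append[OF sub(4,3)] by (simp add: A_B_def)
  have fixG: "act B (act A (int (Suc ?k))) = int (Suc ?k)"
    using act_word_fixes[OF eq_refl[OF st] Suc.prems(3)] unfolding G .
  have fixG': "act B (act A (- int (Suc ?k))) = - int (Suc ?k)"
    by (simp only: act_shift(3)[OF c(1)] act_shift(3)[OF c(2)] fixG)
  have s: "gen_map ?k (int ?k) = int (Suc ?k)" "gen_map ?k (int (Suc ?k)) = int ?k"
    "gen_map ?k (- z) = - gen_map ?k z" for z
    using gen_map_mid[of ?k ?k] gen_map_mid[of ?k "Suc ?k"] gen_map_neg[of ?k] Suc.prems(3) by (simp_all del: of_nat_Suc)
  have kD: "int ?k \<in> ?D" "- int ?k \<in> ?D" unfolding signed_nodes_def by (auto intro!: exI[of _ ?k] simp del: of_nat_Suc)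
  have e: "f' (int (Suc ?k)) = f' (int ?k)" "f' (- int (Suc ?k)) = f' (- int ?k)"
    using f'[OF kD(1)] f'[OF kD(2)] by (simp_all only: s fixG fixG')
  have fs: "f' (gen_map ?k x) = f' x \<and> gen_map ?k x \<in> ?D" if x: "x \<in> signed_nodes ?k" for x
  proof -
    obtain i where i: "1 \<le> i" "i \<le> ?k" "x = int i \<or> x = - int i" using x unfolding signed_nodes_def by blast
    have "x \<in> ?D" using i le_SucI unfolding signed_nodes_def by blast
    then have D: "gen_map ?k x \<in> ?D" using gen_map_signed_nodes[of ?k ?k x] Suc.prems(3) by simp
    show ?thesis
    proof (cases "i = ?k")
      case True
      then show ?thesis using i(3) s e D by (auto simp del: of_nat_Suc)
    next
      case False
      then have "gen_map ?k (int i) = int i" using gen_map_mid[of ?k i] i Suc.prems(3) by simp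
      then have "gen_map ?k x = x" using i(3) s(3) by auto
      then show ?thesis using D by simp
    qed
  qed
  \<comment> \<open>On the old nodes \<open>f'\<close> does not notice the generator
    \<open>?k\<close>, so its invariance under the rotated word becomes invariance under the shorter
    word, to which the induction hypothesis applies.\<close>
  have inv: "f' (act (prd (map sr (bs @ as))) x) = f' x" if x: "x \<in> signed_nodes ?k" for x
    using f'[of "gen_map ?k x"] fs[OF x] gen_map_involution[of ?k x] Suc.prems(3) G by simp
  have const: "f' x = f' y" if "x \<in> signed_nodes ?k" "y \<in> signed_nodes ?k" for x y
    by (rule Suc.IH[of "bs @ as" f' x y, OF d(1) st _ inv that]) (use Suc.prems(3) in auto)
  have k': "int ?k \<in> signed_nodes ?k" "- int ?k \<in> signed_nodes ?k"
    unfolding signed_nodes_def by (auto intro!: exI[of _ ?k] simp del: of_nat_Suc)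
  have all: "f' x = f' (int ?k)" if "x \<in> ?D" for x
  proof -
    obtain i where i: "1 \<le> i" "i \<le> Suc ?k" "x = int i \<or> x = - int i" using \<open>x \<in> ?D\<close> unfolding signed_nodes_def by blast
    show ?thesis
    proof (cases "i = Suc ?k")
      case True
      then show ?thesis using i(3) e const[OF k'(1,2)] by (auto simp del: of_nat_Suc)
    next
      case False
      then have "x \<in> signed_nodes ?k" using i unfolding signed_nodes_def by auto
      then show ?thesis using const k'(1) by blast
    qed
  qed
  have "f x = f' (act B x)" for x using act_inv(1)[OF c(2)] by (simp add: f'_def)
  then show ?case using all Bi(2) Suc.prems(5,6) by metis
qed

text \<open>The word acts on the signed nodes as a single cycle. Dropping the arrows that leave
  \<open>p\<close> and \<open>- p\<close> cuts the cycle into two arcs, one ending at each of these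
  points; the arc that begins at the image of \<open>p\<close> is the one ending at
  \<open>- p\<close>.\<close>

lemma coxeter_word_halves:
  assumes xs: "distinct xs" "set xs = {0..m}" "m < n"
    and p: "p \<in> signed_nodes (Suc m)"
    and f: "\<And>x. x \<in> signed_nodes (Suc m) \<Longrightarrow> x \<noteq> p \<Longrightarrow> x \<noteq> - p \<Longrightarrow> f (act (prd (map sr xs)) x) = f x"
  shows "x \<in> signed_nodes (Suc m) \<Longrightarrow> f x = f p \<or> f x = f (- p)"
    and "f (act (prd (map sr xs)) p) = f (- p)"
proof -
  let ?D = "signed_nodes (Suc m)" and ?g = "act (prd (map sr xs))"
  have c: "prd (map sr xs) \<in> carrier W" using xs by simp
  have D: "?g x \<in> ?D" if "x \<in> ?D" for x using act_word_signed_nodes[OF _ xs(3) that] xs(2) by simp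
  \<comment> \<open>A nonempty subset of a cycle that is closed under it is the whole cycle; below,
    \<open>A\<close> consists of points selected by their label.\<close>
  have closed: "A = ?D" if "A \<subseteq> ?D" "\<And>x. x \<in> A \<Longrightarrow> ?g x \<in> A" "z \<in> A" for A z
  proof -
    have "finite A" using that(1) finite_signed_nodes finite_subset by blast
    then have "?g ` A = A" using that(2) act_inj[OF c] by (intro endo_inj_surj) (auto intro: inj_onI)
    then have "?g x \<in> A \<longleftrightarrow> x \<in> A" for x using inj_image_mem_iff[of ?g x A] act_inj[OF c] by (simp add: inj_def)
    then have "x \<in> A \<longleftrightarrow> z \<in> A" if "x \<in> ?D" for x
      using coxeter_word_cycle[OF xs, of "\<lambda>x. x \<in> A" x z] that \<open>z \<in> A\<close> \<open>A \<subseteq> ?D\<close> by blast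
    then show ?thesis using that by blast
  qed
  have np: "- p \<in> ?D" using p signed_nodes_neg by blast
  have i: "f x = f p \<or> f x = f (- p)" if "x \<in> ?D" for x
  proof (rule ccontr)
    assume n: "\<not> ?thesis"
    let ?A = "{x \<in> ?D. f x \<noteq> f p \<and> f x \<noteq> f (- p)}"
    have "?A = ?D"
    proof (rule closed)
      show "x \<in> ?A" using n that by simp
      fix y assume y: "y \<in> ?A"
      then have "f (?g y) = f y" by (intro f) auto
      then show "?g y \<in> ?A" using y D by simp
    qed auto
    then show False using p by blast
  qed
  then show "x \<in> ?D \<Longrightarrow> f x = f p \<or> f x = f (- p)" .
  show "f (?g p) = f (- p)"
  proof (rule ccontr)
    assume n: "f (?g p) \<noteq> f (- p)"
    then have gp: "f (?g p) = f p" using i[OF D[OF p]] by auto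
    let ?A = "{x \<in> ?D. f x = f p}"
    have "?A = ?D"
    proof (rule closed)
      show "p \<in> ?A" using p by simp
      fix y assume y: "y \<in> ?A"
      then have "y \<noteq> - p" using n gp by auto
      then have "f (?g y) = f y" using gp f[of y] y by (cases "y = p") auto
      then show "?g y \<in> ?A" using y D by simp
    qed auto
    then have "- p \<in> ?A" using np by simp
    then show False using n gp by simp
  qed
qed

lemma X_blocks: assumes "\<not> N dvd z" obtains x k where "x \<in> signed_nodes n" "z = x + k * N"
proof (rule nodeE[of z])
  fix x k assume *: "x \<le> n" "z = int x + k * N"
  then have "x \<noteq> 0" using assms by (intro notI) simp
  then show ?thesis using that[of "int x" k] * by (auto simp: signed_nodes_def)
next
  fix x k assume *: "x \<le> n" "z = k * N - int x"
  then have "x \<noteq> 0" using assms by (intro notI) simp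
  then show ?thesis using that[of "- int x" k] * by (auto simp: signed_nodes_def)
qed

text \<open>Generator \<open>n\<close> fixes the signed nodes other than \<plusminus>n, so on each
  translate by k N the label satisfies the hypotheses of \<open>coxeter_word_halves\<close>. It
  sends n + k N to - n in the block k + 1, whose image begins the arc that ends at n in that block.
  So the label of n + k N is independent of k, and the points - n + k N are linked downwards in the
  same way: two orbits remain.\<close>

lemma coxeter_word_labels:
  fixes f :: "int \<Rightarrow> int"
  assumes xs: "distinct xs" "set xs = {0..<n}"
    and f: "\<And>z. f (act (prd (map sr xs)) (gen_map n z)) = f z" and z: "\<not> N dvd z"
  shows "f z = f (int n) \<or> f z = f (- int n)"
proof -
  obtain m where m: "n = Suc m" using n_ge_2 by (cases n) auto
  have xs': "set xs = {0..m}" "m < n" by (simp_all only: xs(2) m atLeastLessThanSuc_atLeastAtMost lessI)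
  let ?g = "act (prd (map sr xs))"
  have "set xs \<subseteq> S" using xs(2) by auto
  then have c: "prd (map sr xs) \<in> carrier W" by simp
  have nD: "int n \<in> signed_nodes (Suc m)" "- int n \<in> signed_nodes (Suc m)" using m by (auto simp: signed_nodes_def)
  have sn: "gen_map n (int n + k * N) = (k + 1) * N - int n" "gen_map n (- int n + k * N) = (k - 1) * N + int n" for k
  proof -
    have s: "gen_map n (int n) = N - int n" "gen_map n (- int n) = int n - N"
      using gen_map_n[of n] gen_map_neg[of n "int n"] by simp_all
    show "gen_map n (int n + k * N) = (k + 1) * N - int n" "gen_map n (- int n + k * N) = (k - 1) * N + int n"
      unfolding equivariant_add[OF equivariant_gen_map[OF order_refl]] s by (simp_all add: algebra_simps)
  qed
  have block: "f (?g x + k * N) = f (x + k * N)"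
    if x: "x \<in> signed_nodes (Suc m)" "x \<noteq> int n" "x \<noteq> - int n" for x k
  proof -
    obtain i where i: "1 \<le> i" "i \<le> n" "x = int i \<or> x = - int i" using x m unfolding signed_nodes_def by blast
    then have "gen_map n x = x" using x gen_map_n[of i] gen_map_neg[of n "int i"] by auto
    then have "gen_map n (x + k * N) = x + k * N" using equivariant_add[OF equivariant_gen_map[of n]] by simp
    then show ?thesis using f[of "x + k * N"] act_shift(1)[OF c] by simp
  qed
  have F: "f (x + k * N) = f (int n + k * N) \<or> f (x + k * N) = f (- int n + k * N)"
      if "x \<in> signed_nodes (Suc m)" for x k
    using coxeter_word_halves(1)[OF xs(1) xs' nD(1), of "\<lambda>x. f (x + k * N)" x] block that by blast
  have G: "f (?g (int n) + k * N) = f (- int n + k * N)" "f (?g (- int n) + k * N) = f (int n + k * N)" for k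
    using coxeter_word_halves(2)[OF xs(1) xs' nD(1), of "\<lambda>x. f (x + k * N)"]
      coxeter_word_halves(2)[OF xs(1) xs' nD(2), of "\<lambda>x. f (x + k * N)"] block by auto
  have up: "f (int n + k * N) = f (int n + (k + 1) * N)" for k
  proof -
    have "f (int n + k * N) = f (?g ((k + 1) * N - int n))" using f[of "int n + k * N"] sn(1)[of k] by simp
    also have "?g ((k + 1) * N - int n) = ?g (- int n) + (k + 1) * N"
      using act_shift(1)[OF c, of "- int n" "k + 1"] by simp
    finally show ?thesis using G(2) by simp
  qed
  have down: "f (- int n + k * N) = f (- int n + (k - 1) * N)" for k
  proof -
    have "f (- int n + k * N) = f (?g ((k - 1) * N + int n))" using f[of "- int n + k * N"] sn(2)[of k] by simp
    also have "?g ((k - 1) * N + int n) = ?g (int n) + (k - 1) * N"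
      using act_shift(1)[OF c, of "int n" "k - 1"] by (simp add: add.commute)
    finally show ?thesis using G(1) by simp
  qed
  have ups: "f (int n + k * N) = f (int n)" for k
  proof (induction k rule: int_induct[of _ 0])
    case (step1 i) then show ?case using up[of i] by simp
  next
    case (step2 i) then show ?case using up[of "i - 1"] by simp
  qed simp
  have downs: "f (- int n + k * N) = f (- int n)" for k
  proof (induction k rule: int_induct[of _ 0])
    case (step1 i) then show ?case using down[of "i + 1"] by simp
  next
    case (step2 i) then show ?case using down[of i] by simp
  qed simp
  obtain x k where "x \<in> signed_nodes n" "z = x + k * N" using z by (rule X_blocks)
  then show ?thesis using F[of x k] ups downs m by simp
qed

lemma parity_word:
  assumes "even_cut J" "set xs \<subseteq> S"
  shows "parity J (prd (map sr xs)) = odd (length (filter (\<lambda>i. i \<in> J) xs))"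
  using assms(2) by (induction xs) (auto simp: W.list_prod_simps parity_one parity_mult parity_sr assms(1))

text \<open>Every generator occurs once, which makes both parities odd. Splitting the word at
  \<open>n\<close> into \<open>as\<close> and \<open>bs\<close>, conjugation by \<open>B\<close>
  puts generator \<open>n\<close> last as \<open>coxeter_word_labels\<close> expects; undoing it
  turns the points \<plusminus>n into \<plusminus> \<open>?x0\<close>.\<close>

lemma coxeter_like_coxeter_element:
  assumes "is_coxeter_element S M c" shows "coxeter_like c"
proof -
  obtain xs where xs: "distinct xs" "set xs = S" "c = prd (map sr xs)"
    using assms by (auto simp: is_coxeter_element_def)
  have cc: "c \<in> carrier W" using xs by simp
  have "length (filter (\<lambda>i. i \<in> {j}) xs) = 1" if "j \<le> n" for j
  proof -
    have "{i. i \<in> {j}} \<inter> set xs = {j}" using xs(2) that by auto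
    then show ?thesis using distinct_length_filter[OF xs(1), of "\<lambda>i. i \<in> {j}"] by simp
  qed
  then have par: "loopA c" "loopB c"
    using parity_word[OF even_cuts(1), of xs] parity_word[OF even_cuts(2), of xs] xs by auto
  obtain as bs where ab: "xs = as @ n # bs" using xs(2) split_list[of n xs] by auto
  have d: "distinct (bs @ as)" "n \<notin> set as" "n \<notin> set bs" using xs(1) ab by auto
  have st: "set (bs @ as) = {0..<n}"
  proof -
    have "insert n (set (bs @ as)) = {0..n}" using xs(2) ab by auto
    then have "set (bs @ as) = {0..n} - {n}" using d by auto
    also have "\<dots> = {0..<n}" by auto
    finally show ?thesis .
  qed
  have sub: "set as \<subseteq> S" "set bs \<subseteq> S" using xs(2) ab by auto
  define A B where "A = prd (map sr as)" "B = prd (map sr bs)"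
  have c: "A \<in> carrier W" "B \<in> carrier W" using sub by (simp_all add: A_B_def)
  have ac: "act c x = act A (gen_map n (act B x))" for x
    using act_word_append[of as "n # bs" x] act_word_Cons[of n bs x] sub xs(3) ab by (simp add: A_B_def del: list.map(2))
  have G: "act (prd (map sr (bs @ as))) x = act B (act A x)" for x
    using act_word_append[OF sub(2,1)] by (simp add: A_B_def)
  let ?x0 = "act (inv\<^bsub>W\<^esub> B) (int n)"
  have "f x = f ?x0 \<or> f x = f (- ?x0)" if f: "\<forall>z. f (act c z) = f z" and x: "\<not> N dvd x" for f :: "int \<Rightarrow> int" and x
  proof -
    define f' where "f' z = f (act (inv\<^bsub>W\<^esub> B) z)" for z
    have f': "f' (act (prd (map sr (bs @ as))) (gen_map n z)) = f' z" for z
    proof -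
      have "f (act c (act (inv\<^bsub>W\<^esub> B) z)) = f (act (inv\<^bsub>W\<^esub> B) z)" using f by blast
      then show ?thesis unfolding f'_def G ac act_inv[OF c(2)] .
    qed
    have "\<not> N dvd act B x"
    proof
      assume "N dvd act B x"
      then have "sim (act B x) 0" by (simp add: sim_def)
      from equivariant_sim[OF equivariant_act[OF W.inv_closed[OF c(2)]] this] have "sim x 0"
        using act_inv(1)[OF c(2)] equivariant_0[OF equivariant_act[OF W.inv_closed[OF c(2)]]] by simp
      then show False using x by (simp add: sim_def)
    qed
    from coxeter_word_labels[where f = f', OF d(1) st f' this]
    show ?thesis using act_inv(1)[OF c(2)] act_shift(3)[OF W.inv_closed[OF c(2)]] by (simp add: f'_def)
  qed
  then show ?thesis unfolding coxeter_like_def using cc par by blast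
qed

section \<open>Reflection length and divisors\<close>

lemma sr_R: "i \<le> n \<Longrightarrow> sr i \<in> R"
proof -
  assume i: "i \<le> n"
  have "sr i = \<one>\<^bsub>W\<^esub> \<otimes>\<^bsub>W\<^esub> sr i \<otimes>\<^bsub>W\<^esub> inv\<^bsub>W\<^esub> \<one>\<^bsub>W\<^esub>" using i by simp
  then show ?thesis using i W.one_closed unfolding reflections_def by fastforce
qed

lemma reflection_length_attained:
  assumes "w \<in> carrier W"
  obtains L where "length L = reflection_length S M w" "set L \<subseteq> R" "prd L = w"
proof -
  obtain xs where xs: "set xs \<subseteq> S" "w = prd (map sr xs)" using carrier_word[OF assms] by metis
  then have "length (map sr xs) = length xs \<and> set (map sr xs) \<subseteq> R \<and> prd (map sr xs) = w" using sr_R by auto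
  then have "\<exists>L. length L = length xs \<and> set L \<subseteq> R \<and> prd L = w" by blast
  then have "\<exists>L. length L = reflection_length S M w \<and> set L \<subseteq> R \<and> prd L = w"
    unfolding reflection_length_def by (rule LeastI)
  then show ?thesis using that by blast
qed

lemma reflection_length_le: "set L \<subseteq> R \<Longrightarrow> reflection_length S M (prd L) \<le> length L"
  unfolding reflection_length_def by (rule Least_le) auto

lemma reflection_length_coxeter_element:
  assumes "is_coxeter_element S M c" shows "reflection_length S M c = Suc n"
proof -
  have c: "coxeter_like c" by (rule coxeter_like_coxeter_element[OF assms])
  obtain xs where xs: "distinct xs" "set xs = S" "c = prd (map sr xs)"
    using assms by (auto simp: is_coxeter_element_def)
  have "length xs = Suc n" using distinct_card[OF xs(1)] xs(2) by simp
  moreover have "set (map sr xs) \<subseteq> R" using xs(2) sr_R by auto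
  ultimately have "reflection_length S M c \<le> Suc n" using reflection_length_le[of "map sr xs"] xs(3) by simp
  moreover have "c \<in> carrier W" using c by (simp add: coxeter_like_def)
  then obtain L where "length L = reflection_length S M c" "set L \<subseteq> R" "prd L = c"
    by (rule reflection_length_attained)
  then have "Suc n \<le> reflection_length S M c" using coxeter_like_length(1)[OF c] by metis
  ultimately show ?thesis by simp
qed

text \<open>A shortest decomposition of the complement of \<open>w\<close> in \<open>c\<close>
  completes \<open>L\<close>, and the divisor condition says that the lengths add up to n +
  1.\<close>

lemma divisor_admissible:
  assumes "is_coxeter_element S M c" "w \<in> carrier W" "is_divisor S M w c" "L \<in> reduced_decompositions S M w"
  shows "admissible c L"
proof -
  have L: "length L = reflection_length S M w" "set L \<subseteq> R" "prd L = w"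
    using assms(4) by (auto simp: reduced_decompositions_def)
  have c: "c \<in> carrier W" using coxeter_like_coxeter_element[OF assms(1)] by (simp add: coxeter_like_def)
  obtain us where us: "length us = reflection_length S M (inv\<^bsub>W\<^esub> w \<otimes>\<^bsub>W\<^esub> c)" "set us \<subseteq> R" "prd us = inv\<^bsub>W\<^esub> w \<otimes>\<^bsub>W\<^esub> c"
    by (rule reflection_length_attained[of "inv\<^bsub>W\<^esub> w \<otimes>\<^bsub>W\<^esub> c"]) (use assms(2) c in auto)
  have "prd (L @ us) = c" using L us assms(2) c by (simp add: prd_append W.inv_cancel_left)
  moreover have "length (L @ us) = Suc n"
    using L us assms(3) reflection_length_coxeter_element[OF assms(1)] by (simp add: is_divisor_def)
  ultimately show ?thesis unfolding admissible_def using L us by (intro exI[of _ "[]"] exI[of _ us]) simp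
qed

end

theorem theorem7p1:
  fixes n :: nat and c w :: "nat word set"
  assumes "n \<ge> 2"
    and "is_coxeter_element {0..n} (affine_C_matrix n) c"
    and "w \<in> carrier (coxeter_group {0..n} (affine_C_matrix n))"
    and "is_divisor {0..n} (affine_C_matrix n) w c"
  shows "transitive_action (braid_group (reflection_length {0..n} (affine_C_matrix n) w))
    (reduced_decompositions {0..n} (affine_C_matrix n) w)
    (hurwitz_action (coxeter_group {0..n} (affine_C_matrix n))
      (reduced_decompositions {0..n} (affine_C_matrix n) w))"
proof -
  interpret affine_C n by (rule affine_C.intro) (rule assms(1))
  let ?E = "reduced_decompositions S M w" and ?k = "reflection_length S M w"
  have "\<exists>\<beta>\<in>carrier (braid_group ?k). hurwitz_action W ?E \<beta> L = L'" if L: "L \<in> ?E" "L' \<in> ?E" for L L'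
  proof -
    have R: "set L \<subseteq> R" "length L = ?k" "length L = length L'" "prd L = prd L'"
      using L by (auto simp: reduced_decompositions_def)
    have "hurwitz L L'"
      by (rule hurwitz_transitive[OF coxeter_like_coxeter_element[OF assms(2)] _ _ R(4,3)])
        (use divisor_admissible[OF assms(2-4)] L in auto)
    then have "set L' \<subseteq> R \<and> length L' = length L \<and> prd L' = prd L
        \<and> (\<exists>u\<in>words {i. Suc i < length L}. hurwitz_word W u L = L')"
      by (rule W.hurwitz_equiv_invariant[OF _ reflections_carrier _ R(1)])
        (intro conjI R_conj R_conj' R_carrier)
    then obtain u where u: "u \<in> words {i. Suc i < ?k}" "hurwitz_word W u L = L'"
      unfolding R(2) by blast
    let ?\<beta> = "pres_cong {i. Suc i < ?k} braid_relations `` {u}"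
    have "?E \<subseteq> tuples W ?k" using R_carrier by (auto simp: reduced_decompositions_def)
    then have "hurwitz_action W ?E ?\<beta> L = L'" using W.hurwitz_action_class u L(1) by simp
    moreover have "?\<beta> \<in> carrier (braid_group ?k)"
      using u(1) by (simp add: braid_group_def presented_group_def quotientI)
    ultimately show ?thesis by blast
  qed
  then show ?thesis
    using group_action_reduced_decompositions by (intro transitive_action.intro transitive_action_axioms.intro)
qed

end
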